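(* For integers $m\geq 1$, $r\geq 0$, $s\geq 0$, the number $t_{m,r,s}$ of $r$-heavy rectangulations with $m$ tiles and $s$ singular vertices is given by $$t_{m,r,s}=\sum_{\bar m,\bar r,\bar s,c}(-1)^{c+1}\binom{\ell-1}{c-1}\binom{\bar r+2-\ell}{c}\binom{\ell-c}{\Delta s}\binom{\Delta m-c-\Delta s+\ell-1}{\ell-1}\,t_{\bar m,\bar r,\bar s},$$ where the sum ranges over all integer tuples $(\bar m,\bar r,\bar s,c)$ with $1\leq \bar m\leq m-1$, $0\leq \bar r\leq \bar m-1$, $0\leq \bar s\leq s$ and $1\leq c\leq \lceil(\bar r+1)/2\rceil$, and where $\Delta s=s-\bar s$, $\Delta m=m-\bar m$, $\Delta r=r-\bar r$, $\ell=\Delta m-\Delta r$. The base of the recursion is $t_{k,k-1,0}=1$ for $k\geq 1$.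
   Context: A tiling of the unit square is a decomposition into finitely many axis-parallel rectangles (tiles) with disjoint interiors. Two tilings are combinatorially equivalent if there is a homeomorphism of the square taking one (its $1$-skeleton) to the other that fixes the four corners of the square and preserves horizontality and verticality of line segments. A rectangulation is a combinatorial equivalence class of tilings. A vertex of a rectangulation is singular if four rectangles meet there at a corner (i.e. it is a crossing of a horizontal and a vertical segment). A rectangulation is $r$-heavy if exactly $r$ edges of it hit the interior of the right side of the square. *)

theory Defs
  imports "HOL-Analysis.Analysis"
begin

text \<open>A tile is an axis-parallel rectangle, given by its lower-left and upper-right corner.\<close>
type_synonym tile = "(real \<times> real) \<times> (real \<times> real)"

definition tile_ok :: "tile \<Rightarrow> bool" where
  "tile_ok t \<longleftrightarrow> fst (fst t) < fst (snd t) \<and> snd (fst t) < snd (snd t)"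

definition tile_set :: "tile \<Rightarrow> (real \<times> real) set" where
  "tile_set t = {fst (fst t)..fst (snd t)} \<times> {snd (fst t)..snd (snd t)}"

definition tile_interior :: "tile \<Rightarrow> (real \<times> real) set" where
  "tile_interior t = {fst (fst t)<..<fst (snd t)} \<times> {snd (fst t)<..<snd (snd t)}"

definition tile_corners :: "tile \<Rightarrow> (real \<times> real) set" where
  "tile_corners t = {(fst (fst t), snd (fst t)), (fst (fst t), snd (snd t)),
                     (fst (snd t), snd (fst t)), (fst (snd t), snd (snd t))}"

definition unit_square :: "(real \<times> real) set" where
  "unit_square = {0..1} \<times> {0..1}"

definition is_tiling :: "tile set \<Rightarrow> bool" where
  "is_tiling T \<longleftrightarrow> finite T \<and> T \<noteq> {} \<and>
     (\<forall>t\<in>T. tile_ok t \<and> tile_set t \<subseteq> unit_square) \<and>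
     (\<Union>t\<in>T. tile_set t) = unit_square \<and>
     (\<forall>t\<in>T. \<forall>u\<in>T. t \<noteq> u \<longrightarrow> tile_interior t \<inter> tile_interior u = {})"

definition skeleton :: "tile set \<Rightarrow> (real \<times> real) set" where
  "skeleton T = (\<Union>t\<in>T. tile_set t - tile_interior t)"

definition hseg :: "(real \<times> real) set \<Rightarrow> bool" where
  "hseg S \<longleftrightarrow> (\<exists>a b y. a < b \<and> S = {a..b} \<times> {y})"

definition vseg :: "(real \<times> real) set \<Rightarrow> bool" where
  "vseg S \<longleftrightarrow> (\<exists>x a b. a < b \<and> S = {x} \<times> {a..b})"

definition comb_equiv :: "tile set \<Rightarrow> tile set \<Rightarrow> bool" where
  "comb_equiv T T' \<longleftrightarrow> (\<exists>f g. homeomorphism unit_square unit_square f g \<and>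
     f (0,0) = (0,0) \<and> f (1,0) = (1,0) \<and> f (0,1) = (0,1) \<and> f (1,1) = (1,1) \<and>
     f ` skeleton T = skeleton T' \<and>
     (\<forall>S \<subseteq> skeleton T. (hseg S \<longrightarrow> hseg (f ` S)) \<and> (vseg S \<longrightarrow> vseg (f ` S))) \<and>
     (\<forall>S \<subseteq> skeleton T'. (hseg S \<longrightarrow> hseg (g ` S)) \<and> (vseg S \<longrightarrow> vseg (g ` S))))"

definition rect_class :: "tile set \<Rightarrow> tile set set" where
  "rect_class T = {T'. is_tiling T' \<and> comb_equiv T T'}"

definition singular_vertices :: "tile set \<Rightarrow> (real \<times> real) set" where
  "singular_vertices T = {p. card {t\<in>T. p \<in> tile_corners t} = 4}"

definition right_hits :: "tile set \<Rightarrow> real set" where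
  "right_hits T = {y. 0 < y \<and> y < 1 \<and>
     (\<exists>t\<in>T. fst (snd t) = 1 \<and> (snd (fst t) = y \<or> snd (snd t) = y))}"

definition t_count :: "nat \<Rightarrow> nat \<Rightarrow> nat \<Rightarrow> nat" where
  "t_count m r s = card {rect_class T | T. is_tiling T \<and> card T = m \<and>
      card (right_hits T) = r \<and> card (singular_vertices T) = s}"

definition binom :: "int \<Rightarrow> int \<Rightarrow> int" where
  "binom n k = (if 0 \<le> n \<and> 0 \<le> k then int (nat n choose nat k) else 0)"

end

theory Submission
  imports Defs "HOL-Combinatorics.Multiset_Permutations"
begin

text \<open>Call a block of tiles on the right side removable if it is bounded on the left by one vertical
  segment, is crossed by no further vertical segment, and the horizontal segments bounding it carry no
  further vertices. Deleting its left side and its tiles, and prolonging to the right the edges that end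
  there from the left, gives a smaller tiling. Every tiling other than a stack of horizontal strips has a
  removable block, namely next to the rightmost among the left sides of the tiles on the right, and
  distinct removable blocks are separated. Always removing the lowest block therefore encodes a
  rectangulation uniquely as a sequence of gluings in which no block lies strictly above its predecessor.
  Both gluing and removal are compatible with combinatorial equivalence.

  Let \<open>F c\<close> be the number of ways to glue \<open>c\<close> separated blocks to a rectangulation, and \<open>H c\<close> the number
  of those in which the lowest new block is the lowest removable block after gluing it alone. In the
  remaining cases the lowest block of the rectangulation lies below all the new ones and may be counted
  among them, so \<open>F c = H c + H (c + 1)\<close>. Hence \<open>H 1 = F 1 - F 2 + F 3 - \<dots>\<close>, which is the recursion: \<open>H 1\<close>
  counts the rectangulations that are not stacks, and \<open>F c\<close> is a product of binomial coefficients for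
  the positions of the blocks and the interleavings of the edges on their left and right.\<close>

section \<open>Tilings and their skeletons\<close>

text \<open>The obstacle is that an equivalence is an arbitrary homeomorphism: nothing controls it
  inside the tiles, and a line outside the skeleton may be mapped to any arc. Undoing two gluings is
  unaffected, since the block is bounded by the skeleton and the map can be replaced inside it.
  Performing them is affected: the new left side is drawn where an equivalence of the smaller
  tilings need not be straight. Gluing is therefore handled with a stronger relation, equivalence by
  a map of product form near the right side, which gluing preserves and which holds between any two
  realizations of one code. Different codes are separated for arbitrary equivalences. The two halves
  together identify classes with codes without ever straightening a given equivalence. Blocks must
  be described without real coordinates: the lower end by its rank among the heights on the right
  side, the inside by the order in which edges from the left and from the right meet the left side.
  With the two corners there are r + 2 such heights, and separated blocks use at least two each;
  this is the bound on c in the sum.\<close>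

definition xl :: "tile \<Rightarrow> real" where "xl t = fst (fst t)"
definition yl :: "tile \<Rightarrow> real" where "yl t = snd (fst t)"
definition xr :: "tile \<Rightarrow> real" where "xr t = fst (snd t)"
definition yr :: "tile \<Rightarrow> real" where "yr t = snd (snd t)"

lemmas tile_sel_defs = xl_def yl_def xr_def yr_def

lemma tile_sel [simp]:
  "xl ((a, c), (b, d)) = a" "yl ((a, c), (b, d)) = c" "xr ((a, c), (b, d)) = b" "yr ((a, c), (b, d)) = d"
  by (simp_all add: tile_sel_defs)

lemma mem_unit_square: "(x, y) \<in> unit_square \<longleftrightarrow> 0 \<le> x \<and> x \<le> 1 \<and> 0 \<le> y \<and> y \<le> 1"
  by (auto simp: unit_square_def)

lemma mem_tile_set: "(x, y) \<in> tile_set t \<longleftrightarrow> xl t \<le> x \<and> x \<le> xr t \<and> yl t \<le> y \<and> y \<le> yr t"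
  by (auto simp: tile_set_def tile_sel_defs)

lemma mem_tile_interior: "(x, y) \<in> tile_interior t \<longleftrightarrow> xl t < x \<and> x < xr t \<and> yl t < y \<and> y < yr t"
  by (auto simp: tile_interior_def tile_sel_defs)

lemma tile_eq_iff: "t = u \<longleftrightarrow> xl t = xl u \<and> yl t = yl u \<and> xr t = xr u \<and> yr t = yr u"
  by (auto simp: prod_eq_iff tile_sel_defs)

lemma tiling_finite: "is_tiling T \<Longrightarrow> finite T"
  by (simp add: is_tiling_def)

lemma tile_bounds:
  assumes "is_tiling T" "t \<in> T"
  shows "0 \<le> xl t" "xl t < xr t" "xr t \<le> 1" "0 \<le> yl t" "yl t < yr t" "yr t \<le> 1"
proof -
  have ok: "tile_ok t" and sub: "tile_set t \<subseteq> unit_square"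
    using assms by (auto simp: is_tiling_def)
  show *: "xl t < xr t" "yl t < yr t" using ok by (auto simp: tile_ok_def tile_sel_defs)
  have "(xl t, yl t) \<in> tile_set t" "(xr t, yr t) \<in> tile_set t"
    using * by (auto simp: mem_tile_set)
  then have "(xl t, yl t) \<in> unit_square" "(xr t, yr t) \<in> unit_square"
    using sub by blast+
  then show "0 \<le> xl t" "xr t \<le> 1" "0 \<le> yl t" "yr t \<le> 1"
    by (auto simp: mem_unit_square)
qed

lemma tile_interiors_meet:
  assumes "xl t < xr t" "yl t < yr t" "xl u < xr u" "yl u < yr u"
    "xl t < xr u" "xl u < xr t" "yl t < yr u" "yl u < yr t"
  shows "tile_interior t \<inter> tile_interior u \<noteq> {}"
proof -
  obtain x where "max (xl t) (xl u) < x" "x < min (xr t) (xr u)"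
    using assms dense[of "max (xl t) (xl u)" "min (xr t) (xr u)"] by auto
  moreover obtain y where "max (yl t) (yl u) < y" "y < min (yr t) (yr u)"
    using assms dense[of "max (yl t) (yl u)" "min (yr t) (yr u)"] by auto
  ultimately have "(x, y) \<in> tile_interior t \<inter> tile_interior u"
    by (auto simp: mem_tile_interior)
  then show ?thesis by blast
qed

text \<open>If the open extents of two tiles overlap along both axes, the open tiles share a point.
  This is the form in which disjointness is used throughout.\<close>

lemma tile_eqI:
  assumes "is_tiling T" "t \<in> T" "u \<in> T"
    "xl t < xr u" "xl u < xr t" "yl t < yr u" "yl u < yr t"
  shows "t = u"
proof (rule ccontr)
  assume "t \<noteq> u"
  then have "tile_interior t \<inter> tile_interior u = {}"
    using assms(1-3) by (auto simp: is_tiling_def)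
  moreover have "tile_interior t \<inter> tile_interior u \<noteq> {}"
    using tile_bounds[OF assms(1,2)] tile_bounds[OF assms(1,3)] assms(4-7)
    by (intro tile_interiors_meet) auto
  ultimately show False by blast
qed

lemma is_tilingI:
  assumes "finite T"
    and "\<And>t. t \<in> T \<Longrightarrow> 0 \<le> xl t \<and> xl t < xr t \<and> xr t \<le> 1 \<and> 0 \<le> yl t \<and> yl t < yr t \<and> yr t \<le> 1"
    and "\<And>x y. \<lbrakk>0 \<le> x; x \<le> 1; 0 \<le> y; y \<le> 1\<rbrakk> \<Longrightarrow>
      \<exists>t\<in>T. xl t \<le> x \<and> x \<le> xr t \<and> yl t \<le> y \<and> y \<le> yr t"
    and "\<And>t u x y. \<lbrakk>t \<in> T; u \<in> T; xl t < x; x < xr t; yl t < y; y < yr t;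
      xl u < x; x < xr u; yl u < y; y < yr u\<rbrakk> \<Longrightarrow> t = u"
  shows "is_tiling T"
  unfolding is_tiling_def
proof (intro conjI ballI impI)
  show "finite T" by fact
  show "T \<noteq> {}" using assms(3)[of 0 0] by auto
  show "tile_ok t" if "t \<in> T" for t using assms(2)[OF that] by (simp add: tile_ok_def tile_sel_defs)
  show *: "tile_set t \<subseteq> unit_square" if "t \<in> T" for t
    using assms(2)[OF that] by (auto simp: tile_set_def unit_square_def tile_sel_defs)
  show "(\<Union>t\<in>T. tile_set t) = unit_square"
  proof
    show "(\<Union>t\<in>T. tile_set t) \<subseteq> unit_square" using * by blast
    show "unit_square \<subseteq> (\<Union>t\<in>T. tile_set t)"
    proof
      fix p assume "p \<in> unit_square"
      then show "p \<in> (\<Union>t\<in>T. tile_set t)"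
        using assms(3)[of "fst p" "snd p"] by (cases p) (auto simp: mem_unit_square mem_tile_set)
    qed
  qed
  fix t u assume "t \<in> T" "u \<in> T" "t \<noteq> u"
  then show "tile_interior t \<inter> tile_interior u = {}"
    using assms(4)[of t u] by (auto simp: mem_tile_interior)
qed

lemma tile_covers:
  assumes "is_tiling T" "0 \<le> x" "x \<le> 1" "0 \<le> y" "y \<le> 1"
  obtains t where "t \<in> T" "xl t \<le> x" "x \<le> xr t" "yl t \<le> y" "y \<le> yr t"
proof -
  have "(x, y) \<in> (\<Union>t\<in>T. tile_set t)"
    using assms by (auto simp: is_tiling_def mem_unit_square)
  then show ?thesis using that by (auto simp: mem_tile_set)
qed

lemma finite_gap:
  fixes A :: "real set"
  assumes "finite A"
  obtains e where "e > 0" "\<And>z. z \<in> A \<Longrightarrow> z \<noteq> p \<Longrightarrow> e \<le> \<bar>z - p\<bar>"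
  using finite_set_avoid[OF assms, of p] by (auto simp: dist_real_def abs_minus_commute)

text \<open>Abscissae and ordinates are thrown together: the set is used for its finiteness, to keep
  a distance from it or to confine other heights to it.\<close>

definition coords :: "tile set \<Rightarrow> real set" where
  "coords T = xl ` T \<union> xr ` T \<union> yl ` T \<union> yr ` T"

lemma finite_coords: "finite T \<Longrightarrow> finite (coords T)"
  by (simp add: coords_def)

lemma coordsI:
  assumes "t \<in> T"
  shows "xl t \<in> coords T" "xr t \<in> coords T" "yl t \<in> coords T" "yr t \<in> coords T"
  using assms by (auto simp: coords_def)

text \<open>Cover the point obtained from (p, q) by moving to the upper left by less than the
  distance to the next tile coordinate. The covering tile then extends back to (p, q), and the
  strict inequalities record the quadrant in which it lies.\<close>

lemma tile_upper_left:
  assumes "is_tiling T" "0 < p" "p \<le> 1" "0 \<le> q" "q < 1"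
  obtains t where "t \<in> T" "xl t < p" "p \<le> xr t" "yl t \<le> q" "q < yr t"
proof -
  have fin: "finite (coords T)" using assms tiling_finite finite_coords by blast
  obtain e1 where e1: "e1 > 0" "\<And>z. z \<in> coords T \<Longrightarrow> z \<noteq> p \<Longrightarrow> e1 \<le> \<bar>z - p\<bar>"
    using finite_gap[OF fin] by blast
  obtain e2 where e2: "e2 > 0" "\<And>z. z \<in> coords T \<Longrightarrow> z \<noteq> q \<Longrightarrow> e2 \<le> \<bar>z - q\<bar>"
    using finite_gap[OF fin] by blast
  define d1 where "d1 = min (e1 / 2) p"
  define d2 where "d2 = min (e2 / 2) (1 - q)"
  have d: "d1 > 0" "d1 < e1" "d1 \<le> p" "d2 > 0" "d2 < e2" "d2 \<le> 1 - q"
    using assms e1(1) e2(1) by (auto simp: d1_def d2_def min_def)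
  have "0 \<le> p - d1" "p - d1 \<le> 1" "0 \<le> q + d2" "q + d2 \<le> 1" using assms d by auto
  then obtain t where t: "t \<in> T" "xl t \<le> p - d1" "p - d1 \<le> xr t" "yl t \<le> q + d2" "q + d2 \<le> yr t"
    using tile_covers[OF assms(1)] by blast
  have "p \<le> xr t" using e1(2)[OF coordsI(2)[OF t(1)]] t d by (cases "xr t = p") (auto simp: abs_if split: if_splits)
  moreover have "yl t \<le> q" using e2(2)[OF coordsI(3)[OF t(1)]] t d by (cases "yl t = q") (auto simp: abs_if split: if_splits)
  ultimately show ?thesis using that[OF t(1)] t d by auto
qed

lemma tile_lower_left:
  assumes "is_tiling T" "0 < p" "p \<le> 1" "0 < q" "q \<le> 1"
  obtains t where "t \<in> T" "xl t < p" "p \<le> xr t" "yl t < q" "q \<le> yr t"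
proof -
  have fin: "finite (coords T)" using assms tiling_finite finite_coords by blast
  obtain e1 where e1: "e1 > 0" "\<And>z. z \<in> coords T \<Longrightarrow> z \<noteq> p \<Longrightarrow> e1 \<le> \<bar>z - p\<bar>"
    using finite_gap[OF fin] by blast
  obtain e2 where e2: "e2 > 0" "\<And>z. z \<in> coords T \<Longrightarrow> z \<noteq> q \<Longrightarrow> e2 \<le> \<bar>z - q\<bar>"
    using finite_gap[OF fin] by blast
  define d1 where "d1 = min (e1 / 2) p"
  define d2 where "d2 = min (e2 / 2) q"
  have d: "d1 > 0" "d1 < e1" "d1 \<le> p" "d2 > 0" "d2 < e2" "d2 \<le> q"
    using assms e1(1) e2(1) by (auto simp: d1_def d2_def min_def)
  have "0 \<le> p - d1" "p - d1 \<le> 1" "0 \<le> q - d2" "q - d2 \<le> 1" using assms d by auto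
  then obtain t where t: "t \<in> T" "xl t \<le> p - d1" "p - d1 \<le> xr t" "yl t \<le> q - d2" "q - d2 \<le> yr t"
    using tile_covers[OF assms(1)] by blast
  have "p \<le> xr t" using e1(2)[OF coordsI(2)[OF t(1)]] t d by (cases "xr t = p") (auto simp: abs_if split: if_splits)
  moreover have "q \<le> yr t" using e2(2)[OF coordsI(4)[OF t(1)]] t d by (cases "yr t = q") (auto simp: abs_if split: if_splits)
  ultimately show ?thesis using that[OF t(1)] t d by auto
qed

lemma right_tile_above:
  assumes "is_tiling T" "0 \<le> y" "y < 1"
  obtains t where "t \<in> T" "xr t = 1" "yl t \<le> y" "y < yr t"
proof -
  obtain t where t: "t \<in> T" "xl t < 1" "1 \<le> xr t" "yl t \<le> y" "y < yr t"
    using tile_upper_left[OF assms(1) zero_less_one order_refl assms(2,3)] by blast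
  then have "xr t = 1" using tile_bounds(3)[OF assms(1) t(1)] by simp
  then show ?thesis using that[of t] t by blast
qed

lemma right_tile_below:
  assumes "is_tiling T" "0 < y" "y \<le> 1"
  obtains t where "t \<in> T" "xr t = 1" "yl t < y" "y \<le> yr t"
proof -
  obtain t where t: "t \<in> T" "xl t < 1" "1 \<le> xr t" "yl t < y" "y \<le> yr t"
    using tile_lower_left[OF assms(1) zero_less_one order_refl assms(2,3)] by blast
  then have "xr t = 1" using tile_bounds(3)[OF assms(1) t(1)] by simp
  then show ?thesis using that[of t] t by blast
qed

text \<open>A point on the boundary of \<open>t\<close> and interior to \<open>u\<close> would make
  the two tiles overlap. This turns the existential over tiles in the definition into a universal
  statement, which lets skeletons be compared point by point.\<close>

lemma mem_skeleton:
  assumes "is_tiling T"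
  shows "(x, y) \<in> skeleton T \<longleftrightarrow> 0 \<le> x \<and> x \<le> 1 \<and> 0 \<le> y \<and> y \<le> 1 \<and>
    (\<forall>t\<in>T. \<not> (xl t < x \<and> x < xr t \<and> yl t < y \<and> y < yr t))"
proof (intro iffI)
  assume "(x, y) \<in> skeleton T"
  then obtain t where t: "t \<in> T" "xl t \<le> x" "x \<le> xr t" "yl t \<le> y" "y \<le> yr t"
    "\<not> (xl t < x \<and> x < xr t \<and> yl t < y \<and> y < yr t)"
    by (auto simp: skeleton_def mem_tile_set mem_tile_interior)
  note bt = tile_bounds[OF assms t(1)]
  have "\<not> (xl u < x \<and> x < xr u \<and> yl u < y \<and> y < yr u)" if u: "u \<in> T" for u
  proof
    assume *: "xl u < x \<and> x < xr u \<and> yl u < y \<and> y < yr u"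
    then have "u = t" using t bt by (intro tile_eqI[OF assms u t(1)]) auto
    then show False using * t(6) by blast
  qed
  then show "0 \<le> x \<and> x \<le> 1 \<and> 0 \<le> y \<and> y \<le> 1 \<and>
    (\<forall>t\<in>T. \<not> (xl t < x \<and> x < xr t \<and> yl t < y \<and> y < yr t))"
    using t bt by auto
next
  assume *: "0 \<le> x \<and> x \<le> 1 \<and> 0 \<le> y \<and> y \<le> 1 \<and>
    (\<forall>t\<in>T. \<not> (xl t < x \<and> x < xr t \<and> yl t < y \<and> y < yr t))"
  then obtain t where "t \<in> T" "xl t \<le> x" "x \<le> xr t" "yl t \<le> y" "y \<le> yr t"
    using tile_covers[OF assms, of x y] by blast
  then show "(x, y) \<in> skeleton T" using *
    by (auto simp: skeleton_def mem_tile_set mem_tile_interior intro!: bexI[of _ t])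
qed

lemma skeleton_subset: "is_tiling T \<Longrightarrow> skeleton T \<subseteq> unit_square"
  by (auto simp: mem_skeleton mem_unit_square)

lemma skeleton_coords:
  assumes "is_tiling T" "(x, y) \<in> skeleton T" "x \<notin> coords T" "y \<notin> coords T"
  shows False
proof -
  have b: "0 \<le> x" "x \<le> 1" "0 \<le> y" "y \<le> 1" using assms by (auto simp: mem_skeleton)
  obtain t where t: "t \<in> T" "xl t \<le> x" "x \<le> xr t" "yl t \<le> y" "y \<le> yr t"
    using tile_covers[OF assms(1) b] by blast
  have "xl t \<noteq> x" "xr t \<noteq> x" "yl t \<noteq> y" "yr t \<noteq> y"
    using coordsI[OF t(1)] assms(3,4) by auto
  then show False using t assms(1,2) by (force simp: mem_skeleton)
qed

lemma skeleton_frame: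
  assumes "is_tiling T" "0 \<le> z" "z \<le> 1"
  shows "(0, z) \<in> skeleton T" "(1, z) \<in> skeleton T" "(z, 0) \<in> skeleton T" "(z, 1) \<in> skeleton T"
proof -
  have *: "\<not> xl t < 0 \<and> \<not> 1 < xr t \<and> \<not> yl t < 0 \<and> \<not> 1 < yr t" if "t \<in> T" for t
    using tile_bounds[OF assms(1) that] by simp
  then show "(0, z) \<in> skeleton T" "(1, z) \<in> skeleton T" "(z, 0) \<in> skeleton T" "(z, 1) \<in> skeleton T"
    using assms(2,3) unfolding mem_skeleton[OF assms(1)] by auto
qed

lemma tile_sides_skeleton:
  assumes "is_tiling T" "t \<in> T"
  shows "xl t \<le> x \<Longrightarrow> x \<le> xr t \<Longrightarrow> (x, yl t) \<in> skeleton T"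
    "xl t \<le> x \<Longrightarrow> x \<le> xr t \<Longrightarrow> (x, yr t) \<in> skeleton T"
    "yl t \<le> y \<Longrightarrow> y \<le> yr t \<Longrightarrow> (xl t, y) \<in> skeleton T"
    "yl t \<le> y \<Longrightarrow> y \<le> yr t \<Longrightarrow> (xr t, y) \<in> skeleton T"
  using tile_bounds[OF assms] unfolding skeleton_def
  by (auto simp: mem_tile_set mem_tile_interior intro!: bexI[OF _ assms(2)])

text \<open>Otherwise every abscissa of the segment would lie in the finite set
  \<open>coords T\<close>.\<close>

lemma hseg_coord:
  assumes "is_tiling T" "a < b" "\<And>x. a < x \<Longrightarrow> x < b \<Longrightarrow> (x, y) \<in> skeleton T"
  shows "y \<in> coords T"
proof (rule ccontr)
  assume "y \<notin> coords T"
  then have "{a<..<b} \<subseteq> coords T" using assms(3) skeleton_coords[OF assms(1)]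
    by (meson greaterThanLessThan_iff subsetI)
  then show False using finite_coords[OF tiling_finite[OF assms(1)]] assms(2)
    by (meson finite_subset infinite_Ioo)
qed

section \<open>Edges that reach the right side\<close>

lemma right_hits_bounds: "y \<in> right_hits T \<Longrightarrow> 0 < y \<and> y < 1"
  by (simp add: right_hits_def tile_sel_defs)

lemma finite_right_hits: "is_tiling T \<Longrightarrow> finite (right_hits T)"
  by (rule finite_subset[OF _ finite_coords[OF tiling_finite]]) (auto simp: right_hits_def coords_def tile_sel_defs)

text \<open>The corners are included because a block may start at the lower or end at the upper side
  of the square; they account for the 2 in r + 2 later on.\<close>

definition levels :: "tile set \<Rightarrow> real set" where
  "levels T = insert 0 (insert 1 (right_hits T))"

lemma finite_levels: "is_tiling T \<Longrightarrow> finite (levels T)"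
  by (simp add: levels_def finite_right_hits)

lemma levels_bounds: "y \<in> levels T \<Longrightarrow> 0 \<le> y \<and> y \<le> 1"
  by (auto simp: levels_def right_hits_def tile_sel_defs)

lemma right_tile_levels:
  assumes "is_tiling T" "t \<in> T" "xr t = 1"
  shows "yl t \<in> levels T" "yr t \<in> levels T"
  using tile_bounds[OF assms(1,2)] assms(2,3) by (auto simp: levels_def right_hits_def tile_sel_defs)

lemma right_tile_no_level:
  assumes T: "is_tiling T" and t: "t \<in> T" "xr t = 1" and y: "y \<in> levels T"
  shows "y \<le> yl t \<or> yr t \<le> y"
proof (rule ccontr)
  assume *: "\<not> ?thesis"
  note bt = tile_bounds[OF T t(1)]
  then have "y \<in> right_hits T" using * y by (auto simp: levels_def)
  then obtain u where u: "u \<in> T" "xr u = 1" "yl u = y \<or> yr u = y" by (auto simp: right_hits_def tile_sel_defs)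
  note bu = tile_bounds[OF T u(1)]
  have "t = u" using u t bt bu * by (intro tile_eqI[OF T]) auto
  then show False using * u by auto
qed

text \<open>Eliminates the tiles, so that equivalences can transport the hits. For the converse, the
  right tile just above height \<open>y\<close> would have points of the segment in its interior
  unless its lower side is at \<open>y\<close>.\<close>

lemma right_hits_skeleton:
  assumes T: "is_tiling T"
  shows "y \<in> right_hits T \<longleftrightarrow> 0 < y \<and> y < 1 \<and> (\<exists>a<1. \<forall>x. a \<le> x \<longrightarrow> x \<le> 1 \<longrightarrow> (x, y) \<in> skeleton T)"
proof (intro iffI conjI)
  assume y: "y \<in> right_hits T"
  then show "0 < y" "y < 1" by (auto simp: right_hits_def tile_sel_defs)
  from y obtain t where t: "t \<in> T" "xr t = 1" "yl t = y \<or> yr t = y" by (auto simp: right_hits_def tile_sel_defs)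
  show "\<exists>a<1. \<forall>x. a \<le> x \<longrightarrow> x \<le> 1 \<longrightarrow> (x, y) \<in> skeleton T"
    using t tile_sides_skeleton[OF T t(1)] tile_bounds[OF T t(1)] by (intro exI[of _ "xl t"]) auto
next
  assume "0 < y \<and> y < 1 \<and> (\<exists>a<1. \<forall>x. a \<le> x \<longrightarrow> x \<le> 1 \<longrightarrow> (x, y) \<in> skeleton T)"
  then obtain a where y: "0 < y" "y < 1" and a: "a < 1" "\<And>x. a \<le> x \<Longrightarrow> x \<le> 1 \<Longrightarrow> (x, y) \<in> skeleton T"
    by auto
  obtain t where t: "t \<in> T" "xr t = 1" "yl t \<le> y" "y < yr t"
    using right_tile_above[OF T less_imp_le[OF y(1)] y(2)] by blast
  note bt = tile_bounds[OF T t(1)]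
  obtain x where "max a (xl t) < x" "x < 1" using a t bt dense[of "max a (xl t)" 1] by auto
  then have "\<not> (xl t < x \<and> x < xr t \<and> yl t < y \<and> y < yr t)"
    using a(2)[of x] t(1) by (simp add: mem_skeleton[OF T])
  then have "yl t = y" using t \<open>max a (xl t) < x\<close> \<open>x < 1\<close> by auto
  then show "y \<in> right_hits T" using y t by (auto simp: right_hits_def tile_sel_defs)
qed

section \<open>Gluing a block to the right side\<close>

definition consec :: "real set \<Rightarrow> real \<Rightarrow> real \<Rightarrow> bool" where
  "consec Z z z' \<longleftrightarrow> z \<in> Z \<and> z' \<in> Z \<and> z < z' \<and> (\<forall>w\<in>Z. w \<le> z \<or> z' \<le> w)"

definition slabs :: "real \<Rightarrow> real set \<Rightarrow> tile set" where
  "slabs x Z = {((x, z), (1, z')) | z z'. consec Z z z'}"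

lemma consec_above:
  assumes "finite Z" "a \<in> Z" "b \<in> Z" "a \<le> y" "y < b"
  obtains z z' where "consec Z z z'" "z \<le> y" "y < z'"
proof -
  let ?A = "{w \<in> Z. w \<le> y}" and ?B = "{w \<in> Z. y < w}"
  have A: "finite ?A" "?A \<noteq> {}" and B: "finite ?B" "?B \<noteq> {}" using assms by auto
  have "Max ?A \<in> ?A" "Min ?B \<in> ?B" using Max_in[OF A] Min_in[OF B] by blast+
  moreover have "w \<le> Max ?A \<or> Min ?B \<le> w" if "w \<in> Z" for w
    using that A B by (cases "w \<le> y") auto
  ultimately have "consec Z (Max ?A) (Min ?B)" "Max ?A \<le> y" "y < Min ?B"
    by (auto simp: consec_def)
  then show ?thesis using that by blast
qed

lemma consec_below:
  assumes "finite Z" "a \<in> Z" "b \<in> Z" "a < y" "y \<le> b"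
  obtains z z' where "consec Z z z'" "z < y" "y \<le> z'"
proof -
  let ?A = "{w \<in> Z. w < y}" and ?B = "{w \<in> Z. y \<le> w}"
  have A: "finite ?A" "?A \<noteq> {}" and B: "finite ?B" "?B \<noteq> {}" using assms by auto
  have "Max ?A \<in> ?A" "Min ?B \<in> ?B" using Max_in[OF A] Min_in[OF B] by blast+
  moreover have "w \<le> Max ?A \<or> Min ?B \<le> w" if "w \<in> Z" for w
    using that A B by (cases "w < y") auto
  ultimately have "consec Z (Max ?A) (Min ?B)" "Max ?A < y" "y \<le> Min ?B"
    by (auto simp: consec_def)
  then show ?thesis using that by blast
qed

lemma consec_unique:
  assumes "consec Z z z'" "consec Z w w'" "z < w'" "w < z'"
  shows "z = w \<and> z' = w'"
proof -
  have "z \<le> w \<or> w' \<le> z" "w \<le> z \<or> z' \<le> w" "z' \<le> w \<or> w' \<le> z'" "w' \<le> z \<or> z' \<le> w'"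
    using assms(1,2) by (auto simp: consec_def)
  then show ?thesis using assms(3,4) by linarith
qed

lemma slabs_finite: "finite Z \<Longrightarrow> finite (slabs x Z)"
  by (rule finite_subset[of _ "(\<lambda>(z, z'). ((x, z), (1, z'))) ` (Z \<times> Z)"])
    (auto simp: slabs_def consec_def)

text \<open>A slab is determined by its lower end, which can be any element of \<open>Z\<close>
  except the largest.\<close>

lemma card_slabs:
  assumes "finite Z" "Z \<noteq> {}"
  shows "card (slabs x Z) = card Z - 1"
proof -
  have "bij_betw yl (slabs x Z) (Z - {Max Z})"
    unfolding bij_betw_def
  proof
    show "inj_on yl (slabs x Z)"
      using consec_unique by (force simp: inj_on_def slabs_def consec_def)
    show "yl ` slabs x Z = Z - {Max Z}"
    proof
      show "yl ` slabs x Z \<subseteq> Z - {Max Z}"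
        using assms by (auto simp: slabs_def consec_def dest: Max_ge[OF assms(1)])
      show "Z - {Max Z} \<subseteq> yl ` slabs x Z"
      proof
        fix z assume z: "z \<in> Z - {Max Z}"
        then have "z < Max Z" using Max_ge[OF assms(1), of z] by auto
        then obtain w w' where w: "consec Z w w'" "w \<le> z" "z < w'"
          using consec_above[OF assms(1) _ Max_in[OF assms] order_refl] z by blast
        then have "w = z" using z by (force simp: consec_def)
        then have "((x, z), (1, w')) \<in> slabs x Z" using w by (auto simp: slabs_def)
        then show "z \<in> yl ` slabs x Z" by force
      qed
    qed
  qed
  then have "card (slabs x Z) = card (Z - {Max Z})" by (rule bij_betw_same_card)
  then show ?thesis using assms by simp
qed

definition in_block :: "real \<Rightarrow> real \<Rightarrow> tile \<Rightarrow> bool" where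
  "in_block y0 y1 t \<longleftrightarrow> xr t = 1 \<and> y0 \<le> yl t \<and> yr t \<le> y1"

definition trim :: "real \<Rightarrow> tile \<Rightarrow> tile" where
  "trim x t = ((xl t, yl t), (x, yr t))"

lemma trim_sel [simp]: "xl (trim x t) = xl t" "yl (trim x t) = yl t" "xr (trim x t) = x" "yr (trim x t) = yr t"
  by (simp_all add: trim_def)

definition glue :: "real \<Rightarrow> real \<Rightarrow> real \<Rightarrow> real set \<Rightarrow> tile set \<Rightarrow> tile set" where
  "glue x y0 y1 V T = {t \<in> T. \<not> in_block y0 y1 t} \<union> trim x ` {t \<in> T. in_block y0 y1 t} \<union>
     slabs x (insert y0 (insert y1 V))"

text \<open>\<open>clear\<close> refers to closed height ranges, so it also concerns tiles that
  merely touch the block from above or below: except for the right side itself, no vertical side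
  lies at or beyond \<open>x\<close> there. Otherwise a vertical segment could end on a horizontal
  side of the new block, which would then not be removable. \<open>V\<close> holds the heights of
  the new edges, \<open>U\<close> those of the old edges that will end on the new left side.\<close>

locale gluing =
  fixes T :: "tile set" and x y0 y1 :: real and V :: "real set"
  assumes tiling: "is_tiling T"
    and x_gt: "0 < x" and x_lt: "x < 1" and y_less: "y0 < y1"
    and lev: "y0 \<in> levels T" "y1 \<in> levels T"
    and clear: "\<And>t. t \<in> T \<Longrightarrow> yl t \<le> y1 \<Longrightarrow> y0 \<le> yr t \<Longrightarrow> xr t < x \<or> xr t = 1 \<and> xl t < x"
    and finV: "finite V" and V_sub: "V \<subseteq> {y0<..<y1}"
begin

definition "U = right_hits T \<inter> {y0<..<y1}"
definition "Z = insert y0 (insert y1 V)"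

lemma finZ: "finite Z" by (simp add: Z_def finV)

lemma Z_ends: "y0 \<in> Z" "y1 \<in> Z" by (auto simp: Z_def)

lemma Z_bounds: "z \<in> Z \<Longrightarrow> y0 \<le> z \<and> z \<le> y1"
  using V_sub y_less by (auto simp: Z_def)

lemma y_bounds: "0 \<le> y0" "y1 \<le> 1" "y0 < 1" "0 < y1"
  using levels_bounds[OF lev(1)] levels_bounds[OF lev(2)] y_less by auto

lemma block_tile:
  assumes "t \<in> T" "xr t = 1" "yl t < y1" "y0 < yr t"
  shows "in_block y0 y1 t"
  using right_tile_no_level[OF tiling assms(1,2) lev(1)] right_tile_no_level[OF tiling assms(1,2) lev(2)]
    assms by (auto simp: in_block_def)

lemma block_tile_xl:
  assumes "t \<in> T" "in_block y0 y1 t"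
  shows "xl t < x"
  using clear[OF assms(1)] tile_bounds[OF tiling assms(1)] assms(2) x_lt
  by (auto simp: in_block_def)

lemma block_above:
  assumes "y0 \<le> y" "y < y1"
  obtains t where "t \<in> T" "in_block y0 y1 t" "yl t \<le> y" "y < yr t"
proof -
  have "0 \<le> y" "y < 1" using y_bounds assms by auto
  then obtain t where t: "t \<in> T" "xr t = 1" "yl t \<le> y" "y < yr t"
    using right_tile_above[OF tiling] by blast
  then show ?thesis using that[OF t(1)] block_tile[OF t(1,2)] assms by auto
qed

lemma block_below:
  assumes "y0 < y" "y \<le> y1"
  obtains t where "t \<in> T" "in_block y0 y1 t" "yl t < y" "y \<le> yr t"
proof -
  have "0 < y" "y \<le> 1" using y_bounds assms by auto
  then obtain t where t: "t \<in> T" "xr t = 1" "yl t < y" "y \<le> yr t"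
    using right_tile_below[OF tiling] by blast
  then show ?thesis using that[OF t(1)] block_tile[OF t(1,2)] assms by auto
qed

lemma mem_glue: "t \<in> glue x y0 y1 V T \<longleftrightarrow>
    (t \<in> T \<and> \<not> in_block y0 y1 t) \<or> (\<exists>u\<in>T. in_block y0 y1 u \<and> t = trim x u) \<or>
    (\<exists>z z'. consec Z z z' \<and> t = ((x, z), (1, z')))"
  by (auto simp: glue_def slabs_def Z_def)

lemma slab_mem: "consec Z z z' \<Longrightarrow> ((x, z), (1, z')) \<in> glue x y0 y1 V T"
  by (auto simp: mem_glue)

lemma trim_mem: "u \<in> T \<Longrightarrow> in_block y0 y1 u \<Longrightarrow> trim x u \<in> glue x y0 y1 V T"
  by (auto simp: mem_glue)

lemma glue_cases [consumes 1, case_names outside trimmed slab]: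
  assumes "t \<in> glue x y0 y1 V T"
    and "\<lbrakk>t \<in> T; \<not> in_block y0 y1 t\<rbrakk> \<Longrightarrow> P"
    and "\<And>u. \<lbrakk>u \<in> T; in_block y0 y1 u; t = trim x u\<rbrakk> \<Longrightarrow> P"
    and "\<And>z z'. \<lbrakk>consec Z z z'; t = ((x, z), (1, z'))\<rbrakk> \<Longrightarrow> P"
  shows P
  using assms(1) unfolding mem_glue using assms(2-4) by blast

lemma outside_not_block:
  assumes "t \<in> T" "\<not> in_block y0 y1 t" "yl t < y" "y < yr t" "y0 \<le> y" "y \<le> y1" "\<xi> < xr t"
  shows "\<xi> < x"
  using clear[OF assms(1)] block_tile[OF assms(1)] assms by fastforce

lemma glue_interior_outside:
  assumes "\<not> (x \<le> \<xi> \<and> y0 \<le> y \<and> y \<le> y1)"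
  shows "(\<exists>t\<in>glue x y0 y1 V T. xl t < \<xi> \<and> \<xi> < xr t \<and> yl t < y \<and> y < yr t) \<longleftrightarrow>
    (\<exists>t\<in>T. xl t < \<xi> \<and> \<xi> < xr t \<and> yl t < y \<and> y < yr t)" (is "?L = ?R")
proof
  assume ?L
  then obtain t where t: "t \<in> glue x y0 y1 V T" "xl t < \<xi>" "\<xi> < xr t" "yl t < y" "y < yr t" by blast
  from t(1) show ?R
  proof (cases rule: glue_cases)
    case outside then show ?thesis using t by blast
  next
    case (trimmed u) then show ?thesis using t x_lt by (intro bexI[of _ u]) (auto simp: in_block_def)
  next
    case (slab z z')
    then show ?thesis using t assms Z_bounds by (force simp: consec_def)
  qed
next
  assume ?R
  then obtain t where t: "t \<in> T" "xl t < \<xi>" "\<xi> < xr t" "yl t < y" "y < yr t" by blast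
  show ?L
  proof (cases "in_block y0 y1 t")
    case True
    then have "\<xi> < x" using t assms by (auto simp: in_block_def)
    then show ?thesis using t trim_mem[OF t(1) True] by (intro bexI[of _ "trim x t"]) auto
  next
    case False
    then show ?thesis using t by (intro bexI[of _ t]) (auto simp: mem_glue)
  qed
qed

text \<open>At the heights of the block the line at \<open>x\<close> separates the slabs from all
  other tiles. Disjointness in the remaining cases is inherited from \<open>T\<close>, as trimmed
  tiles are contained in old ones.\<close>

lemma tiling_glue: "is_tiling (glue x y0 y1 V T)"
proof (rule is_tilingI)
  show "finite (glue x y0 y1 V T)"
    using tiling_finite[OF tiling] by (simp add: glue_def slabs_finite finV)
next
  fix t assume "t \<in> glue x y0 y1 V T"
  then show "0 \<le> xl t \<and> xl t < xr t \<and> xr t \<le> 1 \<and> 0 \<le> yl t \<and> yl t < yr t \<and> yr t \<le> 1"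
  proof (cases rule: glue_cases)
    case outside then show ?thesis using tile_bounds[OF tiling, of t] by auto
  next
    case (trimmed u) then show ?thesis using tile_bounds[OF tiling, of u] block_tile_xl[of u] x_lt by auto
  next
    case (slab z z') then show ?thesis using x_gt x_lt y_bounds Z_bounds by (force simp: consec_def)
  qed
next
  fix \<xi> y :: real assume b: "0 \<le> \<xi>" "\<xi> \<le> 1" "0 \<le> y" "y \<le> 1"
  obtain t where t: "t \<in> T" "xl t \<le> \<xi>" "\<xi> \<le> xr t" "yl t \<le> y" "y \<le> yr t"
    using tile_covers[OF tiling b] by blast
  show "\<exists>t\<in>glue x y0 y1 V T. xl t \<le> \<xi> \<and> \<xi> \<le> xr t \<and> yl t \<le> y \<and> y \<le> yr t"
  proof (cases "in_block y0 y1 t")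
    case True
    show ?thesis
    proof (cases "\<xi> \<le> x")
      case True2: True
      show ?thesis using t True2 by (intro bexI[OF _ trim_mem[OF t(1) True]]) auto
    next
      case False
      have y: "y0 \<le> y" "y \<le> y1" using True t by (auto simp: in_block_def)
      have "\<exists>z z'. consec Z z z' \<and> z \<le> y \<and> y \<le> z'"
      proof (cases "y < y1")
        case True
        obtain z z' where "consec Z z z'" "z \<le> y" "y < z'"
          using consec_above[OF finZ Z_ends y(1) True] by blast
        then show ?thesis by (intro exI[of _ z] exI[of _ z']) auto
      next
        case False
        then have "y0 < y" using y_less by simp
        obtain z z' where "consec Z z z'" "z < y" "y \<le> z'"
          using consec_below[OF finZ Z_ends \<open>y0 < y\<close> y(2)] by blast
        then show ?thesis by (intro exI[of _ z] exI[of _ z']) auto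
      qed
      then obtain z z' where z: "consec Z z z'" "z \<le> y" "y \<le> z'" by blast
      show ?thesis using False z b by (intro bexI[OF _ slab_mem[OF z(1)]]) auto
    qed
  next
    case False
    then show ?thesis using t by (intro bexI[of _ t]) (auto simp: mem_glue)
  qed
next
  fix t u \<xi> y
  assume t: "t \<in> glue x y0 y1 V T" and u: "u \<in> glue x y0 y1 V T"
    and i: "xl t < \<xi>" "\<xi> < xr t" "yl t < y" "y < yr t" "xl u < \<xi>" "\<xi> < xr u" "yl u < y" "y < yr u"
  have nb: "\<xi> < x" if "w \<in> T" "\<not> in_block y0 y1 w" "yl w < y" "y < yr w" "\<xi> < xr w" "y0 < y" "y < y1" for w
    using outside_not_block[of w y \<xi>] that by auto
  have sl: "y0 < y \<and> y < y1" if "consec Z z z'" "z < y" "y < z'" for z z'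
    using that Z_bounds by (force simp: consec_def)
  have bl: "y0 < y \<and> y < y1" if "in_block y0 y1 w" "yl w < y" "y < yr w" for w
    using that by (auto simp: in_block_def)
  have eq: "v = w" if "v \<in> T" "w \<in> T" "xl v < \<xi>" "\<xi> < xr v" "yl v < y" "y < yr v" "xl w < \<xi>" "\<xi> < xr w" "yl w < y" "y < yr w" for v w
    using that by (intro tile_eqI[OF tiling that(1,2)]) auto
  have xr1: "\<xi> < xr w" if "in_block y0 y1 w" "\<xi> < x" for w
    using that x_lt by (auto simp: in_block_def)
  from t show "t = u"
  proof (cases rule: glue_cases)
    case to: outside
    from u show ?thesis
    proof (cases rule: glue_cases)
      case outside then show ?thesis using to i eq by blast
    next
      case (trimmed w)
      then have "t = w" using to i xr1[of w] eq[of t w] by auto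
      then show ?thesis using to trimmed by blast
    next
      case (slab z z') then show ?thesis using to i nb[of t] sl[of z z'] by auto
    qed
  next
    case tt: (trimmed v)
    from u show ?thesis
    proof (cases rule: glue_cases)
      case outside
      then have "v = u" using tt i xr1[of v] eq[of v u] by auto
      then show ?thesis using outside tt by blast
    next
      case (trimmed w)
      then have "v = w" using tt i xr1[of v] xr1[of w] eq[of v w] by auto
      then show ?thesis using trimmed tt by blast
    next
      case (slab z z') then show ?thesis using tt i by auto
    qed
  next
    case ts: (slab z z')
    from u show ?thesis
    proof (cases rule: glue_cases)
      case outside then show ?thesis using ts i nb[of u] sl[of z z'] by auto
    next
      case (trimmed w) then show ?thesis using ts i by auto
    next
      case (slab w w') then show ?thesis using ts i consec_unique[of Z z z' w w'] by auto
    qed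
  qed
qed

text \<open>With the two lemmas that follow this determines the glued skeleton: nothing changes
  outside the block, and inside it the rungs at \<open>U\<close> are replaced by the left side and
  the rungs at \<open>V\<close>.\<close>

lemma skeleton_glue_outside:
  assumes "\<not> (x \<le> \<xi> \<and> y0 \<le> y \<and> y \<le> y1)"
  shows "(\<xi>, y) \<in> skeleton (glue x y0 y1 V T) \<longleftrightarrow> (\<xi>, y) \<in> skeleton T"
  using glue_interior_outside[OF assms]
  unfolding mem_skeleton[OF tiling] mem_skeleton[OF tiling_glue] by blast

lemma skeleton_block:
  assumes "x \<le> \<xi>" "\<xi> \<le> 1" "y0 \<le> y" "y \<le> y1"
  shows "(\<xi>, y) \<in> skeleton T \<longleftrightarrow> y \<in> insert y0 (insert y1 U) \<or> \<xi> = 1"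
proof (rule iffI)
  assume s: "(\<xi>, y) \<in> skeleton T"
  show "y \<in> insert y0 (insert y1 U) \<or> \<xi> = 1"
  proof (rule ccontr)
    assume n: "\<not> ?thesis"
    then have y: "y0 \<le> y" "y < y1" using assms by auto
    obtain t where t: "t \<in> T" "in_block y0 y1 t" "yl t \<le> y" "y < yr t"
      using block_above[OF y] by blast
    have "yl t \<noteq> y"
      using n t assms y right_tile_levels(1)[OF tiling t(1)] y_bounds
      by (auto simp: in_block_def U_def levels_def)
    then show False using s n t block_tile_xl[OF t(1,2)] assms
      unfolding mem_skeleton[OF tiling] by (fastforce simp: in_block_def)
  qed
next
  assume y: "y \<in> insert y0 (insert y1 U) \<or> \<xi> = 1"
  have "\<not> (xl t < \<xi> \<and> \<xi> < xr t \<and> yl t < y \<and> y < yr t)" if t: "t \<in> T" for t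
  proof
    assume *: "xl t < \<xi> \<and> \<xi> < xr t \<and> yl t < y \<and> y < yr t"
    then have xr: "xr t = 1" using clear[OF t] assms by auto
    have "\<xi> \<noteq> 1" using * tile_bounds[OF tiling t] by auto
    then have "y \<in> levels T" using y lev by (auto simp: U_def levels_def)
    then show False using right_tile_no_level[OF tiling t xr] * by force
  qed
  then show "(\<xi>, y) \<in> skeleton T" using assms x_gt y_bounds
    unfolding mem_skeleton[OF tiling] by auto
qed

lemma skeleton_glue_block:
  assumes "x \<le> \<xi>" "\<xi> \<le> 1" "y0 \<le> y" "y \<le> y1"
  shows "(\<xi>, y) \<in> skeleton (glue x y0 y1 V T) \<longleftrightarrow> y \<in> Z \<or> \<xi> = x \<or> \<xi> = 1"
proof (rule iffI)
  assume s: "(\<xi>, y) \<in> skeleton (glue x y0 y1 V T)"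
  show "y \<in> Z \<or> \<xi> = x \<or> \<xi> = 1"
  proof (rule ccontr)
    assume n: "\<not> ?thesis"
    then have y: "y0 \<le> y" "y < y1" using assms by (auto simp: Z_def)
    obtain z z' where z: "consec Z z z'" "z \<le> y" "y < z'"
      using consec_above[OF finZ Z_ends y] by blast
    have "z \<noteq> y" using z n by (auto simp: consec_def)
    then have "\<exists>t\<in>glue x y0 y1 V T. xl t < \<xi> \<and> \<xi> < xr t \<and> yl t < y \<and> y < yr t"
      using n z assms by (intro bexI[OF _ slab_mem[OF z(1)]]) auto
    then show False using s unfolding mem_skeleton[OF tiling_glue] by blast
  qed
next
  assume y: "y \<in> Z \<or> \<xi> = x \<or> \<xi> = 1"
  have "\<not> (xl t < \<xi> \<and> \<xi> < xr t \<and> yl t < y \<and> y < yr t)" if t: "t \<in> glue x y0 y1 V T" for t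
  proof
    assume *: "xl t < \<xi> \<and> \<xi> < xr t \<and> yl t < y \<and> y < yr t"
    from t show False
    proof (cases rule: glue_cases)
      case outside then show False using outside_not_block[of t y \<xi>] * assms by auto
    next
      case (trimmed u) then show False using * assms by auto
    next
      case (slab z z') then show False using * y by (auto simp: consec_def)
    qed
  qed
  then show "(\<xi>, y) \<in> skeleton (glue x y0 y1 V T)" using assms x_gt y_bounds
    unfolding mem_skeleton[OF tiling_glue] by auto
qed

end

text \<open>Stated in terms of the skeleton alone, so that equivalences preserve it.\<close>

definition removable :: "tile set \<Rightarrow> real \<Rightarrow> real \<Rightarrow> real \<Rightarrow> bool" where
  "removable T x y0 y1 \<longleftrightarrow> 0 < x \<and> x < 1 \<and> 0 \<le> y0 \<and> y0 < y1 \<and> y1 \<le> 1 \<and>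
     (\<forall>y. y0 \<le> y \<longrightarrow> y \<le> y1 \<longrightarrow> (x, y) \<in> skeleton T) \<and>
     (\<forall>\<xi>. x \<le> \<xi> \<longrightarrow> \<xi> \<le> 1 \<longrightarrow> (\<xi>, y0) \<in> skeleton T \<and> (\<xi>, y1) \<in> skeleton T) \<and>
     (\<forall>p a b. a < b \<longrightarrow> x \<le> p \<longrightarrow> p < 1 \<longrightarrow> a \<le> y1 \<longrightarrow> y0 \<le> b \<longrightarrow>
        (\<forall>y. a \<le> y \<longrightarrow> y \<le> b \<longrightarrow> (p, y) \<in> skeleton T) \<longrightarrow> p = x \<and> y0 \<le> a \<and> b \<le> y1)"

section \<open>Corners, singular vertices and the numbers of a glued tiling\<close>

definition ll_corner where "ll_corner T p \<longleftrightarrow> (\<exists>t\<in>T. (xl t, yl t) = p)"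
definition lr_corner where "lr_corner T p \<longleftrightarrow> (\<exists>t\<in>T. (xr t, yl t) = p)"
definition ul_corner where "ul_corner T p \<longleftrightarrow> (\<exists>t\<in>T. (xl t, yr t) = p)"
definition ur_corner where "ur_corner T p \<longleftrightarrow> (\<exists>t\<in>T. (xr t, yr t) = p)"

lemma card_at_most_one:
  assumes "finite A" "\<And>t u. t \<in> A \<Longrightarrow> u \<in> A \<Longrightarrow> t = u"
  shows "card A = (if A = {} then 0 else 1)"
proof (cases "A = {}")
  case False
  then obtain t where "A = {t}" using assms(2) by blast
  then show ?thesis by simp
qed simp

text \<open>Two tiles with the same point as the same kind of corner overlap, so each of the four
  kinds contributes at most one tile, and the count four is reached only if all kinds occur.\<close>

lemma singular_iff:
  assumes T: "is_tiling T"
  shows "p \<in> singular_vertices T \<longleftrightarrow> ll_corner T p \<and> lr_corner T p \<and> ul_corner T p \<and> ur_corner T p"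
proof -
  define A1 where "A1 = {t \<in> T. (xl t, yl t) = p}"
  define A2 where "A2 = {t \<in> T. (xl t, yr t) = p}"
  define A3 where "A3 = {t \<in> T. (xr t, yl t) = p}"
  define A4 where "A4 = {t \<in> T. (xr t, yr t) = p}"
  have fin: "finite A1" "finite A2" "finite A3" "finite A4"
    using tiling_finite[OF T] by (auto simp: A1_def A2_def A3_def A4_def)
  have b: "xl t < xr t" "yl t < yr t" if "t \<in> T" for t
    using tile_bounds[OF T that] by auto
  have eq: "t = u" if "t \<in> T" "u \<in> T" "xl t = xl u \<or> xr t = xr u" "yl t = yl u \<or> yr t = yr u" for t u
    by (rule tile_eqI[OF T that(1,2)]) (use b[OF that(1)] b[OF that(2)] that(3,4) in auto)
  have "card A1 = (if A1 = {} then 0 else 1)"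
    by (intro card_at_most_one fin eq) (auto simp: A1_def)
  moreover have "card A2 = (if A2 = {} then 0 else 1)"
    by (intro card_at_most_one fin eq) (auto simp: A2_def)
  moreover have "card A3 = (if A3 = {} then 0 else 1)"
    by (intro card_at_most_one fin eq) (auto simp: A3_def)
  moreover have "card A4 = (if A4 = {} then 0 else 1)"
    by (intro card_at_most_one fin eq) (auto simp: A4_def)
  moreover have "{t \<in> T. p \<in> tile_corners t} = A1 \<union> A2 \<union> (A3 \<union> A4)"
    by (auto simp: tile_corners_def A1_def A2_def A3_def A4_def tile_sel_defs)
  moreover have "card (A1 \<union> A2 \<union> (A3 \<union> A4)) = card A1 + card A2 + (card A3 + card A4)"
  proof -
    have "A1 \<inter> A2 = {}" "A3 \<inter> A4 = {}" "(A1 \<union> A2) \<inter> (A3 \<union> A4) = {}"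
      using b by (force simp: A1_def A2_def A3_def A4_def)+
    then show ?thesis using fin by (simp add: card_Un_disjoint)
  qed
  moreover have "A1 \<noteq> {} \<longleftrightarrow> ll_corner T p" "A2 \<noteq> {} \<longleftrightarrow> ul_corner T p"
    "A3 \<noteq> {} \<longleftrightarrow> lr_corner T p" "A4 \<noteq> {} \<longleftrightarrow> ur_corner T p"
    unfolding A1_def A2_def A3_def A4_def ll_corner_def ul_corner_def lr_corner_def ur_corner_def by blast+
  ultimately show ?thesis
    unfolding singular_vertices_def by (auto split: if_splits)
qed

lemma finite_singular: assumes "is_tiling T" shows "finite (singular_vertices T)"
proof (rule finite_subset)
  show "singular_vertices T \<subseteq> (\<lambda>t. (xl t, yl t)) ` T"
    by (auto simp: singular_iff[OF assms] ll_corner_def)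
qed (use tiling_finite[OF assms] in simp)

context gluing
begin

text \<open>By \<open>clear\<close>, the tile just above or below the block at such an abscissa
  reaches the right side, so its interior keeps the skeleton away up to its far side;
  \<open>e\<close> comes from the gap to the next coordinate. The margin confines vertical segments
  to the block, and later gives deformations room to fade out.\<close>

lemma margin:
  obtains e where "e > 0"
    "\<And>p q. x \<le> p \<Longrightarrow> p < 1 \<Longrightarrow> y1 < q \<and> q < y1 + e \<or> y0 - e < q \<and> q < y0 \<Longrightarrow> (p, q) \<notin> skeleton T"
proof -
  have fin: "finite (coords T)" using tiling tiling_finite finite_coords by blast
  obtain e1 where e1: "e1 > 0" "\<And>z. z \<in> coords T \<Longrightarrow> z \<noteq> y1 \<Longrightarrow> e1 \<le> \<bar>z - y1\<bar>"
    using finite_gap[OF fin] by blast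
  obtain e2 where e2: "e2 > 0" "\<And>z. z \<in> coords T \<Longrightarrow> z \<noteq> y0 \<Longrightarrow> e2 \<le> \<bar>z - y0\<bar>"
    using finite_gap[OF fin] by blast
  have h1: "(p, q) \<notin> skeleton T" if p: "x \<le> p" "p < 1" and q: "y1 < q" "q < y1 + e1" for p q
  proof
    assume s: "(p, q) \<in> skeleton T"
    then have "q \<le> 1" by (auto simp: mem_skeleton[OF tiling])
    then have y: "0 \<le> y1" "y1 < 1" using q y_bounds by auto
    have p': "0 < p" "p \<le> 1" using p x_gt by auto
    obtain t where t: "t \<in> T" "xl t < p" "p \<le> xr t" "yl t \<le> y1" "y1 < yr t"
      using tile_upper_left[OF tiling p' y] by blast
    have "xr t = 1" using clear[OF t(1)] t p y_less by auto
    moreover have "q < yr t" using e1(2)[OF coordsI(4)[OF t(1)]] t q by auto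
    ultimately show False using s t p q unfolding mem_skeleton[OF tiling] by auto
  qed
  have h2: "(p, q) \<notin> skeleton T" if p: "x \<le> p" "p < 1" and q: "y0 - e2 < q" "q < y0" for p q
  proof
    assume s: "(p, q) \<in> skeleton T"
    then have "0 \<le> q" by (auto simp: mem_skeleton[OF tiling])
    then have y: "0 < y0" "y0 \<le> 1" using q y_bounds by auto
    have p': "0 < p" "p \<le> 1" using p x_gt by auto
    obtain t where t: "t \<in> T" "xl t < p" "p \<le> xr t" "yl t < y0" "y0 \<le> yr t"
      using tile_lower_left[OF tiling p' y] by blast
    have "xr t = 1" using clear[OF t(1)] t p y_less by auto
    moreover have "yl t < q" using e2(2)[OF coordsI(3)[OF t(1)]] t q by auto
    ultimately show False using s t p q unfolding mem_skeleton[OF tiling] by auto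
  qed
  show ?thesis
  proof (rule that)
    show "min e1 e2 > 0" using e1(1) e2(1) by simp
    fix p q assume "x \<le> p" "p < 1" "y1 < q \<and> q < y1 + min e1 e2 \<or> y0 - min e1 e2 < q \<and> q < y0"
    then show "(p, q) \<notin> skeleton T" using h1[of p q] h2[of p q] by (auto simp: min_def split: if_splits)
  qed
qed

lemma finU: "finite U"
  using finite_right_hits[OF tiling] by (simp add: U_def)

text \<open>The margin keeps such a segment within the heights of the block, where a vertical line
  short of the right side meets the skeleton only at \<open>y0\<close>, \<open>y1\<close> and the
  finitely many heights in \<open>U\<close>.\<close>

lemma no_vseg:
  assumes "a < b" "x \<le> p" "p < 1" "a \<le> y1" "y0 \<le> b" "\<And>y. a \<le> y \<Longrightarrow> y \<le> b \<Longrightarrow> (p, y) \<in> skeleton T"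
  shows False
proof -
  obtain e where e: "e > 0"
    "\<And>p q. x \<le> p \<Longrightarrow> p < 1 \<Longrightarrow> y1 < q \<and> q < y1 + e \<or> y0 - e < q \<and> q < y0 \<Longrightarrow> (p, q) \<notin> skeleton T"
    using margin by blast
  have b: "b \<le> y1"
  proof (rule ccontr)
    assume "\<not> b \<le> y1"
    then obtain q where "y1 < q" "q < min b (y1 + e)" using e(1) dense[of y1 "min b (y1 + e)"] by auto
    then show False using e(2)[of p q] assms(2-4) assms(6)[of q] by auto
  qed
  have a: "y0 \<le> a"
  proof (rule ccontr)
    assume "\<not> y0 \<le> a"
    then obtain q where "max a (y0 - e) < q" "q < y0" using e(1) dense[of "max a (y0 - e)" y0] by auto
    then show False using e(2)[of p q] assms(2,3,5) assms(6)[of q] by auto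
  qed
  have "{a..b} \<subseteq> insert y0 (insert y1 U)"
  proof
    fix y assume "y \<in> {a..b}"
    then show "y \<in> insert y0 (insert y1 U)"
      using skeleton_block[of p y] assms(2,3) assms(6)[of y] a b by auto
  qed
  then have "finite {a..b}" using finU finite_subset by blast
  then show False using assms(1) infinite_Icc by blast
qed

text \<open>A vertical segment that touches the block cannot cross the margin, and inside the block
  the edges at \<open>Z\<close> meet an abscissa other than \<open>x\<close> and 1 in finitely many
  points, too few for a segment.\<close>

lemma removable_glue: "removable (glue x y0 y1 V T) x y0 y1"
  unfolding removable_def
proof (intro conjI allI impI)
  show "0 < x" "x < 1" "0 \<le> y0" "y0 < y1" "y1 \<le> 1" using x_gt x_lt y_bounds y_less by auto
  show "(x, y) \<in> skeleton (glue x y0 y1 V T)" if "y0 \<le> y" "y \<le> y1" for y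
    using that x_lt by (subst skeleton_glue_block) auto
  show "(\<xi>, y0) \<in> skeleton (glue x y0 y1 V T)" "(\<xi>, y1) \<in> skeleton (glue x y0 y1 V T)"
    if "x \<le> \<xi>" "\<xi> \<le> 1" for \<xi>
    using that y_less Z_ends by (auto simp: skeleton_glue_block)
next
  fix p a b assume *: "a < b" "x \<le> p" "p < 1" "a \<le> y1" "y0 \<le> b"
    "\<forall>y. a \<le> y \<longrightarrow> y \<le> b \<longrightarrow> (p, y) \<in> skeleton (glue x y0 y1 V T)"
  obtain e where e: "e > 0"
    "\<And>p q. x \<le> p \<Longrightarrow> p < 1 \<Longrightarrow> y1 < q \<and> q < y1 + e \<or> y0 - e < q \<and> q < y0 \<Longrightarrow> (p, q) \<notin> skeleton T"
    using margin by blast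
  show b: "b \<le> y1"
  proof (rule ccontr)
    assume "\<not> b \<le> y1"
    then obtain q where "y1 < q" "q < min b (y1 + e)" using e(1) dense[of y1 "min b (y1 + e)"] by auto
    then show False using e(2)[of p q] skeleton_glue_outside[of p q] * by auto
  qed
  show a: "y0 \<le> a"
  proof (rule ccontr)
    assume "\<not> y0 \<le> a"
    then obtain q where "max a (y0 - e) < q" "q < y0" using e(1) dense[of "max a (y0 - e)" y0] by auto
    then show False using e(2)[of p q] skeleton_glue_outside[of p q] * by auto
  qed
  show "p = x"
  proof (rule ccontr)
    assume n: "p \<noteq> x"
    have "{a..b} \<subseteq> Z"
    proof
      fix y assume "y \<in> {a..b}"
      then show "y \<in> Z" using skeleton_glue_block[of p y] * a b n by auto
    qed
    then have "finite {a..b}" using finZ finite_subset by blast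
    then show False using *(1) infinite_Icc by blast
  qed
qed

text \<open>Reads \<open>U\<close> off the glued skeleton, as the next lemma does for
  \<open>V\<close>. This is what makes the pattern of a block invariant under equivalences.\<close>

lemma U_glue:
  assumes "y0 < u" "u < y1"
  shows "u \<in> U \<longleftrightarrow> (\<exists>a<x. \<forall>\<xi>. a \<le> \<xi> \<longrightarrow> \<xi> \<le> x \<longrightarrow> (\<xi>, u) \<in> skeleton (glue x y0 y1 V T))"
    (is "_ \<longleftrightarrow> ?R")
proof
  assume u: "u \<in> U"
  obtain t where t: "t \<in> T" "in_block y0 y1 t" "yl t \<le> u" "u < yr t"
    using block_above[OF less_imp_le[OF assms(1)] assms(2)] by blast
  have "u \<in> levels T" using u by (auto simp: U_def levels_def)
  then have "yl t = u" using right_tile_no_level[OF tiling t(1)] t by (force simp: in_block_def)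
  then have "(\<xi>, u) \<in> skeleton (glue x y0 y1 V T)" if "xl t \<le> \<xi>" "\<xi> \<le> x" for \<xi>
    using that tile_sides_skeleton(1)[OF tiling t(1), of \<xi>] t x_lt skeleton_glue_outside[of \<xi> u]
      skeleton_glue_block[of x u] assms
    by (cases "\<xi> = x") (auto simp: in_block_def)
  then show ?R using block_tile_xl[OF t(1,2)] by blast
next
  assume ?R
  then obtain a where a: "a < x" "\<And>\<xi>. a \<le> \<xi> \<Longrightarrow> \<xi> \<le> x \<Longrightarrow> (\<xi>, u) \<in> skeleton (glue x y0 y1 V T)" by blast
  obtain t where t: "t \<in> T" "in_block y0 y1 t" "yl t \<le> u" "u < yr t"
    using block_above[OF less_imp_le[OF assms(1)] assms(2)] by blast
  obtain \<xi> where xi: "max a (xl t) < \<xi>" "\<xi> < x"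
    using dense[of "max a (xl t)" x] a block_tile_xl[OF t(1,2)] by auto
  then have "(\<xi>, u) \<in> skeleton T" using a(2)[of \<xi>] skeleton_glue_outside[of \<xi> u] by auto
  then have "yl t = u" using t xi x_lt unfolding mem_skeleton[OF tiling] by (force simp: in_block_def)
  then show "u \<in> U" using assms t right_tile_levels(1)[OF tiling t(1)] y_bounds
    by (auto simp: U_def levels_def in_block_def)
qed

lemma V_glue:
  assumes "y0 < u" "u < y1"
  shows "u \<in> V \<longleftrightarrow> (\<forall>\<xi>. x \<le> \<xi> \<longrightarrow> \<xi> \<le> 1 \<longrightarrow> (\<xi>, u) \<in> skeleton (glue x y0 y1 V T))" (is "_ \<longleftrightarrow> ?R")
proof
  assume "u \<in> V"
  then show ?R using assms by (auto simp: skeleton_glue_block Z_def)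
next
  assume ?R
  moreover obtain \<xi> where "x < \<xi>" "\<xi> < 1" using x_lt dense by blast
  ultimately show "u \<in> V" using assms skeleton_glue_block[of \<xi> u] by (auto simp: Z_def)
qed

lemma right_hits_glue: "right_hits (glue x y0 y1 V T) = (right_hits T - {y0<..<y1}) \<union> V"
proof (intro set_eqI)
  fix y
  let ?G = "glue x y0 y1 V T"
  consider "y < y0 \<or> y1 < y" | "y = y0 \<or> y = y1" | "y0 < y" "y < y1" by linarith
  then show "y \<in> right_hits ?G \<longleftrightarrow> y \<in> (right_hits T - {y0<..<y1}) \<union> V"
  proof cases
    case 1
    then have "y \<in> right_hits ?G \<longleftrightarrow> y \<in> right_hits T"
      unfolding right_hits_skeleton[OF tiling] right_hits_skeleton[OF tiling_glue]
      using skeleton_glue_outside[of _ y] by auto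
    then show ?thesis using 1 V_sub by auto
  next
    case 2
    have "y \<in> right_hits ?G \<longleftrightarrow> 0 < y \<and> y < 1"
      unfolding right_hits_skeleton[OF tiling_glue] using 2 Z_ends y_less x_lt
      by (auto simp: skeleton_glue_block intro!: exI[of _ x])
    moreover have "y \<in> right_hits T \<longleftrightarrow> 0 < y \<and> y < 1"
    proof -
      have "y \<in> levels T" using 2 lev by auto
      then show ?thesis by (auto simp: levels_def dest: right_hits_bounds)
    qed
    ultimately show ?thesis using 2 V_sub y_less by auto
  next
    case 3
    have "y \<in> right_hits ?G \<longleftrightarrow> y \<in> V"
    proof
      assume "y \<in> right_hits ?G"
      then obtain a where a: "a < 1" "\<And>\<xi>. a \<le> \<xi> \<Longrightarrow> \<xi> \<le> 1 \<Longrightarrow> (\<xi>, y) \<in> skeleton ?G"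
        unfolding right_hits_skeleton[OF tiling_glue] by blast
      obtain \<xi> where "max a x < \<xi>" "\<xi> < 1" using a x_lt dense[of "max a x" 1] by auto
      then show "y \<in> V" using a(2)[of \<xi>] skeleton_glue_block[of \<xi> y] 3 by (auto simp: Z_def)
    next
      assume "y \<in> V"
      then show "y \<in> right_hits ?G" using 3 V_glue[OF 3] x_lt y_bounds
        unfolding right_hits_skeleton[OF tiling_glue] by auto
    qed
    then show ?thesis using 3 by auto
  qed
qed

lemma card_right_hits_glue: "card (right_hits (glue x y0 y1 V T)) + card U = card (right_hits T) + card V"
proof -
  have fin: "finite (right_hits T)" by (rule finite_right_hits[OF tiling])
  have "card (right_hits (glue x y0 y1 V T)) = card (right_hits T - {y0<..<y1}) + card V"
    unfolding right_hits_glue using fin finV V_sub by (intro card_Un_disjoint) auto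
  moreover have "card (right_hits T - {y0<..<y1}) + card U = card (right_hits T)"
    unfolding U_def using fin
    by (subst card_Un_disjoint[symmetric]) (auto intro!: arg_cong[where f = card])
  ultimately show ?thesis by simp
qed

lemma xr_ne_x: "t \<in> T \<Longrightarrow> yl t \<le> y1 \<Longrightarrow> y0 \<le> yr t \<Longrightarrow> xr t \<noteq> x \<and> xl t \<noteq> x"
  using clear[of t] x_lt tile_bounds[OF tiling, of t] by force

lemma card_glue: "card (glue x y0 y1 V T) = card T + card V + 1"
proof -
  let ?A = "{t \<in> T. \<not> in_block y0 y1 t}" and ?B = "{t \<in> T. in_block y0 y1 t}"
  have fin: "finite ?A" "finite ?B" "finite (slabs x Z)"
    using tiling_finite[OF tiling] slabs_finite finZ by auto
  have rng: "yl u \<le> y1 \<and> y0 \<le> yr u" if "u \<in> T" "in_block y0 y1 u" for u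
    using that tile_bounds[OF tiling, of u] by (auto simp: in_block_def)
  have inj: "inj_on (trim x) ?B"
    unfolding inj_on_def using tile_bounds[OF tiling]
    by (auto simp: trim_def in_block_def tile_eq_iff)
  have "?A \<inter> trim x ` ?B = {}"
    using rng xr_ne_x by (force simp: trim_def)
  moreover have "(?A \<union> trim x ` ?B) \<inter> slabs x Z = {}"
  proof -
    have "((x, z), (1, z')) \<notin> ?A \<union> trim x ` ?B" if "consec Z z z'" for z z'
    proof
      assume "((x, z), (1, z')) \<in> ?A \<union> trim x ` ?B"
      then consider "((x, z), (1, z')) \<in> T" | u where "u \<in> ?B" "((x, z), (1, z')) = trim x u" by blast
      then show False
      proof cases
        case 1
        have "z \<le> y1" "y0 \<le> z'" using that Z_bounds by (auto simp: consec_def)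
        then show False using xr_ne_x[OF 1] by simp
      next
        case 2 then show False using x_lt by (simp add: trim_def)
      qed
    qed
    then show ?thesis by (auto simp: slabs_def)
  qed
  ultimately have "card (glue x y0 y1 V T) = card ?A + card (trim x ` ?B) + card (slabs x Z)"
    unfolding glue_def Z_def[symmetric] using fin by (simp add: card_Un_disjoint)
  also have "card (trim x ` ?B) = card ?B" by (rule card_image[OF inj])
  also have "card (slabs x Z) = card V + 1"
  proof -
    have "card Z = card V + 2" unfolding Z_def using finV V_sub y_less
      by (subst card_insert_disjoint) (auto simp: card_insert_if)
    then show ?thesis using card_slabs[OF finZ] Z_ends by auto
  qed
  also have "card ?A + card ?B = card T"
    using tiling_finite[OF tiling] by (subst card_Un_disjoint[symmetric]) (auto intro!: arg_cong[where f = card])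
  finally show ?thesis by simp
qed

lemma block_yl: "(\<exists>t\<in>T. in_block y0 y1 t \<and> yl t = y) \<longleftrightarrow> y = y0 \<or> y \<in> U"
proof
  assume "\<exists>t\<in>T. in_block y0 y1 t \<and> yl t = y"
  then obtain t where t: "t \<in> T" "in_block y0 y1 t" "yl t = y" by blast
  then have "y \<in> levels T" using right_tile_levels(1)[OF tiling t(1)] by (auto simp: in_block_def)
  then show "y = y0 \<or> y \<in> U" using t tile_bounds[OF tiling t(1)] y_bounds
    by (auto simp: U_def levels_def in_block_def)
next
  assume y: "y = y0 \<or> y \<in> U"
  then have "y0 \<le> y" "y < y1" using y_less by (auto simp: U_def)
  then obtain t where t: "t \<in> T" "in_block y0 y1 t" "yl t \<le> y" "y < yr t" using block_above by blast
  have "y \<in> levels T" using y lev by (auto simp: U_def levels_def)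
  then have "yl t = y" using right_tile_no_level[OF tiling t(1)] t by (force simp: in_block_def)
  then show "\<exists>t\<in>T. in_block y0 y1 t \<and> yl t = y" using t by blast
qed

lemma block_yr: "(\<exists>t\<in>T. in_block y0 y1 t \<and> yr t = y) \<longleftrightarrow> y = y1 \<or> y \<in> U"
proof
  assume "\<exists>t\<in>T. in_block y0 y1 t \<and> yr t = y"
  then obtain t where t: "t \<in> T" "in_block y0 y1 t" "yr t = y" by blast
  then have "y \<in> levels T" using right_tile_levels(2)[OF tiling t(1)] by (auto simp: in_block_def)
  then show "y = y1 \<or> y \<in> U" using t tile_bounds[OF tiling t(1)] y_bounds
    by (auto simp: U_def levels_def in_block_def)
next
  assume y: "y = y1 \<or> y \<in> U"
  then have "y0 < y" "y \<le> y1" using y_less by (auto simp: U_def)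
  then obtain t where t: "t \<in> T" "in_block y0 y1 t" "yl t < y" "y \<le> yr t" using block_below by blast
  have "y \<in> levels T" using y lev by (auto simp: U_def levels_def)
  then have "yr t = y" using right_tile_no_level[OF tiling t(1)] t by (force simp: in_block_def)
  then show "\<exists>t\<in>T. in_block y0 y1 t \<and> yr t = y" using t by blast
qed

lemma slab_z: "(\<exists>z'. consec Z z z') \<longleftrightarrow> z \<in> Z \<and> z \<noteq> y1"
proof
  assume "z \<in> Z \<and> z \<noteq> y1"
  then have z: "y0 \<le> z" "z < y1" "z \<in> Z" using Z_bounds[of z] by auto
  obtain w w' where "consec Z w w'" "w \<le> z" "z < w'" using consec_above[OF finZ Z_ends z(1,2)] by blast
  moreover have "w = z" using calculation z by (force simp: consec_def)
  ultimately show "\<exists>z'. consec Z z z'" by blast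
qed (use Z_bounds in \<open>force simp: consec_def\<close>)

lemma slab_z': "(\<exists>z. consec Z z z') \<longleftrightarrow> z' \<in> Z \<and> z' \<noteq> y0"
proof
  assume "z' \<in> Z \<and> z' \<noteq> y0"
  then have z: "y0 < z'" "z' \<le> y1" "z' \<in> Z" using Z_bounds[of z'] by auto
  obtain w w' where "consec Z w w'" "w < z'" "z' \<le> w'" using consec_below[OF finZ Z_ends z(1,2)] by blast
  moreover have "w' = z'" using calculation z by (force simp: consec_def)
  ultimately show "\<exists>z. consec Z z z'" by blast
qed (use Z_bounds in \<open>force simp: consec_def\<close>)

lemma bex_glue:
  "(\<exists>t\<in>glue x y0 y1 V T. P t) \<longleftrightarrow> (\<exists>t\<in>T. \<not> in_block y0 y1 t \<and> P t) \<or>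
     (\<exists>t\<in>T. in_block y0 y1 t \<and> P (trim x t)) \<or> (\<exists>z z'. consec Z z z' \<and> P ((x, z), (1, z')))"
  unfolding Bex_def mem_glue by blast

lemma ll_glue: "ll_corner (glue x y0 y1 V T) (p, q) \<longleftrightarrow> ll_corner T (p, q) \<or> p = x \<and> q \<in> Z \<and> q \<noteq> y1"
  unfolding ll_corner_def bex_glue slab_z[symmetric] by auto

lemma ul_glue: "ul_corner (glue x y0 y1 V T) (p, q) \<longleftrightarrow> ul_corner T (p, q) \<or> p = x \<and> q \<in> Z \<and> q \<noteq> y0"
  unfolding ul_corner_def bex_glue slab_z'[symmetric] by auto

text \<open>The abscissa 1 is set apart because trimming moves the right corners of the block tiles
  from there to \<open>x\<close>.\<close>

lemma lr_glue:
  assumes "p \<noteq> 1"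
  shows "lr_corner (glue x y0 y1 V T) (p, q) \<longleftrightarrow> lr_corner T (p, q) \<or> p = x \<and> (q = y0 \<or> q \<in> U)"
proof -
  have "(\<exists>t\<in>T. \<not> in_block y0 y1 t \<and> (xr t, yl t) = (p, q)) \<longleftrightarrow> lr_corner T (p, q)"
    using assms by (auto simp: lr_corner_def in_block_def)
  moreover have "(\<exists>t\<in>T. in_block y0 y1 t \<and> (xr (trim x t), yl (trim x t)) = (p, q)) \<longleftrightarrow> p = x \<and> (q = y0 \<or> q \<in> U)"
    unfolding block_yl[symmetric] by auto
  ultimately show ?thesis using assms unfolding lr_corner_def[of "glue x y0 y1 V T"] bex_glue by auto
qed

lemma ur_glue:
  assumes "p \<noteq> 1"
  shows "ur_corner (glue x y0 y1 V T) (p, q) \<longleftrightarrow> ur_corner T (p, q) \<or> p = x \<and> (q = y1 \<or> q \<in> U)"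
proof -
  have "(\<exists>t\<in>T. \<not> in_block y0 y1 t \<and> (xr t, yr t) = (p, q)) \<longleftrightarrow> ur_corner T (p, q)"
    using assms by (auto simp: ur_corner_def in_block_def)
  moreover have "(\<exists>t\<in>T. in_block y0 y1 t \<and> (xr (trim x t), yr (trim x t)) = (p, q)) \<longleftrightarrow> p = x \<and> (q = y1 \<or> q \<in> U)"
    unfolding block_yr[symmetric] by auto
  ultimately show ?thesis using assms unfolding ur_corner_def[of "glue x y0 y1 V T"] bex_glue by auto
qed

text \<open>By \<open>clear\<close> no old corner lies on the new segment. Its left corners come
  from the slabs and its right corners from the trimmed tiles, so all four kinds meet exactly where
  an old and a new edge have the same height. The ends fail: \<open>y0\<close> is not an upper and
  \<open>y1\<close> not a lower left corner of a slab.\<close>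

lemma singular_glue: "singular_vertices (glue x y0 y1 V T) = singular_vertices T \<union> {x} \<times> (U \<inter> V)"
proof (intro set_eqI)
  fix pq :: "real \<times> real"
  obtain p q where pq: "pq = (p, q)" by fastforce
  let ?G = "glue x y0 y1 V T"
  have one: "p \<noteq> 1" if "ll_corner S (p, q)" "is_tiling S" for S
  proof -
    obtain t where t: "t \<in> S" "xl t = p" using \<open>ll_corner S (p, q)\<close> by (auto simp: ll_corner_def)
    then show ?thesis using tile_bounds[OF that(2) t(1)] by simp
  qed
  have no: "\<not> ll_corner T (x, q)" "\<not> ul_corner T (x, q)" "\<not> lr_corner T (x, q)" "\<not> ur_corner T (x, q)"
    if "y0 \<le> q" "q \<le> y1"
  proof -
    have "xr t \<noteq> x \<and> xl t \<noteq> x" if "t \<in> T" "yl t = q \<or> yr t = q" for t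
      using that tile_bounds(5)[OF tiling that(1)] \<open>y0 \<le> q\<close> \<open>q \<le> y1\<close> xr_ne_x[OF that(1)] by fastforce
    then show "\<not> ll_corner T (x, q)" "\<not> ul_corner T (x, q)" "\<not> lr_corner T (x, q)" "\<not> ur_corner T (x, q)"
      by (auto simp: ll_corner_def ul_corner_def lr_corner_def ur_corner_def)
  qed
  show "pq \<in> singular_vertices ?G \<longleftrightarrow> pq \<in> singular_vertices T \<union> {x} \<times> (U \<inter> V)"
  proof (cases "p = x \<and> y0 \<le> q \<and> q \<le> y1")
    case True
    then show ?thesis
      unfolding pq Un_iff singular_iff[OF tiling] singular_iff[OF tiling_glue] ll_glue ul_glue
      using lr_glue[of p q] ur_glue[of p q] no x_lt y_less by (auto simp: Z_def U_def)
  next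
    case False
    have "ll_corner ?G pq \<longleftrightarrow> ll_corner T pq" "ul_corner ?G pq \<longleftrightarrow> ul_corner T pq"
      using False Z_bounds by (auto simp: pq ll_glue ul_glue)
    moreover have "lr_corner ?G pq \<longleftrightarrow> lr_corner T pq" "ur_corner ?G pq \<longleftrightarrow> ur_corner T pq" if "p \<noteq> 1"
      using that False y_less by (auto simp: pq lr_glue ur_glue U_def)
    moreover have "p \<noteq> 1" if "ll_corner T pq" using one[of T] that tiling by (simp add: pq)
    ultimately show ?thesis using False
      unfolding Un_iff singular_iff[OF tiling] singular_iff[OF tiling_glue] by (auto simp: pq U_def)
  qed
qed

lemma card_singular_glue:
  "card (singular_vertices (glue x y0 y1 V T)) = card (singular_vertices T) + card (U \<inter> V)"
proof -
  have "singular_vertices T \<inter> {x} \<times> (U \<inter> V) = {}"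
  proof -
    have "(x, u) \<notin> singular_vertices T" if "u \<in> U" for u
    proof
      assume "(x, u) \<in> singular_vertices T"
      then obtain t where t: "t \<in> T" "xl t = x" "yl t = u"
        by (auto simp: singular_iff[OF tiling] ll_corner_def)
      then show False using that xr_ne_x[OF t(1)] tile_bounds[OF tiling t(1)] by (auto simp: U_def)
    qed
    then show ?thesis by auto
  qed
  moreover have "card ({x} \<times> (U \<inter> V)) = card (U \<inter> V)" by (simp add: card_cartesian_product)
  ultimately show ?thesis unfolding singular_glue
    using finite_singular[OF tiling] finU by (simp add: card_Un_disjoint)
qed

end

section \<open>Removing a block\<close>

lemma removableD:
  assumes "removable T x y0 y1"
  shows "0 < x" "x < 1" "0 \<le> y0" "y0 < y1" "y1 \<le> 1"
    "\<And>y. y0 \<le> y \<Longrightarrow> y \<le> y1 \<Longrightarrow> (x, y) \<in> skeleton T"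
    "\<And>\<xi>. x \<le> \<xi> \<Longrightarrow> \<xi> \<le> 1 \<Longrightarrow> (\<xi>, y0) \<in> skeleton T"
    "\<And>\<xi>. x \<le> \<xi> \<Longrightarrow> \<xi> \<le> 1 \<Longrightarrow> (\<xi>, y1) \<in> skeleton T"
  using assms unfolding removable_def by auto

lemma removable_vseg:
  assumes "removable T x y0 y1" "a < b" "x \<le> p" "p < 1" "a \<le> y1" "y0 \<le> b"
    "\<And>y. a \<le> y \<Longrightarrow> y \<le> b \<Longrightarrow> (p, y) \<in> skeleton T"
  shows "p = x" "y0 \<le> a" "b \<le> y1"
  using assms unfolding removable_def by blast+

definition extend :: "tile \<Rightarrow> tile" where
  "extend t = ((xl t, yl t), (1, yr t))"

lemma extend_sel [simp]: "xl (extend t) = xl t" "yl (extend t) = yl t" "xr (extend t) = 1" "yr (extend t) = yr t"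
  by (simp_all add: extend_def)

locale removal =
  fixes T :: "tile set" and x y0 y1 :: real
  assumes tiling: "is_tiling T" and rem: "removable T x y0 y1"
begin

lemmas bounds = removableD(1-5)[OF rem]

definition "right_part t \<longleftrightarrow> xl t = x \<and> y0 \<le> yl t \<and> yr t \<le> y1"
definition "left_part t \<longleftrightarrow> xr t = x \<and> y0 \<le> yl t \<and> yr t \<le> y1"
definition "unglue = {t \<in> T. \<not> right_part t \<and> \<not> left_part t} \<union> extend ` {t \<in> T. left_part t}"
definition "V = right_hits T \<inter> {y0<..<y1}"

text \<open>The left side of \<open>t\<close> is a vertical segment that touches the block, so
  removability puts it on the left side of the block.\<close>

lemma touch_xl:
  assumes "t \<in> T" "yl t \<le> y1" "y0 \<le> yr t" "x \<le> xl t"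
  shows "right_part t"
  using removable_vseg[OF rem, of "yl t" "yr t" "xl t"] tile_sides_skeleton(3)[OF tiling assms(1)]
    tile_bounds[OF tiling assms(1)] assms by (auto simp: right_part_def)

lemma touch_xr:
  assumes "t \<in> T" "yl t \<le> y1" "y0 \<le> yr t" "x \<le> xr t" "xr t < 1"
  shows "left_part t"
  using removable_vseg[OF rem, of "yl t" "yr t" "xr t"] tile_sides_skeleton(4)[OF tiling assms(1)]
    tile_bounds[OF tiling assms(1)] assms by (auto simp: left_part_def)

lemma right_part_xr: "t \<in> T \<Longrightarrow> right_part t \<Longrightarrow> xr t = 1"
  using touch_xr[of t] tile_bounds[OF tiling, of t] bounds
  by (force simp: left_part_def right_part_def)

lemma left_side: "t \<in> T \<Longrightarrow> xl t < x \<Longrightarrow> x < xr t \<Longrightarrow> yl t < y \<Longrightarrow> y < yr t \<Longrightarrow> y0 \<le> y \<Longrightarrow> y \<le> y1 \<Longrightarrow> False"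
  using removableD(6)[OF rem, of y] unfolding mem_skeleton[OF tiling] by blast

lemma touch_beyond:
  assumes "t \<in> T" "yl t \<le> y1" "y0 \<le> yr t" "x < xr t" "\<not> right_part t"
  shows "xl t < x" "xr t = 1"
  using touch_xl[OF assms(1-3)] touch_xr[OF assms(1-3)] assms tile_bounds[OF tiling assms(1)]
  by (force simp: left_part_def)+

lemma interior_right_part:
  assumes "t \<in> T" "xl t < \<xi>" "\<xi> < xr t" "yl t < y" "y < yr t" "x < \<xi>" "y0 < y" "y < y1"
  shows "right_part t"
proof (rule ccontr)
  assume n: "\<not> ?thesis"
  have "xl t < x" using touch_beyond[OF assms(1) _ _ _ n] assms by auto
  then show False using left_side[OF assms(1), of y] assms by auto
qed

lemma left_above:
  assumes "y0 \<le> y" "y < y1"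
  obtains t where "t \<in> T" "left_part t" "yl t \<le> y" "y < yr t"
proof -
  have b: "0 < x" "x \<le> 1" "0 \<le> y" "y < 1" using bounds assms by auto
  obtain t where t: "t \<in> T" "xl t < x" "x \<le> xr t" "yl t \<le> y" "y < yr t"
    using tile_upper_left[OF tiling b] by blast
  obtain y' where y': "y < y'" "y' < min (yr t) y1" using dense[of y "min (yr t) y1"] t assms by auto
  have "xr t = x" using left_side[OF t(1,2), of y'] t y' assms by force
  then show ?thesis using that[OF t(1)] touch_xr[OF t(1)] t assms bounds by auto
qed

lemma left_below:
  assumes "y0 < y" "y \<le> y1"
  obtains t where "t \<in> T" "left_part t" "yl t < y" "y \<le> yr t"
proof -
  have b: "0 < x" "x \<le> 1" "0 < y" "y \<le> 1" using bounds assms by auto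
  obtain t where t: "t \<in> T" "xl t < x" "x \<le> xr t" "yl t < y" "y \<le> yr t"
    using tile_lower_left[OF tiling b] by blast
  obtain y' where y': "max (yl t) y0 < y'" "y' < y" using dense[of "max (yl t) y0" y] t assms by auto
  have "xr t = x" using left_side[OF t(1,2), of y'] t y' assms by force
  then show ?thesis using that[OF t(1)] touch_xr[OF t(1)] t assms bounds by auto
qed

lemma left_cover:
  assumes "y0 \<le> y" "y \<le> y1"
  obtains t where "t \<in> T" "left_part t" "yl t \<le> y" "y \<le> yr t"
proof (cases "y < y1")
  case True
  then obtain t where "t \<in> T" "left_part t" "yl t \<le> y" "y < yr t" using left_above assms by blast
  then show ?thesis using that[of t] by simp
next
  case False
  then have "y0 < y" using bounds by simp
  then obtain t where "t \<in> T" "left_part t" "yl t < y" "y \<le> yr t" using left_below assms by blast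
  then show ?thesis using that[of t] by simp
qed

lemma unglue_cases [consumes 1, case_names outside extended]:
  assumes "t \<in> unglue"
    and "\<lbrakk>t \<in> T; \<not> right_part t; \<not> left_part t\<rbrakk> \<Longrightarrow> P"
    and "\<And>u. \<lbrakk>u \<in> T; left_part u; t = extend u\<rbrakk> \<Longrightarrow> P"
  shows P
  using assms unfolding unglue_def by blast

lemma left_part_b: "t \<in> T \<Longrightarrow> left_part t \<Longrightarrow> xl t < x"
  using tile_bounds[OF tiling, of t] by (auto simp: left_part_def)

lemma tiling_unglue: "is_tiling unglue"
proof (rule is_tilingI)
  show "finite unglue" using tiling_finite[OF tiling] by (simp add: unglue_def)
next
  fix t assume "t \<in> unglue"
  then show "0 \<le> xl t \<and> xl t < xr t \<and> xr t \<le> 1 \<and> 0 \<le> yl t \<and> yl t < yr t \<and> yr t \<le> 1"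
  proof (cases rule: unglue_cases)
    case outside then show ?thesis using tile_bounds[OF tiling, of t] by auto
  next
    case (extended u) then show ?thesis using tile_bounds[OF tiling, of u] by auto
  qed
next
  fix \<xi> y :: real assume b: "0 \<le> \<xi>" "\<xi> \<le> 1" "0 \<le> y" "y \<le> 1"
  obtain t where t: "t \<in> T" "xl t \<le> \<xi>" "\<xi> \<le> xr t" "yl t \<le> y" "y \<le> yr t"
    using tile_covers[OF tiling b] by blast
  consider "right_part t" | "left_part t" | "\<not> right_part t" "\<not> left_part t" by blast
  then show "\<exists>t\<in>unglue. xl t \<le> \<xi> \<and> \<xi> \<le> xr t \<and> yl t \<le> y \<and> y \<le> yr t"
  proof cases
    case 1
    then have y: "y0 \<le> y" "y \<le> y1" "x \<le> \<xi>" using t by (auto simp: right_part_def)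
    obtain u where u: "u \<in> T" "left_part u" "yl u \<le> y" "y \<le> yr u" using left_cover[OF y(1,2)] by blast
    then have "extend u \<in> unglue" by (auto simp: unglue_def)
    then show ?thesis using u left_part_b[OF u(1,2)] y b by (intro bexI[of _ "extend u"]) auto
  next
    case 2
    then have "extend t \<in> unglue" using t by (auto simp: unglue_def)
    then show ?thesis using t b by (intro bexI[of _ "extend t"]) auto
  next
    case 3 then show ?thesis using t by (intro bexI[of _ t]) (auto simp: unglue_def)
  qed
next
  fix t u \<xi> y
  assume t: "t \<in> unglue" and u: "u \<in> unglue"
    and i: "xl t < \<xi>" "\<xi> < xr t" "yl t < y" "y < yr t" "xl u < \<xi>" "\<xi> < xr u" "yl u < y" "y < yr u"
  have eq: "v = w" if "v \<in> T" "w \<in> T" "xl v < xr w" "xl w < xr v" "yl v < y" "y < yr v" "yl w < y" "y < yr w" for v w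
    using that by (intro tile_eqI[OF tiling that(1,2)]) auto
  \<comment> \<open>An extended tile cannot overlap an untouched one: left of \<open>x\<close> both
    are tiles of \<open>T\<close>, right of \<open>x\<close> only block tiles have interior points
    at these heights, and on the line itself \<open>w\<close> would cross the left side of the
    block.\<close>
  have mixed: False if v: "v \<in> T" "left_part v" "xl v < \<xi>" "yl v < y" "y < yr v"
    and w: "w \<in> T" "\<not> right_part w" "\<not> left_part w" "xl w < \<xi>" "\<xi> < xr w" "yl w < y" "y < yr w" for v w
  proof -
    have y: "y0 < y" "y < y1" and xv: "xr v = x" using v by (auto simp: left_part_def)
    show False
    proof (cases "\<xi> \<le> x")
      case True
      show False
      proof (cases "\<xi> = x")
        case True then show False using left_side[OF w(1), of y] w y by auto
      next
        case False
        then have "v = w" using True v w xv by (intro eq) auto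
        then show False using v w by blast
      qed
    next
      case False then show False using interior_right_part[OF w(1,4-7)] w(2) y by auto
    qed
  qed
  from t show "t = u"
  proof (cases rule: unglue_cases)
    case to: outside
    from u show ?thesis
    proof (cases rule: unglue_cases)
      case outside then show ?thesis using to i eq[of t u] by auto
    next
      case (extended w) then show ?thesis using to i mixed[of w t] by auto
    qed
  next
    case te: (extended v)
    from u show ?thesis
    proof (cases rule: unglue_cases)
      case outside then show ?thesis using te i mixed[of v u] by auto
    next
      case (extended w)
      then have "v = w" using te i left_part_b[of v] left_part_b[of w]
        by (intro eq) (auto simp: left_part_def)
      then show ?thesis using te extended by blast
    qed
  qed
qed

text \<open>The ends of the block are levels of the smaller tiling because the tiles at the two ends
  of the left side now reach the right side.\<close>

sublocale un: gluing unglue x y0 y1 V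
proof
  show "is_tiling unglue" by (rule tiling_unglue)
  show "0 < x" "x < 1" "y0 < y1" by (fact bounds)+
  have ext: "extend t \<in> unglue" if "t \<in> T" "left_part t" for t using that by (auto simp: unglue_def)
  obtain t where t: "t \<in> T" "left_part t" "yl t \<le> y0" "y0 < yr t" using left_above[OF order_refl bounds(4)] by blast
  then have "yl t = y0" by (auto simp: left_part_def)
  then show "y0 \<in> levels unglue" using right_tile_levels(1)[OF tiling_unglue ext[OF t(1,2)]] by simp
  obtain t where t: "t \<in> T" "left_part t" "yl t < y1" "y1 \<le> yr t" using left_below[OF bounds(4) order_refl] by blast
  then have "yr t = y1" by (auto simp: left_part_def)
  then show "y1 \<in> levels unglue" using right_tile_levels(2)[OF tiling_unglue ext[OF t(1,2)]] by simp
  show "finite V" "V \<subseteq> {y0<..<y1}" using finite_right_hits[OF tiling] by (auto simp: V_def)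
  fix t assume t: "t \<in> unglue" "yl t \<le> y1" "y0 \<le> yr t"
  from t(1) show "xr t < x \<or> xr t = 1 \<and> xl t < x"
  proof (cases rule: unglue_cases)
    case outside
    then show ?thesis using touch_beyond[of t] touch_xr[of t] t bounds by (cases "xr t" x rule: linorder_cases) auto
  next
    case (extended u) then show ?thesis using left_part_b by auto
  qed
qed

lemma Z_eq: "un.Z = insert y0 (insert y1 (right_hits T \<inter> {y0<..<y1}))"
  unfolding un.Z_def unfolding V_def ..

lemma right_part_consec:
  assumes "t \<in> T" "right_part t"
  shows "consec un.Z (yl t) (yr t)"
proof -
  have xr: "xr t = 1" using right_part_xr assms by blast
  note lv = right_tile_levels[OF tiling assms(1) xr] and bt = tile_bounds[OF tiling assms(1)]
  have "yl t \<in> un.Z" "yr t \<in> un.Z"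
    using lv bt assms(2) bounds by (auto simp: Z_eq levels_def right_part_def)
  moreover have "w \<le> yl t \<or> yr t \<le> w" if "w \<in> un.Z" for w
    using that right_tile_no_level[OF tiling assms(1) xr, of w] assms(2) bt
    by (auto simp: Z_eq levels_def right_part_def)
  ultimately show ?thesis using bt by (auto simp: consec_def)
qed

lemma glue_unglue: "glue x y0 y1 V unglue = T"
proof (intro set_eqI iffI)
  fix t assume "t \<in> glue x y0 y1 V unglue"
  then show "t \<in> T"
  proof (cases rule: un.glue_cases)
    case outside
    from outside(1) show ?thesis
    proof (cases rule: unglue_cases)
      case (extended u)
      then show ?thesis using outside by (auto simp: in_block_def left_part_def)
    qed
  next
    case (trimmed u)
    from trimmed(1) show ?thesis
    proof (cases rule: unglue_cases)
      case outside
      have b: "yl u \<le> y1" "y0 \<le> yr u" "x < xr u"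
        using trimmed(2) tile_bounds[OF tiling outside(1)] bounds by (auto simp: in_block_def)
      obtain y where "yl u < y" "y < yr u" using dense tile_bounds(5)[OF tiling outside(1)] by blast
      then have False using left_side[OF outside(1) touch_beyond(1)[OF outside(1) b outside(2)] b(3), of y] trimmed(2)
        by (auto simp: in_block_def)
      then show ?thesis ..
    next
      case (extended w)
      then have "t = w" using trimmed by (simp add: tile_eq_iff left_part_def)
      then show ?thesis using extended by blast
    qed
  next
    case (slab z z')
    have z: "y0 \<le> z" "z < z'" "z' \<le> y1" using slab(1) un.Z_bounds by (auto simp: consec_def)
    have zb: "0 \<le> z" "z < 1" using z bounds by auto
    obtain u where u: "u \<in> T" "xr u = 1" "yl u \<le> z" "z < yr u" using right_tile_above[OF tiling zb] by blast
    note bu = tile_bounds[OF tiling u(1)]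
    obtain y where y: "z < y" "y < min (yr u) z'" using dense[of z "min (yr u) z'"] u z by auto
    obtain \<xi> where xi: "max x (xl u) < \<xi>" "\<xi> < 1" using dense[of "max x (xl u)" 1] bounds bu u by auto
    have rp: "right_part u" using interior_right_part[OF u(1), of \<xi> y] u y xi z by auto
    have "yl u = z \<and> yr u = z'"
      using consec_unique[OF right_part_consec[OF u(1) rp] slab(1)] u z by auto
    then have "t = u" using slab rp u by (simp add: tile_eq_iff right_part_def)
    then show ?thesis using u by blast
  qed
next
  fix t assume t: "t \<in> T"
  consider "right_part t" | "left_part t" | "\<not> right_part t" "\<not> left_part t" by blast
  then show "t \<in> glue x y0 y1 V unglue"
  proof cases
    case 1
    then have "t = ((x, yl t), (1, yr t))" using right_part_xr[OF t] by (simp add: tile_eq_iff right_part_def)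
    then show ?thesis using un.slab_mem[OF right_part_consec[OF t 1]] by simp
  next
    case 2
    then have e: "extend t \<in> unglue" "in_block y0 y1 (extend t)"
      using t by (auto simp: unglue_def in_block_def left_part_def)
    have "t = trim x (extend t)" using 2 by (simp add: tile_eq_iff left_part_def)
    then show ?thesis using un.trim_mem[OF e] by simp
  next
    case 3
    then have m: "t \<in> unglue" using t by (auto simp: unglue_def)
    have "\<not> in_block y0 y1 t"
    proof
      assume ib: "in_block y0 y1 t"
      then have b: "yl t \<le> y1" "y0 \<le> yr t" "x < xr t"
        using tile_bounds[OF tiling t] bounds by (auto simp: in_block_def)
      obtain y where "yl t < y" "y < yr t" using dense tile_bounds(5)[OF tiling t] by blast
      then show False using left_side[OF t touch_beyond(1)[OF t b 3(1)] b(3), of y] ib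
        by (auto simp: in_block_def)
    qed
    then show ?thesis using m by (auto simp: un.mem_glue)
  qed
qed

end

section \<open>Removable blocks: separation, existence, the lowest one\<close>

lemma removable_unglue:
  assumes "is_tiling T" "removable T x y0 y1"
  obtains S V where "gluing S x y0 y1 V" "glue x y0 y1 V S = T"
proof -
  interpret removal T x y0 y1 by unfold_locales (fact assms)+
  show ?thesis using that un.gluing_axioms glue_unglue by blast
qed

text \<open>The left side of the block that starts further to the right is a vertical segment
  touching the other block, hence lies on the left side of that one; exchanging the roles gives
  equality. Height ranges that share a single end point are covered too, so distinct blocks never
  share a level.\<close>

lemma removable_overlap_eq:
  assumes "removable T x y0 y1" "removable T x' z0 z1" "y0 \<le> z1" "z0 \<le> y1"
  shows "x = x' \<and> y0 = z0 \<and> y1 = z1"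
proof -
  have *: "x' = x \<and> y0 = z0 \<and> y1 = z1"
    if r: "removable T x y0 y1" "removable T x' z0 z1" "y0 \<le> z1" "z0 \<le> y1" "x \<le> x'" for x x' y0 y1 z0 z1
  proof -
    note d = removableD[OF r(1)] and d' = removableD[OF r(2)]
    have *: "x' = x" "y0 \<le> z0" "z1 \<le> y1"
      using removable_vseg[OF r(1) d'(4) r(5) d'(2) r(4) r(3) d'(6)] by blast+
    moreover have "z0 \<le> y0" "y1 \<le> z1"
      using removable_vseg[OF r(2) d(4) _ d(2) _ _ d(6)] * r(3,4) by auto
    ultimately show ?thesis by auto
  qed
  show ?thesis
  proof (cases "x \<le> x'")
    case True then show ?thesis using *[OF assms] by auto
  next
    case False
    then show ?thesis using *[OF assms(2,1) assms(4,3)] by auto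
  qed
qed

text \<open>Since \<open>x\<close> is the largest left abscissa among the right tiles, a vertical
  segment at or beyond it that touches the block can consist only of left sides at
  \<open>x\<close>.\<close>

lemma ex_removable:
  assumes T: "is_tiling T" and t0: "t0 \<in> T" "xr t0 = 1" "0 < xl t0"
  shows "\<exists>x y0 y1. removable T x y0 y1"
proof -
  let ?R = "{t \<in> T. xr t = 1}"
  have fin: "finite (xl ` ?R)" using tiling_finite[OF T] by simp
  define x where "x = Max (xl ` ?R)"
  have "x \<in> xl ` ?R" unfolding x_def by (rule Max_in[OF fin]) (use t0 in blast)
  then obtain t1 where t1: "t1 \<in> T" "xr t1 = 1" "xl t1 = x" by auto
  have le: "xl t \<le> x" if "t \<in> T" "xr t = 1" for t
    unfolding x_def using fin that by (intro Max_ge) auto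
  have x: "0 < x" "x < 1" using le[OF t0(1,2)] t0 t1 tile_bounds[OF T t1(1)] by auto
  define A where "A = (\<Union>t\<in>{t \<in> ?R. xl t = x}. {yl t..yr t})"
  have "compact A" unfolding A_def using tiling_finite[OF T] by (intro compact_UN) auto
  have AI: "y \<in> A" if "t \<in> T" "xr t = 1" "xl t = x" "yl t \<le> y" "y \<le> yr t" for t y
    unfolding A_def by (rule UN_I[of t]) (use that in auto)
  \<comment> \<open>Removability forbids the left side to continue upwards or downwards, so the
    whole component of the union of the left sides at \<open>x\<close> is taken. As a component of a
    compact set it is a closed interval.\<close>
  define C where "C = connected_component_set A (yl t1)"
  have "yl t1 \<in> A" using t1 tile_bounds[OF T t1(1)] by (intro AI[OF t1]) auto
  then have C1: "yl t1 \<in> C" by (simp add: C_def)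
  have CA: "C \<subseteq> A" by (simp add: C_def connected_component_subset)
  have conC: "connected C" by (simp add: C_def)
  have join: "B \<subseteq> C" if "connected B" "B \<subseteq> A" "B \<inter> C \<noteq> {}" for B
    using that unfolding C_def by (metis connected_component_maximal connected_component_eq disjoint_iff)
  have "closed C" unfolding C_def
    by (intro closed_connected_component compact_imp_closed \<open>compact A\<close>)
  then have "compact C" using \<open>compact A\<close> CA by (metis compact_Int_closed inf.absorb_iff2)
  then obtain y0 y1 where C: "C = {y0..y1}"
    using conC connected_compact_interval_1[of C] by blast
  have seg: "{yl t..yr t} \<subseteq> C" if "t \<in> T" "xr t = 1" "xl t = x" "{yl t..yr t} \<inter> C \<noteq> {}" for t
    using that by (intro join) (auto simp: A_def)
  have cov: "\<exists>t\<in>T. xr t = 1 \<and> xl t = x \<and> yl t \<le> y \<and> y \<le> yr t" if "y \<in> C" for y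
  proof -
    have "y \<in> A" using that CA by blast
    then obtain t where "t \<in> T" "xr t = 1" "xl t = x" "y \<in> {yl t..yr t}" unfolding A_def by blast
    then show ?thesis by (intro bexI[of _ t]) auto
  qed
  have tC: "y0 \<le> yl t" "yr t \<le> y1" if "t \<in> T" "xr t = 1" "xl t = x" "yl t \<le> y" "y \<le> yr t" "y \<in> C" for t y
    using seg[OF that(1-3)] that(4-6) tile_bounds[OF T that(1)] by (auto simp: C)
  have "yl t1 < yr t1" using tile_bounds[OF T t1(1)] by simp
  then have y01: "y0 < y1" using tC[OF t1 order_refl _ C1] by auto
  obtain ta where ta: "ta \<in> T" "xr ta = 1" "xl ta = x" "yl ta \<le> y0" "y0 \<le> yr ta"
    using cov[of y0] C y01 by auto
  have ta0: "yl ta = y0" using tC(1)[OF ta] ta(4) C y01 by auto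
  obtain tb where tb: "tb \<in> T" "xr tb = 1" "xl tb = x" "yl tb \<le> y1" "y1 \<le> yr tb"
    using cov[of y1] C y01 by auto
  have tb1: "yr tb = y1" using tC(2)[OF tb] tb(5) C y01 by auto
  have "removable T x y0 y1"
    unfolding removable_def
  proof (intro conjI allI impI)
    show "0 < x" "x < 1" "y0 < y1" by fact+
    show "0 \<le> y0" "y1 \<le> 1" using tile_bounds[OF T ta(1)] tile_bounds[OF T tb(1)] ta0 tb1 by auto
    show "(x, y) \<in> skeleton T" if "y0 \<le> y" "y \<le> y1" for y
      using cov[of y] that C tile_sides_skeleton(3)[OF T] by force
    show "(\<xi>, y0) \<in> skeleton T" if "x \<le> \<xi>" "\<xi> \<le> 1" for \<xi>
      using tile_sides_skeleton(1)[OF T ta(1), of \<xi>] ta ta0 that by auto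
    show "(\<xi>, y1) \<in> skeleton T" if "x \<le> \<xi>" "\<xi> \<le> 1" for \<xi>
      using tile_sides_skeleton(2)[OF T tb(1), of \<xi>] tb tb1 that by auto
  next
    fix p a b assume p: "a < b" "x \<le> p" "p < 1" "a \<le> y1" "y0 \<le> b"
      and s: "\<forall>y. a \<le> y \<longrightarrow> y \<le> b \<longrightarrow> (p, y) \<in> skeleton T"
    have ab: "0 \<le> a" "b \<le> 1" using s p unfolding mem_skeleton[OF T] by auto
    \<comment> \<open>A right tile beside the segment would have a part of it in its interior unless
      it starts at or beyond \<open>p\<close>; by the choice of \<open>x\<close> it then starts at
      \<open>x\<close>, and \<open>p = x\<close>.\<close>
    have key: "p = x \<and> xl u = x" if u: "u \<in> T" "xr u = 1" "yl u < b" "a < yr u" for u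
    proof -
      obtain y where y: "max a (yl u) < y" "y < min b (yr u)"
        using dense[of "max a (yl u)" "min b (yr u)"] u p tile_bounds[OF T u(1)] by auto
      then have "\<not> (xl u < p \<and> p < xr u \<and> yl u < y \<and> y < yr u)"
        using s u(1) unfolding mem_skeleton[OF T] by auto
      then have "p \<le> xl u" using y u p by auto
      then show ?thesis using le[OF u(1,2)] p by auto
    qed
    have sub: "{a..b} \<subseteq> A"
    proof
      fix y assume y: "y \<in> {a..b}"
      show "y \<in> A"
      proof (cases "y < b")
        case True
        then have "0 \<le> y" "y < 1" using y ab by auto
        then obtain u where u: "u \<in> T" "xr u = 1" "yl u \<le> y" "y < yr u" using right_tile_above[OF T] by blast
        then show ?thesis using key[OF u(1,2)] y True by (intro AI[OF u(1,2)]) auto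
      next
        case False
        then have "0 < y" "y \<le> 1" using y ab p by auto
        then obtain u where u: "u \<in> T" "xr u = 1" "yl u < y" "y \<le> yr u" using right_tile_below[OF T] by blast
        then show ?thesis using key[OF u(1,2)] y False p by (intro AI[OF u(1,2)]) auto
      qed
    qed
    have "max a y0 \<in> {a..b} \<inter> C" using p y01 C by auto
    then have "{a..b} \<subseteq> C" using join[OF connected_Icc sub] by blast
    then show "y0 \<le> a" "b \<le> y1" using p C by auto
    have "0 \<le> a" "a < 1" using ab p by auto
    then obtain u where u: "u \<in> T" "xr u = 1" "yl u \<le> a" "a < yr u" using right_tile_above[OF T] by blast
    show "p = x" using key[OF u(1,2)] u p by auto
  qed
  then show ?thesis by blast
qed

text \<open>Comparing upper ends orders the blocks, since distinct removable blocks have disjoint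
  height ranges.\<close>

definition lowest :: "tile set \<Rightarrow> real \<Rightarrow> real \<Rightarrow> real \<Rightarrow> bool" where
  "lowest T x y0 y1 \<longleftrightarrow> removable T x y0 y1 \<and> (\<forall>x' z0 z1. removable T x' z0 z1 \<longrightarrow> y1 \<le> z1)"

lemma lowest_removable: "lowest T x y0 y1 \<Longrightarrow> removable T x y0 y1"
  by (simp add: lowest_def)

lemma lowest_unique:
  assumes "lowest T x y0 y1" "lowest T x' z0 z1"
  shows "x = x' \<and> y0 = z0 \<and> y1 = z1"
proof (rule removable_overlap_eq)
  show r: "removable T x y0 y1" "removable T x' z0 z1" using assms by (auto simp: lowest_def)
  have "y1 = z1" using assms r by (meson lowest_def order_antisym)
  then show "y0 \<le> z1" "z0 \<le> y1" using removableD(4)[OF r(1)] removableD(4)[OF r(2)] by auto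
qed

text \<open>Upper ends of removable blocks carry horizontal segments, so they lie in the finite set
  \<open>coords T\<close> and there is a smallest one.\<close>

lemma ex_lowest:
  assumes T: "is_tiling T" and ex: "removable T x y0 y1"
  shows "\<exists>x y0 y1. lowest T x y0 y1"
proof -
  let ?Y = "{y1. \<exists>x y0. removable T x y0 y1}"
  have "?Y \<subseteq> coords T"
  proof
    fix y1 assume "y1 \<in> ?Y"
    then obtain x y0 where r: "removable T x y0 y1" by blast
    show "y1 \<in> coords T" by (rule hseg_coord[OF T removableD(2)[OF r]]) (use removableD(8)[OF r] in auto)
  qed
  then have fin: "finite ?Y" using finite_coords[OF tiling_finite[OF T]] finite_subset by blast
  have "Min ?Y \<in> ?Y" using fin ex by (intro Min_in) auto
  then obtain x y0 where "removable T x y0 (Min ?Y)" by blast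
  moreover have "Min ?Y \<le> z1" if "removable T x' z0 z1" for x' z0 z1
    using fin that by (intro Min_le) auto
  ultimately show ?thesis unfolding lowest_def by blast
qed

definition strips :: "tile set \<Rightarrow> bool" where
  "strips T \<longleftrightarrow> is_tiling T \<and> (\<forall>t\<in>T. xl t = 0 \<and> xr t = 1)"

lemma stripsI:
  assumes T: "is_tiling T" and "\<And>t. t \<in> T \<Longrightarrow> xr t = 1 \<Longrightarrow> xl t \<le> 0"
  shows "strips T"
  unfolding strips_def
proof (intro conjI ballI)
  show "is_tiling T" by fact
  fix t assume t: "t \<in> T"
  note bt = tile_bounds[OF T t]
  have "0 \<le> yl t" "yl t < 1" using bt by auto
  then obtain u where u: "u \<in> T" "xr u = 1" "yl u \<le> yl t" "yl t < yr u" using right_tile_above[OF T] by blast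
  then have "xl u = 0" using assms(2)[OF u(1,2)] tile_bounds[OF T u(1)] by auto
  then have "t = u" using u bt by (intro tile_eqI[OF T t u(1)]) auto
  then show "xl t = 0" "xr t = 1" using u \<open>xl u = 0\<close> by auto
qed

lemma strips_not_removable:
  assumes "strips T"
  shows "\<not> removable T x y0 y1"
proof
  assume r: "removable T x y0 y1"
  note d = removableD[OF r]
  have T: "is_tiling T" using assms by (simp add: strips_def)
  have "0 \<le> y0" "y0 < 1" using d by auto
  then obtain u where u: "u \<in> T" "xr u = 1" "yl u \<le> y0" "y0 < yr u" using right_tile_above[OF T] by blast
  then have xu: "xl u = 0" using assms by (simp add: strips_def)
  obtain y where y: "y0 < y" "y < min y1 (yr u)" using dense[of y0 "min y1 (yr u)"] d u by auto
  then show False using d(6)[of y] u xu d(1,2) unfolding mem_skeleton[OF T] by fastforce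
qed

lemma ex_lowest_or_strips:
  assumes "is_tiling T"
  shows "strips T \<or> (\<exists>x y0 y1. lowest T x y0 y1)"
proof (cases "\<exists>t\<in>T. xr t = 1 \<and> 0 < xl t")
  case True then show ?thesis using ex_removable[OF assms] ex_lowest[OF assms] by blast
next
  case False then show ?thesis using stripsI[OF assms] by force
qed

text \<open>Removability of a block only depends on the skeleton near the block, so gluing elsewhere
  does not affect it.\<close>

lemma removable_local:
  assumes r: "removable T x' z0 z1" and "z1 < y0"
    and eq: "\<And>\<xi> y. y < y0 \<Longrightarrow> (\<xi>, y) \<in> skeleton T \<longleftrightarrow> (\<xi>, y) \<in> skeleton T'"
  shows "removable T' x' z0 z1"
  unfolding removable_def
proof (intro conjI allI impI)
  note d = removableD[OF r]
  show "0 < x'" "x' < 1" "0 \<le> z0" "z0 < z1" "z1 \<le> 1" by (fact d)+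
  show "(x', y) \<in> skeleton T'" if "z0 \<le> y" "y \<le> z1" for y
    using d(6)[OF that] eq[of y x'] that assms(2) by auto
  show "(\<xi>, z0) \<in> skeleton T'" "(\<xi>, z1) \<in> skeleton T'" if "x' \<le> \<xi>" "\<xi> \<le> 1" for \<xi>
    using d(4) d(7)[OF that] d(8)[OF that] eq[of z0 \<xi>] eq[of z1 \<xi>] assms(2) by auto
  fix p a b assume *: "a < b" "x' \<le> p" "p < 1" "a \<le> z1" "z0 \<le> b"
    "\<forall>y. a \<le> y \<longrightarrow> y \<le> b \<longrightarrow> (p, y) \<in> skeleton T'"
  obtain c where c: "z1 < c" "c < y0" using assms(2) dense by blast
  have "a < min b c" "z0 \<le> min b c" using * c d(4) by auto
  moreover have "(p, y) \<in> skeleton T" if "a \<le> y" "y \<le> min b c" for y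
    using *(6) that eq[of y p] c by auto
  ultimately have "p = x'" "z0 \<le> a" "min b c \<le> z1"
    using removable_vseg[OF r, of a "min b c" p] * by blast+
  then show "p = x'" "z0 \<le> a" "b \<le> z1" using c by auto
qed

lemma (in gluing) removable_glue_below:
  assumes "z1 < y0"
  shows "removable (glue x y0 y1 V T) x' z0 z1 \<longleftrightarrow> removable T x' z0 z1"
proof -
  have "(\<xi>, y) \<in> skeleton (glue x y0 y1 V T) \<longleftrightarrow> (\<xi>, y) \<in> skeleton T" if "y < y0" for \<xi> y
    using that by (intro skeleton_glue_outside) auto
  then show ?thesis using removable_local[OF _ assms] by metis
qed

section \<open>Equivalences of tilings\<close>

lemma attains_between:
  fixes \<phi> :: "real \<Rightarrow> real"
  assumes "continuous_on {a..b} \<phi>" "a \<le> b" "min (\<phi> a) (\<phi> b) \<le> v" "v \<le> max (\<phi> a) (\<phi> b)"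
  obtains s where "a \<le> s" "s \<le> b" "\<phi> s = v"
proof (cases "\<phi> a \<le> \<phi> b")
  case True
  then show ?thesis using IVT'[of \<phi> a v b] assms that by auto
next
  case False
  then show ?thesis using IVT2'[of \<phi> b v a] assms that by auto
qed

lemma inj_continuous_strict_mono:
  fixes \<phi> :: "real \<Rightarrow> real"
  assumes "continuous_on {a..b} \<phi>" "inj_on \<phi> {a..b}" "\<phi> a < \<phi> b" "a \<le> s" "s < t" "t \<le> b"
  shows "\<phi> s < \<phi> t"
proof -
  have t: "\<phi> a < \<phi> t \<and> \<phi> t \<le> \<phi> b"
    using continuous_inj_imp_mono[of a t b \<phi>] assms by (cases "t = b") auto
  show ?thesis
  proof (cases "s = a")
    case False
    have "continuous_on {a..t} \<phi>" "inj_on \<phi> {a..t}"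
      using assms by (auto elim: continuous_on_subset inj_on_subset)
    then show ?thesis using continuous_inj_imp_mono[of a s t \<phi>] assms False t by auto
  qed (use t in simp)
qed

text \<open>Only the end points of a segment are compared, but the condition applies to all its
  subsegments as well. That the image is again a whole segment is then a matter of
  continuity.\<close>

definition straight :: "(real \<times> real \<Rightarrow> real \<times> real) \<Rightarrow> (real \<times> real) set \<Rightarrow> bool" where
  "straight f S \<longleftrightarrow>
     (\<forall>a b y. a < b \<longrightarrow> (\<forall>x. a \<le> x \<longrightarrow> x \<le> b \<longrightarrow> (x, y) \<in> S) \<longrightarrow> snd (f (a, y)) = snd (f (b, y))) \<and>
     (\<forall>a b x. a < b \<longrightarrow> (\<forall>y. a \<le> y \<longrightarrow> y \<le> b \<longrightarrow> (x, y) \<in> S) \<longrightarrow> fst (f (x, a)) = fst (f (x, b)))"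

text \<open>A one-sided form of \<open>comb_equiv\<close>: the inverse is continuous by compactness
  of the square, and its straightness is the content of \<open>eqv_inv\<close>.\<close>

definition eqv :: "(real \<times> real \<Rightarrow> real \<times> real) \<Rightarrow> tile set \<Rightarrow> tile set \<Rightarrow> bool" where
  "eqv f T T' \<longleftrightarrow> continuous_on unit_square f \<and> inj_on f unit_square \<and> f ` unit_square = unit_square \<and>
     f (0,0) = (0,0) \<and> f (1,0) = (1,0) \<and> f (0,1) = (0,1) \<and> f (1,1) = (1,1) \<and>
     f ` skeleton T = skeleton T' \<and> straight f (skeleton T)"

lemma eqvD:
  assumes "eqv f T T'"
  shows "continuous_on unit_square f" "inj_on f unit_square" "f ` unit_square = unit_square"
    "f (0,0) = (0,0)" "f (1,0) = (1,0)" "f (0,1) = (0,1)" "f (1,1) = (1,1)"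
    "f ` skeleton T = skeleton T'" "straight f (skeleton T)"
  using assms by (simp_all add: eqv_def)

lemma eqvI:
  assumes "continuous_on unit_square f" "inj_on f unit_square" "f ` unit_square = unit_square"
    "f (0,0) = (0,0)" "f (1,0) = (1,0)" "f (0,1) = (0,1)" "f (1,1) = (1,1)"
    "f ` skeleton T = skeleton T'"
    "\<And>a b y. \<lbrakk>a < b; \<And>x. a \<le> x \<Longrightarrow> x \<le> b \<Longrightarrow> (x, y) \<in> skeleton T\<rbrakk> \<Longrightarrow> snd (f (a, y)) = snd (f (b, y))"
    "\<And>a b x. \<lbrakk>a < b; \<And>y. a \<le> y \<Longrightarrow> y \<le> b \<Longrightarrow> (x, y) \<in> skeleton T\<rbrakk> \<Longrightarrow> fst (f (x, a)) = fst (f (x, b))"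
  shows "eqv f T T'"
proof -
  have "straight f (skeleton T)" unfolding straight_def using assms(9,10) by blast
  then show ?thesis unfolding eqv_def using assms(1-8) by blast
qed

lemma eqv_horizontal:
  assumes "eqv f T T'" "\<And>x. min a b \<le> x \<Longrightarrow> x \<le> max a b \<Longrightarrow> (x, y) \<in> skeleton T"
  shows "snd (f (a, y)) = snd (f (b, y))"
proof -
  have *: "snd (f (a, y)) = snd (f (b, y))"
    if "a < b" "\<And>x. a \<le> x \<Longrightarrow> x \<le> b \<Longrightarrow> (x, y) \<in> skeleton T" for a b
    by (rule eqvD(9)[OF assms(1), unfolded straight_def, THEN conjunct1, rule_format, OF that])
  show ?thesis
  proof (cases a b rule: linorder_cases)
    case less show ?thesis by (rule *[OF less]) (use less in \<open>auto intro: assms(2)\<close>)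
  next
    case greater show ?thesis by (rule *[OF greater, symmetric]) (use greater in \<open>auto intro: assms(2)\<close>)
  qed simp
qed

lemma eqv_vertical:
  assumes "eqv f T T'" "\<And>y. min a b \<le> y \<Longrightarrow> y \<le> max a b \<Longrightarrow> (x, y) \<in> skeleton T"
  shows "fst (f (x, a)) = fst (f (x, b))"
proof -
  have *: "fst (f (x, a)) = fst (f (x, b))"
    if "a < b" "\<And>y. a \<le> y \<Longrightarrow> y \<le> b \<Longrightarrow> (x, y) \<in> skeleton T" for a b
    by (rule eqvD(9)[OF assms(1), unfolded straight_def, THEN conjunct2, rule_format, OF that])
  show ?thesis
  proof (cases a b rule: linorder_cases)
    case less show ?thesis by (rule *[OF less]) (use less in \<open>auto intro: assms(2)\<close>)
  next
    case greater show ?thesis by (rule *[OF greater, symmetric]) (use greater in \<open>auto intro: assms(2)\<close>)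
  qed simp
qed

lemma eqv_id: "eqv id T T"
  by (rule eqvI) auto

lemma eqv_skeleton: "eqv f T T' \<Longrightarrow> p \<in> skeleton T \<Longrightarrow> f p \<in> skeleton T'"
  using eqvD(8) by blast

lemma compact_unit_square: "compact unit_square"
  by (simp add: unit_square_def compact_Times)

lemma closed_unit_square: "closed unit_square"
  by (simp add: compact_imp_closed compact_unit_square)

lemma continuous_on_hline:
  assumes "continuous_on unit_square f" "0 \<le> a" "b \<le> 1" "0 \<le> y" "y \<le> 1"
  shows "continuous_on {a..b} (\<lambda>s. fst (f (s, y)))" "continuous_on {a..b} (\<lambda>s. snd (f (s, y)))"
proof -
  have "continuous_on {a..b} (\<lambda>s. f (s, y))"
    by (rule continuous_on_compose2[OF assms(1)]) (use assms in \<open>auto intro!: continuous_intros simp: mem_unit_square\<close>)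
  then show "continuous_on {a..b} (\<lambda>s. fst (f (s, y)))" "continuous_on {a..b} (\<lambda>s. snd (f (s, y)))"
    by (auto intro!: continuous_intros)
qed

lemma continuous_on_vline:
  assumes "continuous_on unit_square f" "0 \<le> a" "b \<le> 1" "0 \<le> x" "x \<le> 1"
  shows "continuous_on {a..b} (\<lambda>s. fst (f (x, s)))" "continuous_on {a..b} (\<lambda>s. snd (f (x, s)))"
proof -
  have "continuous_on {a..b} (\<lambda>s. f (x, s))"
    by (rule continuous_on_compose2[OF assms(1)]) (use assms in \<open>auto intro!: continuous_intros simp: mem_unit_square\<close>)
  then show "continuous_on {a..b} (\<lambda>s. fst (f (x, s)))" "continuous_on {a..b} (\<lambda>s. snd (f (x, s)))"
    by (auto intro!: continuous_intros)
qed

text \<open>Here \<open>\<phi>\<close> and \<open>\<psi>\<close> are the coordinates of a path in a finite union of horizontal and vertical lines.\<close>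

lemma path_vertical_piece:
  fixes \<phi> \<psi> :: "real \<Rightarrow> real"
  assumes "a \<le> b" and cont: "continuous_on {a..b} \<phi>" "continuous_on {a..b} \<psi>"
    and C: "finite C" "\<And>s. a \<le> s \<Longrightarrow> s \<le> b \<Longrightarrow> \<phi> s \<in> C \<or> \<psi> s \<in> C"
    and ne: "\<psi> a \<noteq> \<psi> b"
  obtains c d where "a \<le> c" "c < d" "d \<le> b" "\<And>s. c \<le> s \<Longrightarrow> s \<le> d \<Longrightarrow> \<phi> s = \<phi> c"
proof -
  have "infinite {min (\<psi> a) (\<psi> b)<..<max (\<psi> a) (\<psi> b)}" using ne by (intro infinite_Ioo) auto
  \<comment> \<open>A value of \<open>\<psi>\<close> off \<open>C\<close>. Near a parameter where it
    is attained \<open>\<psi>\<close> avoids \<open>C\<close>, so \<open>\<phi>\<close> takes values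
    in the finite set \<open>C\<close> and is constant there.\<close>
  then obtain q where q: "min (\<psi> a) (\<psi> b) < q" "q < max (\<psi> a) (\<psi> b)" "q \<notin> C"
    using C(1) by (metis finite_subset greaterThanLessThan_iff subsetI)
  obtain s where s: "a \<le> s" "s \<le> b" "\<psi> s = q" using attains_between[OF cont(2) assms(1), of q] q by auto
  obtain e where e: "e > 0" "\<And>z. z \<in> C \<Longrightarrow> z \<noteq> q \<Longrightarrow> e \<le> \<bar>z - q\<bar>"
    using finite_gap[OF C(1)] by blast
  obtain r where r: "r > 0" "\<And>s'. s' \<in> {a..b} \<Longrightarrow> dist s' s < r \<Longrightarrow> dist (\<psi> s') (\<psi> s) < e"
    using cont(2) e(1) s unfolding continuous_on_iff by (metis atLeastAtMost_iff)
  have "a < b" using assms(1) ne by (cases "a = b") auto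
  define c where "c = max a (s - r / 2)"
  define d where "d = min b (s + r / 2)"
  have cd: "a \<le> c" "c < d" "d \<le> b" using r(1) s \<open>a < b\<close> by (auto simp: c_def d_def)
  have C': "\<phi> s' \<in> C" if "c \<le> s'" "s' \<le> d" for s'
  proof -
    have "dist s' s < r" using that r(1) by (auto simp: c_def d_def dist_real_def abs_if)
    then have "\<bar>\<psi> s' - q\<bar> < e" using r(2)[of s'] that cd s by (auto simp: dist_real_def)
    then have "\<psi> s' \<notin> C" using e(2)[of "\<psi> s'"] q(3) by auto
    then show ?thesis using C(2)[of s'] that cd by auto
  qed
  have "\<phi> s' = \<phi> c" if s': "c \<le> s'" "s' \<le> d" for s'
  proof (rule ccontr)
    assume n: "\<phi> s' \<noteq> \<phi> c"
    have "{min (\<phi> c) (\<phi> s')..max (\<phi> c) (\<phi> s')} \<subseteq> C"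
    proof
      fix v assume v: "v \<in> {min (\<phi> c) (\<phi> s')..max (\<phi> c) (\<phi> s')}"
      have "continuous_on {c..s'} \<phi>" using cont(1) cd s' by (auto elim: continuous_on_subset)
      then obtain z where "c \<le> z" "z \<le> s'" "\<phi> z = v"
        using attains_between[of c s' \<phi> v] s' v by auto
      then show "v \<in> C" using C'[of z] s' by auto
    qed
    then have "finite {min (\<phi> c) (\<phi> s')..max (\<phi> c) (\<phi> s')}" using C(1) finite_subset by blast
    then show False using n infinite_Icc[of "min (\<phi> c) (\<phi> s')" "max (\<phi> c) (\<phi> s')"] by auto
  qed
  then show ?thesis using that cd by blast
qed

text \<open>The inverse is straight as well: if it bent a horizontal segment, then the image would contain a
  vertical piece, which the map itself could not send back into a horizontal line.\<close>

lemma eqv_inv: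
  assumes T: "is_tiling T" and T': "is_tiling T'" and f: "eqv f T T'"
  shows "eqv (inv_into unit_square f) T' T"
proof -
  note D = eqvD[OF f]
  let ?g = "inv_into unit_square f"
  have gf: "?g (f p) = p" if "p \<in> unit_square" for p using that D(2) by simp
  have fg: "f (?g p) = p" "?g p \<in> unit_square" if "p \<in> unit_square" for p
    using that D(3) by (metis f_inv_into_f inv_into_into)+
  have cont: "continuous_on unit_square ?g"
    using continuous_on_inv[OF D(1) compact_unit_square, of ?g] gf D(3) by simp
  have sk: "?g ` skeleton T' = skeleton T"
    unfolding D(8)[symmetric] using D(2) skeleton_subset[OF T] by (simp add: inv_into_image_cancel)
  have skT': "p \<in> unit_square" if "p \<in> skeleton T'" for p using that skeleton_subset[OF T'] by blast
  have crd: "fst (?g p) \<in> coords T \<or> snd (?g p) \<in> coords T" if "p \<in> skeleton T'" for p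
  proof -
    have "?g p \<in> skeleton T" using sk that by blast
    then show ?thesis using skeleton_coords[OF T, of "fst (?g p)" "snd (?g p)"] by auto
  qed
  have fin: "finite (coords T)" using tiling_finite[OF T] finite_coords by blast
  have h: "snd (?g (a, y)) = snd (?g (b, y))"
    if ab: "a < b" and s: "\<And>x. a \<le> x \<Longrightarrow> x \<le> b \<Longrightarrow> (x, y) \<in> skeleton T'" for a b y
  proof (rule ccontr)
    assume ne: "snd (?g (a, y)) \<noteq> snd (?g (b, y))"
    have b: "0 \<le> a" "b \<le> 1" "0 \<le> y" "y \<le> 1"
      using s[of a] s[of b] ab unfolding mem_skeleton[OF T'] by auto
    let ?\<phi> = "\<lambda>s. fst (?g (s, y))" and ?\<psi> = "\<lambda>s. snd (?g (s, y))"
    note c = continuous_on_hline[OF cont b]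
    obtain c d where cd: "a \<le> c" "c < d" "d \<le> b" "\<And>s. c \<le> s \<Longrightarrow> s \<le> d \<Longrightarrow> ?\<phi> s = ?\<phi> c"
      using path_vertical_piece[OF less_imp_le[OF ab] c fin crd[OF s] ne] by blast
    have v: "(?\<phi> c, v) \<in> skeleton T" if v: "min (?\<psi> c) (?\<psi> d) \<le> v" "v \<le> max (?\<psi> c) (?\<psi> d)" for v
    proof -
      have "continuous_on {c..d} ?\<psi>" using c(2) cd by (auto elim: continuous_on_subset)
      then obtain s' where s': "c \<le> s'" "s' \<le> d" "?\<psi> s' = v" using attains_between[of c d ?\<psi> v] cd v by auto
      then have "?g (s', y) = (?\<phi> c, v)" using cd(4)[of s'] by (metis prod.collapse)
      moreover have "?g (s', y) \<in> skeleton T" using sk s[of s'] s' cd by auto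
      ultimately show ?thesis by simp
    qed
    \<comment> \<open>Straightness of \<open>f\<close> gives the ends of this vertical piece equal
      abscissae, whereas \<open>f\<close> sends them to (c, y) and (d, y).\<close>
    have "fst (f (?\<phi> c, ?\<psi> c)) = fst (f (?\<phi> c, ?\<psi> d))" by (rule eqv_vertical[OF f v])
    then have "fst (f (?g (c, y))) = fst (f (?g (d, y)))" using cd(4)[of d] cd(2) by (metis less_imp_le order_refl prod.collapse)
    then show False using fg(1)[of "(c, y)"] fg(1)[of "(d, y)"] cd b by (simp add: mem_unit_square)
  qed
  have v: "fst (?g (x, a)) = fst (?g (x, b))"
    if ab: "a < b" and s: "\<And>y. a \<le> y \<Longrightarrow> y \<le> b \<Longrightarrow> (x, y) \<in> skeleton T'" for a b x
  proof (rule ccontr)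
    assume ne: "fst (?g (x, a)) \<noteq> fst (?g (x, b))"
    have b: "0 \<le> a" "b \<le> 1" "0 \<le> x" "x \<le> 1"
      using s[of a] s[of b] ab unfolding mem_skeleton[OF T'] by auto
    let ?\<phi> = "\<lambda>s. snd (?g (x, s))" and ?\<psi> = "\<lambda>s. fst (?g (x, s))"
    note c = continuous_on_vline[OF cont b]
    have crd': "?\<phi> s \<in> coords T \<or> ?\<psi> s \<in> coords T" if "a \<le> s" "s \<le> b" for s
      using crd[OF s[OF that]] by blast
    obtain c d where cd: "a \<le> c" "c < d" "d \<le> b" "\<And>s. c \<le> s \<Longrightarrow> s \<le> d \<Longrightarrow> ?\<phi> s = ?\<phi> c"
      using path_vertical_piece[OF less_imp_le[OF ab] c(2,1) fin crd' ne] by blast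
    have v: "(v, ?\<phi> c) \<in> skeleton T" if v: "min (?\<psi> c) (?\<psi> d) \<le> v" "v \<le> max (?\<psi> c) (?\<psi> d)" for v
    proof -
      have "continuous_on {c..d} ?\<psi>" using c(1) cd by (auto elim: continuous_on_subset)
      then obtain s' where s': "c \<le> s'" "s' \<le> d" "?\<psi> s' = v" using attains_between[of c d ?\<psi> v] cd v by auto
      then have "?g (x, s') = (v, ?\<phi> c)" using cd(4)[of s'] by (metis prod.collapse)
      moreover have "?g (x, s') \<in> skeleton T" using sk s[of s'] s' cd by auto
      ultimately show ?thesis by simp
    qed
    have "snd (f (?\<psi> c, ?\<phi> c)) = snd (f (?\<psi> d, ?\<phi> c))" by (rule eqv_horizontal[OF f v])
    then have "snd (f (?g (x, c))) = snd (f (?g (x, d)))" using cd(4)[of d] cd(2) by (metis less_imp_le order_refl prod.collapse)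
    then show False using fg(1)[of "(x, c)"] fg(1)[of "(x, d)"] cd b by (simp add: mem_unit_square)
  qed
  have img: "?g ` unit_square = unit_square" using D(2,3) by (metis inv_into_image_cancel order_refl)
  have inj: "inj_on ?g unit_square" using D(3) inj_on_inv_into[of unit_square f unit_square] by simp
  have cor: "(0,0) \<in> unit_square" "(1,0) \<in> unit_square" "(0,1) \<in> unit_square" "(1,1) \<in> unit_square"
    by (auto simp: mem_unit_square)
  have gc: "?g (0,0) = (0,0)" "?g (1,0) = (1,0)" "?g (0,1) = (0,1)" "?g (1,1) = (1,1)"
    using gf[OF cor(1)] gf[OF cor(2)] gf[OF cor(3)] gf[OF cor(4)] D(4-7) by simp_all
  show ?thesis by (rule eqvI[OF cont inj img gc sk]) (fact h, fact v)
qed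

lemma eqv_image_hline:
  assumes T: "is_tiling T" and f: "eqv f T T'" and ab: "a \<le> b"
    and s: "\<And>x. a \<le> x \<Longrightarrow> x \<le> b \<Longrightarrow> (x, y) \<in> skeleton T"
    and v: "min (fst (f (a, y))) (fst (f (b, y))) \<le> v" "v \<le> max (fst (f (a, y))) (fst (f (b, y)))"
  obtains s where "a \<le> s" "s \<le> b" "f (s, y) = (v, snd (f (a, y)))"
proof -
  have b: "0 \<le> a" "b \<le> 1" "0 \<le> y" "y \<le> 1"
    using s[of a] s[of b] ab unfolding mem_skeleton[OF T] by auto
  obtain z where z: "a \<le> z" "z \<le> b" "fst (f (z, y)) = v"
    using attains_between[OF continuous_on_hline(1)[OF eqvD(1)[OF f] b] ab v] by blast
  have "snd (f (a, y)) = snd (f (z, y))" by (rule eqv_horizontal[OF f]) (use s z in auto)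
  then show ?thesis using that[of z] z by (metis prod.collapse)
qed

lemma eqv_image_vline:
  assumes T: "is_tiling T" and f: "eqv f T T'" and ab: "a \<le> b"
    and s: "\<And>y. a \<le> y \<Longrightarrow> y \<le> b \<Longrightarrow> (x, y) \<in> skeleton T"
    and v: "min (snd (f (x, a))) (snd (f (x, b))) \<le> v" "v \<le> max (snd (f (x, a))) (snd (f (x, b)))"
  obtains s where "a \<le> s" "s \<le> b" "f (x, s) = (fst (f (x, a)), v)"
proof -
  have b: "0 \<le> a" "b \<le> 1" "0 \<le> x" "x \<le> 1"
    using s[of a] s[of b] ab unfolding mem_skeleton[OF T] by auto
  obtain z where z: "a \<le> z" "z \<le> b" "snd (f (x, z)) = v"
    using attains_between[OF continuous_on_vline(2)[OF eqvD(1)[OF f] b] ab v] by blast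
  have "fst (f (x, a)) = fst (f (x, z))" by (rule eqv_vertical[OF f]) (use s z in auto)
  then show ?thesis using that[of z] z by (metis prod.collapse)
qed

text \<open>Straightness of \<open>g\<close> can be applied only if the skeleton contains the whole
  segment between the images of the two ends under \<open>f\<close>; the intermediate value theorem
  provides it.\<close>

lemma eqv_trans:
  assumes T: "is_tiling T" and f: "eqv f T T'" and g: "eqv g T' T''"
  shows "eqv (g \<circ> f) T T''"
proof -
  note F = eqvD[OF f] and G = eqvD[OF g]
  have sk: "f p \<in> skeleton T'" if "p \<in> skeleton T" for p using F(8) that by blast
  have "snd (g (f (a, y))) = snd (g (f (b, y)))"
    if ab: "a < b" and s: "\<And>x. a \<le> x \<Longrightarrow> x \<le> b \<Longrightarrow> (x, y) \<in> skeleton T" for a b y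
  proof -
    have eq: "snd (f (b, y)) = snd (f (a, y))"
      by (rule eqv_horizontal[OF f, symmetric]) (use s ab in auto)
    have "(v, snd (f (a, y))) \<in> skeleton T'"
      if "min (fst (f (a, y))) (fst (f (b, y))) \<le> v" "v \<le> max (fst (f (a, y))) (fst (f (b, y)))" for v
      using eqv_image_hline[OF T f less_imp_le[OF ab] s that] sk s by metis
    then have "snd (g (fst (f (a, y)), snd (f (a, y)))) = snd (g (fst (f (b, y)), snd (f (a, y))))"
      by (rule eqv_horizontal[OF g])
    then show ?thesis using eq by (metis prod.collapse)
  qed
  moreover have "fst (g (f (x, a))) = fst (g (f (x, b)))"
    if ab: "a < b" and s: "\<And>y. a \<le> y \<Longrightarrow> y \<le> b \<Longrightarrow> (x, y) \<in> skeleton T" for a b x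
  proof -
    have eq: "fst (f (x, b)) = fst (f (x, a))"
      by (rule eqv_vertical[OF f, symmetric]) (use s ab in auto)
    have "(fst (f (x, a)), v) \<in> skeleton T'"
      if "min (snd (f (x, a))) (snd (f (x, b))) \<le> v" "v \<le> max (snd (f (x, a))) (snd (f (x, b)))" for v
      using eqv_image_vline[OF T f less_imp_le[OF ab] s that] sk s by metis
    then have "fst (g (fst (f (x, a)), snd (f (x, a)))) = fst (g (fst (f (x, a)), snd (f (x, b))))"
      by (rule eqv_vertical[OF g])
    then show ?thesis using eq by (metis prod.collapse)
  qed
  moreover have "continuous_on unit_square (g \<circ> f)"
    using continuous_on_compose[OF F(1)] F(3) G(1) by simp
  moreover have "inj_on (g \<circ> f) unit_square" using comp_inj_on[OF F(2)] F(3) G(2) by simp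
  moreover have "(g \<circ> f) ` unit_square = unit_square" "(g \<circ> f) ` skeleton T = skeleton T''"
    by (simp_all only: image_comp[symmetric] F(3,8) G(3,8))
  ultimately show ?thesis
    by (intro eqvI) (use F(4-7) G(4-7) in simp_all)
qed

lemma hseg_image:
  assumes T: "is_tiling T" and f: "eqv f T T'" and S: "S \<subseteq> skeleton T" "hseg S"
  shows "hseg (f ` S)"
proof -
  obtain a b y where ab: "a < b" and Seq: "S = {a..b} \<times> {y}" using S by (auto simp: hseg_def)
  have s: "(x, y) \<in> skeleton T" if "a \<le> x" "x \<le> b" for x using S(1) Seq that by auto
  have b: "0 \<le> a" "b \<le> 1" "0 \<le> y" "y \<le> 1"
    using s[of a] s[of b] ab unfolding mem_skeleton[OF T] by auto
  let ?\<phi> = "\<lambda>s. fst (f (s, y))"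
  have snd: "snd (f (x, y)) = snd (f (a, y))" if "a \<le> x" "x \<le> b" for x
    by (rule eqv_horizontal[OF f, symmetric]) (use s that in auto)
  obtain u v where uv: "?\<phi> ` {a..b} = {u..v}" "u \<le> v"
    using continuous_image_closed_interval[OF less_imp_le[OF ab] continuous_on_hline(1)[OF eqvD(1)[OF f] b]] by blast
  have "?\<phi> a \<noteq> ?\<phi> b"
  proof
    assume "?\<phi> a = ?\<phi> b"
    then have "f (a, y) = f (b, y)" using snd[of b] ab by (simp add: prod_eq_iff)
    then have "(a, y) = (b, y)" by (rule inj_onD[OF eqvD(2)[OF f]]) (use b ab in \<open>simp_all add: mem_unit_square\<close>)
    then show False using ab by simp
  qed
  moreover have "?\<phi> a \<in> {u..v}" "?\<phi> b \<in> {u..v}" using uv(1) ab by auto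
  ultimately have "u < v" by auto
  have "f ` S = (\<lambda>s. (?\<phi> s, snd (f (a, y)))) ` {a..b}"
  proof -
    have "S = (\<lambda>s. (s, y)) ` {a..b}" by (auto simp: Seq)
    then have "f ` S = (\<lambda>s. f (s, y)) ` {a..b}" by (simp add: image_image)
    also have "\<dots> = (\<lambda>s. (?\<phi> s, snd (f (a, y)))) ` {a..b}"
    proof (rule image_cong[OF refl])
      fix s assume "s \<in> {a..b}"
      then show "f (s, y) = (?\<phi> s, snd (f (a, y)))" using snd[of s] by (metis atLeastAtMost_iff prod.collapse)
    qed
    finally show ?thesis .
  qed
  also have "\<dots> = {u..v} \<times> {snd (f (a, y))}" unfolding uv(1)[symmetric] by auto
  finally have "f ` S = {u..v} \<times> {snd (f (a, y))}" .
  then show ?thesis unfolding hseg_def using \<open>u < v\<close> by (intro exI conjI)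
qed

lemma vseg_image:
  assumes T: "is_tiling T" and f: "eqv f T T'" and S: "S \<subseteq> skeleton T" "vseg S"
  shows "vseg (f ` S)"
proof -
  obtain a b x where ab: "a < b" and Seq: "S = {x} \<times> {a..b}" using S by (auto simp: vseg_def)
  have s: "(x, y) \<in> skeleton T" if "a \<le> y" "y \<le> b" for y using S(1) Seq that by auto
  have b: "0 \<le> a" "b \<le> 1" "0 \<le> x" "x \<le> 1"
    using s[of a] s[of b] ab unfolding mem_skeleton[OF T] by auto
  let ?\<phi> = "\<lambda>s. snd (f (x, s))"
  have fst: "fst (f (x, y)) = fst (f (x, a))" if "a \<le> y" "y \<le> b" for y
    by (rule eqv_vertical[OF f, symmetric]) (use s that in auto)
  obtain u v where uv: "?\<phi> ` {a..b} = {u..v}" "u \<le> v"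
    using continuous_image_closed_interval[OF less_imp_le[OF ab] continuous_on_vline(2)[OF eqvD(1)[OF f] b]] by blast
  have "?\<phi> a \<noteq> ?\<phi> b"
  proof
    assume "?\<phi> a = ?\<phi> b"
    then have "f (x, a) = f (x, b)" using fst[of b] ab by (simp add: prod_eq_iff)
    then have "(x, a) = (x, b)" by (rule inj_onD[OF eqvD(2)[OF f]]) (use b ab in \<open>simp_all add: mem_unit_square\<close>)
    then show False using ab by simp
  qed
  moreover have "?\<phi> a \<in> {u..v}" "?\<phi> b \<in> {u..v}" using uv(1) ab by auto
  ultimately have "u < v" by auto
  have "f ` S = (\<lambda>s. (fst (f (x, a)), ?\<phi> s)) ` {a..b}"
  proof -
    have "S = (\<lambda>s. (x, s)) ` {a..b}" by (auto simp: Seq)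
    then have "f ` S = (\<lambda>s. f (x, s)) ` {a..b}" by (simp add: image_image)
    also have "\<dots> = (\<lambda>s. (fst (f (x, a)), ?\<phi> s)) ` {a..b}"
    proof (rule image_cong[OF refl])
      fix s assume "s \<in> {a..b}"
      then show "f (x, s) = (fst (f (x, a)), ?\<phi> s)" using fst[of s] by (metis atLeastAtMost_iff prod.collapse)
    qed
    finally show ?thesis .
  qed
  also have "\<dots> = {fst (f (x, a))} \<times> {u..v}" unfolding uv(1)[symmetric] by auto
  finally have "f ` S = {fst (f (x, a))} \<times> {u..v}" .
  then show ?thesis unfolding vseg_def using \<open>u < v\<close> by (intro exI conjI)
qed

text \<open>A segment in the image of a segment forces its ends onto one line, which is
  straightness. Conversely straightness and continuity make images of segments segments, for the
  inverse by \<open>eqv_inv\<close>.\<close>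

lemma comb_equiv_iff:
  assumes T: "is_tiling T" and T': "is_tiling T'"
  shows "comb_equiv T T' \<longleftrightarrow> (\<exists>f. eqv f T T')"
proof
  assume "comb_equiv T T'"
  then obtain f g where *: "homeomorphism unit_square unit_square f g \<and>
     f (0,0) = (0,0) \<and> f (1,0) = (1,0) \<and> f (0,1) = (0,1) \<and> f (1,1) = (1,1) \<and>
     f ` skeleton T = skeleton T' \<and>
     (\<forall>S \<subseteq> skeleton T. (hseg S \<longrightarrow> hseg (f ` S)) \<and> (vseg S \<longrightarrow> vseg (f ` S)))"
    unfolding comb_equiv_def by (elim exE conjE) (rule that, intro conjI)
  then have fg: "homeomorphism unit_square unit_square f g"
    and c: "f (0,0) = (0,0)" "f (1,0) = (1,0)" "f (0,1) = (0,1)" "f (1,1) = (1,1)" "f ` skeleton T = skeleton T'"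
    and h: "\<And>S. S \<subseteq> skeleton T \<Longrightarrow> hseg S \<Longrightarrow> hseg (f ` S)"
    and v: "\<And>S. S \<subseteq> skeleton T \<Longrightarrow> vseg S \<Longrightarrow> vseg (f ` S)"
    by simp_all
  have "snd (f (a, y)) = snd (f (b, y))" if "a < b" "\<And>x. a \<le> x \<Longrightarrow> x \<le> b \<Longrightarrow> (x, y) \<in> skeleton T" for a b y
  proof -
    have "hseg ({a..b} \<times> {y})" unfolding hseg_def using that(1) by (intro exI conjI) auto
    then have "hseg (f ` ({a..b} \<times> {y}))" by (rule h[rotated]) (use that(2) in auto)
    then obtain c d z where eq: "f ` ({a..b} \<times> {y}) = {c..d} \<times> {z}" by (auto simp: hseg_def)
    have "f (a, y) \<in> {c..d} \<times> {z}" "f (b, y) \<in> {c..d} \<times> {z}" unfolding eq[symmetric] using that(1) by auto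
    then show ?thesis by auto
  qed
  moreover have "fst (f (x, a)) = fst (f (x, b))" if "a < b" "\<And>y. a \<le> y \<Longrightarrow> y \<le> b \<Longrightarrow> (x, y) \<in> skeleton T" for a b x
  proof -
    have "vseg ({x} \<times> {a..b})" unfolding vseg_def using that(1) by (intro exI conjI) auto
    then have "vseg (f ` ({x} \<times> {a..b}))" by (rule v[rotated]) (use that(2) in auto)
    then obtain c d z where eq: "f ` ({x} \<times> {a..b}) = {z} \<times> {c..d}" by (auto simp: vseg_def)
    have "f (x, a) \<in> {z} \<times> {c..d}" "f (x, b) \<in> {z} \<times> {c..d}" unfolding eq[symmetric] using that(1) by auto
    then show ?thesis by auto
  qed
  moreover have "inj_on f unit_square" using fg by (metis homeomorphism_def inj_on_inverseI)
  ultimately have "eqv f T T'"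
    by (intro eqvI) (use fg c in \<open>simp_all add: homeomorphism_def\<close>)
  then show "\<exists>f. eqv f T T'" by blast
next
  assume "\<exists>f. eqv f T T'"
  then obtain f where f: "eqv f T T'" by blast
  let ?g = "inv_into unit_square f"
  have g: "eqv ?g T' T" by (rule eqv_inv[OF T T' f])
  have "homeomorphism unit_square unit_square f ?g"
    unfolding homeomorphism_def using eqvD(1-3)[OF f] eqvD(1,3)[OF g]
    by (auto simp: f_inv_into_f)
  then show "comb_equiv T T'"
    unfolding comb_equiv_def using eqvD(4-8)[OF f] hseg_image[OF T f] vseg_image[OF T f]
      hseg_image[OF T' g] vseg_image[OF T' g] by (intro exI[of _ f] exI[of _ ?g]) simp
qed

section \<open>Transporting blocks along an equivalence\<close>

abbreviation block :: "real \<Rightarrow> real \<Rightarrow> real \<Rightarrow> (real \<times> real) set" where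
  "block x y0 y1 \<equiv> {x..1} \<times> {y0..y1}"

definition block_boundary :: "real \<Rightarrow> real \<Rightarrow> real \<Rightarrow> (real \<times> real) set" where
  "block_boundary x y0 y1 = block x y0 y1 - {x<..<1} \<times> {y0<..<y1}"

text \<open>The complement is a left strip of positive width together with a lower and an upper
  strip, which meet it in the corners (0, 0) and (0, 1) whenever they are nonempty.\<close>

lemma connected_block_complement:
  assumes "0 < x" "x \<le> 1" "0 \<le> y0" "y1 \<le> 1" "y0 \<le> y1"
  shows "connected (unit_square - block x y0 y1)"
proof -
  let ?A = "{0..<x} \<times> {0..1::real}" and ?B = "{0..1::real} \<times> {0..<y0}" and ?C = "{0..1::real} \<times> {y1<..1}"
  have A: "connected ?A" and B: "connected ?B" and C: "connected ?C" by (intro connected_Times; simp)+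
  have "connected (?A \<union> ?B)"
  proof (cases "0 < y0")
    case True
    then have "(0, 0) \<in> ?A \<inter> ?B" using assms by auto
    then have "?A \<inter> ?B \<noteq> {}" by blast
    with A B show ?thesis by (rule connected_Un)
  qed (use A in auto)
  then have "connected (?A \<union> ?B \<union> ?C)"
  proof (cases "y1 < 1")
    case True
    then have "(0, 1) \<in> (?A \<union> ?B) \<inter> ?C" using assms by auto
    then have "(?A \<union> ?B) \<inter> ?C \<noteq> {}" by blast
    with \<open>connected (?A \<union> ?B)\<close> C show ?thesis by (rule connected_Un)
  qed auto
  moreover have "unit_square - block x y0 y1 = ?A \<union> ?B \<union> ?C"
    using assms by (auto simp: unit_square_def)
  ultimately show ?thesis by simp
qed

text \<open>The complement of the block is the component of the complement of its boundary that
  contains the corner at the origin.\<close>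

lemma block_complement_image:
  assumes cont: "continuous_on unit_square h" and inj: "inj_on h unit_square"
    and img: "h ` unit_square = unit_square" and "h (0, 0) = (0, 0)"
    and bd: "h ` block_boundary x y0 y1 = block_boundary x' y0' y1'"
    and x: "0 < x" "x \<le> 1" "0 \<le> y0" "y1 \<le> 1" "y0 \<le> y1" "0 < x'"
    and p: "p \<in> unit_square" "p \<notin> block x y0 y1"
  shows "h p \<notin> block x' y0' y1'"
proof
  define I where "I = {x'<..<1} \<times> {y0'<..<y1'}"
  define B where "B = block x' y0' y1'"
  define D where "D = unit_square - block x y0 y1"
  assume "h p \<in> block x' y0' y1'"
  then have hp: "h p \<in> B" by (simp only: B_def)
  have sub: "block_boundary x y0 y1 \<subseteq> unit_square"
    using x by (auto simp: block_boundary_def unit_square_def)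
  have nb: "h q \<notin> B - I" if "q \<in> D" for q
  proof
    assume "h q \<in> B - I"
    then have "h q \<in> h ` block_boundary x y0 y1" unfolding bd by (simp only: block_boundary_def B_def I_def)
    then obtain r where "r \<in> block_boundary x y0 y1" "h r = h q" by (metis imageE)
    then have "r = q" using that sub inj by (metis D_def DiffD1 inj_onD subsetD)
    then show False using that \<open>r \<in> block_boundary x y0 y1\<close> by (simp add: block_boundary_def D_def)
  qed
  have "connected (h ` D)" unfolding D_def
    by (intro connected_continuous_image connected_block_complement x(1-5) continuous_on_subset[OF cont]) auto
  moreover have "open I" unfolding I_def by (intro open_Times) auto
  moreover have "open (- B)" unfolding B_def by (intro open_Compl closed_Times) auto
  moreover have "I \<subseteq> B" by (auto simp: I_def B_def)
  then have "I \<inter> - B \<inter> h ` D = {}" by blast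
  moreover have "h ` D \<subseteq> I \<union> - B" using nb by blast
  ultimately have "I \<inter> h ` D = {} \<or> - B \<inter> h ` D = {}" by (rule connectedD)
  moreover have "(0, 0) \<in> D" using x by (auto simp: mem_unit_square D_def)
  then have "(0, 0) \<in> h ` D" using assms(4) by (metis imageI)
  then have "(0, 0) \<in> - B \<inter> h ` D" using x by (auto simp: B_def)
  moreover have "p \<in> D" using p by (simp add: D_def)
  then have "h p \<in> I \<inter> h ` D" using nb[of p] hp by blast
  ultimately show False by blast
qed

locale tequiv =
  fixes f T T'
  assumes T: "is_tiling T" and T': "is_tiling T'" and f: "eqv f T T'"
begin

text \<open>The map that \<open>f\<close> induces on the right side. It is increasing since the
  corners are fixed.\<close>

definition "\<gamma> y = snd (f (1, y))"
abbreviation "g \<equiv> inv_into unit_square f"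

lemmas F = eqvD[OF f]

lemma g_f: "p \<in> unit_square \<Longrightarrow> g (f p) = p" using F(2) by simp
lemma f_g: "p \<in> unit_square \<Longrightarrow> f (g p) = p" using F(3) by (metis f_inv_into_f)
lemma f_mem: "p \<in> unit_square \<Longrightarrow> f p \<in> unit_square" using F(3) by blast
lemma g_mem: "p \<in> unit_square \<Longrightarrow> g p \<in> unit_square" using F(3) by (metis inv_into_into)

lemma f_inj: "p \<in> unit_square \<Longrightarrow> q \<in> unit_square \<Longrightarrow> f p = f q \<Longrightarrow> p = q"
  using F(2) by (meson inj_onD)

lemma f_right: "0 \<le> y \<Longrightarrow> y \<le> 1 \<Longrightarrow> f (1, y) = (1, \<gamma> y)"
  using eqv_vertical[OF f, of 0 y 1] skeleton_frame[OF T] F(5) by (simp add: \<gamma>_def prod_eq_iff)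

lemma f_left: "0 \<le> y \<Longrightarrow> y \<le> 1 \<Longrightarrow> fst (f (0, y)) = 0"
  using eqv_vertical[OF f, of 0 y 0] skeleton_frame[OF T] F(4) by simp

lemma \<gamma>_ends: "\<gamma> 0 = 0" "\<gamma> 1 = 1" using F(5,7) by (simp_all add: \<gamma>_def)

lemma \<gamma>_strict_mono: "0 \<le> a \<Longrightarrow> a < b \<Longrightarrow> b \<le> 1 \<Longrightarrow> \<gamma> a < \<gamma> b"
proof (rule inj_continuous_strict_mono[of 0 1 \<gamma>])
  show "continuous_on {0..1} \<gamma>" unfolding \<gamma>_def by (rule continuous_on_vline[OF F(1)]) auto
  show "inj_on \<gamma> {0..1}"
  proof (rule inj_onI)
    fix s t assume st: "s \<in> {0..1}" "t \<in> {0..1}" "\<gamma> s = \<gamma> t"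
    then have "f (1, s) = f (1, t)" using f_right[of s] f_right[of t] by auto
    then have "(1::real, s) = (1, t)" by (rule f_inj[rotated 2]) (use st in \<open>auto simp: mem_unit_square\<close>)
    then show "s = t" by simp
  qed
qed (use \<gamma>_ends in auto)

lemma \<gamma>_mono: "0 \<le> a \<Longrightarrow> a \<le> b \<Longrightarrow> b \<le> 1 \<Longrightarrow> \<gamma> a \<le> \<gamma> b"
  using \<gamma>_strict_mono[of a b] by (cases "a = b") auto

lemma \<gamma>_less_iff: "0 \<le> a \<Longrightarrow> a \<le> 1 \<Longrightarrow> 0 \<le> b \<Longrightarrow> b \<le> 1 \<Longrightarrow> \<gamma> a < \<gamma> b \<longleftrightarrow> a < b"
  using \<gamma>_strict_mono[of a b] \<gamma>_mono[of b a] by linarith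

lemma \<gamma>_bounds: "0 \<le> y \<Longrightarrow> y \<le> 1 \<Longrightarrow> 0 \<le> \<gamma> y \<and> \<gamma> y \<le> 1"
  using \<gamma>_mono[of 0 y] \<gamma>_mono[of y 1] \<gamma>_ends by auto

lemma right_hits_forward:
  assumes y: "y \<in> right_hits T"
  shows "\<gamma> y \<in> right_hits T'"
proof -
  obtain a where a: "0 < y" "y < 1" "a < 1" "\<And>x. a \<le> x \<Longrightarrow> x \<le> 1 \<Longrightarrow> (x, y) \<in> skeleton T"
    using y unfolding right_hits_skeleton[OF T] by blast
  have b: "0 \<le> a" using a(4)[of a] a(3) unfolding mem_skeleton[OF T] by auto
  have "\<gamma> 0 < \<gamma> y" "\<gamma> y < \<gamma> 1" using a by (auto intro: \<gamma>_strict_mono)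
  moreover have lev: "snd (f (a, y)) = \<gamma> y" unfolding \<gamma>_def by (rule eqv_horizontal[OF f]) (use a in auto)
  have "f (a, y) \<in> unit_square" by (rule f_mem) (use a b in \<open>auto simp: mem_unit_square\<close>)
  then have le: "fst (f (a, y)) \<le> 1" by (auto simp: unit_square_def)
  moreover have "fst (f (a, y)) \<noteq> 1"
  proof
    assume "fst (f (a, y)) = 1"
    then have "f (a, y) = f (1, y)" using lev f_right[of y] a by (simp add: prod_eq_iff)
    then have "(a, y) = (1, y)" by (rule f_inj[rotated 2]) (use a b in \<open>auto simp: mem_unit_square\<close>)
    then show False using a by simp
  qed
  moreover have "(v, \<gamma> y) \<in> skeleton T'" if "fst (f (a, y)) \<le> v" "v \<le> 1" for v
  proof -
    have "min (fst (f (a, y))) (fst (f (1, y))) \<le> v" "v \<le> max (fst (f (a, y))) (fst (f (1, y)))"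
      using that f_right[of y] a by auto
    then obtain s where "a \<le> s" "s \<le> 1" "f (s, y) = (v, snd (f (a, y)))"
      using eqv_image_hline[OF T f less_imp_le[OF a(3)] a(4)] by blast
    then show ?thesis using lev a(4)[of s] eqv_skeleton[OF f] by metis
  qed
  ultimately show ?thesis using \<gamma>_ends unfolding right_hits_skeleton[OF T']
    by (intro conjI exI[of _ "fst (f (a, y))"]) auto
qed

end

text \<open>The inverse is a second instance of the same locale, so that every forward statement
  about \<open>f\<close> can be read backwards.\<close>

locale tequiv_inv = tequiv + inv: tequiv "inv_into unit_square f" T' T
begin

lemma inv_\<gamma>: "0 \<le> y \<Longrightarrow> y \<le> 1 \<Longrightarrow> inv.\<gamma> (\<gamma> y) = y"
  using g_f[of "(1, y)"] f_right[of y] by (simp add: inv.\<gamma>_def mem_unit_square)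

lemma \<gamma>_inv: "0 \<le> y \<Longrightarrow> y \<le> 1 \<Longrightarrow> \<gamma> (inv.\<gamma> y) = y"
  using f_g[of "(1, y)"] inv.f_right[of y] by (simp add: \<gamma>_def mem_unit_square)

lemma right_hits_image: "\<gamma> ` right_hits T = right_hits T'"
proof
  show "\<gamma> ` right_hits T \<subseteq> right_hits T'" using right_hits_forward by blast
  show "right_hits T' \<subseteq> \<gamma> ` right_hits T"
  proof
    fix y assume y: "y \<in> right_hits T'"
    then have "y = \<gamma> (inv.\<gamma> y)" using right_hits_bounds[OF y] by (intro \<gamma>_inv[symmetric]) auto
    then show "y \<in> \<gamma> ` right_hits T" using inv.right_hits_forward[OF y] by blast
  qed
qed

lemma levels_image: "\<gamma> ` levels T = levels T'"
  by (simp add: levels_def right_hits_image \<gamma>_ends)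

lemma \<gamma>_inj_on: "inj_on \<gamma> {0..1}"
  by (rule inj_onI) (metis atLeastAtMost_iff inv_\<gamma>)

end

lemma tequiv_invI:
  assumes "is_tiling T" "is_tiling T'" "eqv f T T'"
  shows "tequiv_inv f T T'"
  by (intro tequiv_inv.intro tequiv.intro assms eqv_inv)

locale tequiv_block = tequiv_inv +
  fixes x y0 y1
  assumes rem: "removable T x y0 y1"
begin

lemmas b = removableD(1-5)[OF rem]
lemmas b_sk = removableD(6-8)[OF rem]

text \<open>The three sides of the block other than the right one lie in the skeleton, so their
  images are straight: \<open>v\<close>, \<open>u0\<close> and \<open>u1\<close> parametrize the
  images of the left, lower and upper side, and \<open>x'\<close> is the abscissa of the new left
  side.\<close>

definition "x' = fst (f (x, y0))"
definition "v y = snd (f (x, y))"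
definition "u0 \<xi> = fst (f (\<xi>, y0))"
definition "u1 \<xi> = fst (f (\<xi>, y1))"

lemma f_left_side: "y0 \<le> y \<Longrightarrow> y \<le> y1 \<Longrightarrow> f (x, y) = (x', v y)"
  using eqv_vertical[OF f, of y0 y x] b_sk(1) by (simp add: x'_def v_def prod_eq_iff)

lemma f_bottom: "x \<le> \<xi> \<Longrightarrow> \<xi> \<le> 1 \<Longrightarrow> f (\<xi>, y0) = (u0 \<xi>, \<gamma> y0)"
  using eqv_horizontal[OF f, of \<xi> 1 y0] b_sk(2) by (simp add: u0_def \<gamma>_def prod_eq_iff)

lemma f_top: "x \<le> \<xi> \<Longrightarrow> \<xi> \<le> 1 \<Longrightarrow> f (\<xi>, y1) = (u1 \<xi>, \<gamma> y1)"
  using eqv_horizontal[OF f, of \<xi> 1 y1] b_sk(3) by (simp add: u1_def \<gamma>_def prod_eq_iff)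

lemma v_ends: "v y0 = \<gamma> y0" "v y1 = \<gamma> y1"
  using f_bottom[of x] f_top[of x] b by (auto simp: v_def)

lemma u_ends: "u0 x = x'" "u1 x = x'" "u0 1 = 1" "u1 1 = 1"
  using f_left_side[of y1] f_right[of y0] f_right[of y1] b by (auto simp: u0_def u1_def x'_def)

lemma gy: "0 \<le> \<gamma> y0" "\<gamma> y0 < \<gamma> y1" "\<gamma> y1 \<le> 1"
  using \<gamma>_bounds[of y0] \<gamma>_bounds[of y1] \<gamma>_strict_mono[of y0 y1] b by auto

lemma x'_bounds: "0 < x'" "x' < 1"
proof -
  have m: "(x, y0) \<in> unit_square" using b by (simp add: mem_unit_square)
  have fx: "f (x, y0) = (x', \<gamma> y0)" using f_left_side[of y0] v_ends b by simp
  then have "(x', \<gamma> y0) \<in> unit_square" using f_mem[OF m] by simp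
  then have *: "0 \<le> x'" "x' \<le> 1" by (auto simp: mem_unit_square)
  have "x' \<noteq> 1"
  proof
    assume "x' = 1"
    then have "f (x, y0) = f (1, y0)" using fx f_right[of y0] b by simp
    then have "(x, y0) = (1, y0)" by (rule f_inj[rotated 2]) (use b in \<open>simp_all add: mem_unit_square\<close>)
    then show False using b by simp
  qed
  moreover have "x' \<noteq> 0"
  proof
    assume "x' = 0"
    then have "g (0, \<gamma> y0) = (x, y0)" using fx g_f[OF m] by simp
    moreover have "fst (g (0, \<gamma> y0)) = 0" using gy by (intro inv.f_left) auto
    ultimately show False using b by simp
  qed
  ultimately show "0 < x'" "x' < 1" using * by auto
qed

lemma v_cont: "continuous_on {y0..y1} v"
  unfolding v_def by (rule continuous_on_vline[OF F(1)]) (use b in auto)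

lemma v_strict_mono: "y0 \<le> s \<Longrightarrow> s < t \<Longrightarrow> t \<le> y1 \<Longrightarrow> v s < v t"
proof (rule inj_continuous_strict_mono[OF v_cont])
  show "inj_on v {y0..y1}"
  proof (rule inj_onI)
    fix s t assume "s \<in> {y0..y1}" "t \<in> {y0..y1}" "v s = v t"
    then have "f (x, s) = f (x, t)" using f_left_side[of s] f_left_side[of t] by auto
    then have "(x, s) = (x, t)" by (rule f_inj[rotated 2])
        (use b \<open>s \<in> {y0..y1}\<close> \<open>t \<in> {y0..y1}\<close> in \<open>auto simp: mem_unit_square\<close>)
    then show "s = t" by simp
  qed
qed (use v_ends gy in auto)

lemma u0_cont: "continuous_on {x..1} u0"
  unfolding u0_def by (rule continuous_on_hline[OF F(1)]) (use b in auto)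

lemma u1_cont: "continuous_on {x..1} u1"
  unfolding u1_def by (rule continuous_on_hline[OF F(1)]) (use b in auto)

lemma u0_strict_mono: "x \<le> s \<Longrightarrow> s < t \<Longrightarrow> t \<le> 1 \<Longrightarrow> u0 s < u0 t"
proof (rule inj_continuous_strict_mono[OF u0_cont])
  show "inj_on u0 {x..1}"
  proof (rule inj_onI)
    fix s t assume "s \<in> {x..1}" "t \<in> {x..1}" "u0 s = u0 t"
    then have "f (s, y0) = f (t, y0)" using f_bottom[of s] f_bottom[of t] by auto
    then have "(s, y0) = (t, y0)" by (rule f_inj[rotated 2])
        (use b \<open>s \<in> {x..1}\<close> \<open>t \<in> {x..1}\<close> in \<open>auto simp: mem_unit_square\<close>)
    then show "s = t" by simp
  qed
qed (use u_ends x'_bounds in auto)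

lemma u1_strict_mono: "x \<le> s \<Longrightarrow> s < t \<Longrightarrow> t \<le> 1 \<Longrightarrow> u1 s < u1 t"
proof (rule inj_continuous_strict_mono[OF u1_cont])
  show "inj_on u1 {x..1}"
  proof (rule inj_onI)
    fix s t assume "s \<in> {x..1}" "t \<in> {x..1}" "u1 s = u1 t"
    then have "f (s, y1) = f (t, y1)" using f_top[of s] f_top[of t] by auto
    then have "(s, y1) = (t, y1)" by (rule f_inj[rotated 2])
        (use b \<open>s \<in> {x..1}\<close> \<open>t \<in> {x..1}\<close> in \<open>auto simp: mem_unit_square\<close>)
    then show "s = t" by simp
  qed
qed (use u_ends x'_bounds in auto)

lemma v_bounds: "y0 \<le> y \<Longrightarrow> y \<le> y1 \<Longrightarrow> \<gamma> y0 \<le> v y \<and> v y \<le> \<gamma> y1"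
  using v_strict_mono[of y0 y] v_strict_mono[of y y1] v_ends by (cases "y = y0"; cases "y = y1") auto

lemma v_bounds_strict: "y0 < y \<Longrightarrow> y < y1 \<Longrightarrow> \<gamma> y0 < v y \<and> v y < \<gamma> y1"
  using v_strict_mono[of y0 y] v_strict_mono[of y y1] v_ends by auto

lemma u0_bounds: "x \<le> \<xi> \<Longrightarrow> \<xi> \<le> 1 \<Longrightarrow> x' \<le> u0 \<xi> \<and> u0 \<xi> \<le> 1"
  using u0_strict_mono[of x \<xi>] u0_strict_mono[of \<xi> 1] u_ends by (cases "\<xi> = x"; cases "\<xi> = 1") auto

lemma u1_bounds: "x \<le> \<xi> \<Longrightarrow> \<xi> \<le> 1 \<Longrightarrow> x' \<le> u1 \<xi> \<and> u1 \<xi> \<le> 1"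
  using u1_strict_mono[of x \<xi>] u1_strict_mono[of \<xi> 1] u_ends by (cases "\<xi> = x"; cases "\<xi> = 1") auto

lemma boundary_image: "f ` block_boundary x y0 y1 = block_boundary x' (\<gamma> y0) (\<gamma> y1)"
proof
  show "f ` block_boundary x y0 y1 \<subseteq> block_boundary x' (\<gamma> y0) (\<gamma> y1)"
  proof (rule image_subsetI)
    fix p assume p: "p \<in> block_boundary x y0 y1"
    obtain \<xi> y where pe: "p = (\<xi>, y)" by fastforce
    have "\<xi> = x \<or> \<xi> = 1 \<or> y = y0 \<or> y = y1" and r: "x \<le> \<xi>" "\<xi> \<le> 1" "y0 \<le> y" "y \<le> y1"
      using p by (auto simp: block_boundary_def pe)
    then consider "\<xi> = x" | "\<xi> = 1" | "y = y0" | "y = y1" by blast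
    then show "f p \<in> block_boundary x' (\<gamma> y0) (\<gamma> y1)"
    proof cases
      case 1 then show ?thesis using f_left_side[of y] v_bounds[of y] r x'_bounds by (auto simp: pe block_boundary_def)
    next
      case 2 then show ?thesis using f_right[of y] \<gamma>_mono[of y0 y] \<gamma>_mono[of y y1] r b x'_bounds by (auto simp: pe block_boundary_def)
    next
      case 3 then show ?thesis using f_bottom[of \<xi>] u0_bounds[of \<xi>] r gy by (auto simp: pe block_boundary_def)
    next
      case 4 then show ?thesis using f_top[of \<xi>] u1_bounds[of \<xi>] r gy by (auto simp: pe block_boundary_def)
    qed
  qed
  show "block_boundary x' (\<gamma> y0) (\<gamma> y1) \<subseteq> f ` block_boundary x y0 y1"
  proof
    fix p assume p: "p \<in> block_boundary x' (\<gamma> y0) (\<gamma> y1)"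
    obtain \<xi> y where pe: "p = (\<xi>, y)" by fastforce
    have "\<xi> = x' \<or> \<xi> = 1 \<or> y = \<gamma> y0 \<or> y = \<gamma> y1" and r: "x' \<le> \<xi>" "\<xi> \<le> 1" "\<gamma> y0 \<le> y" "y \<le> \<gamma> y1"
      using p by (auto simp: block_boundary_def pe)
    then consider "\<xi> = x'" | "\<xi> = 1" | "y = \<gamma> y0" | "y = \<gamma> y1" by blast
    then have "\<exists>q\<in>block_boundary x y0 y1. f q = p"
    proof cases
      case 1
      obtain s where s: "y0 \<le> s" "s \<le> y1" "v s = y"
        using attains_between[OF v_cont, of y] r v_ends b gy by auto
      then show ?thesis using 1 f_left_side[of s] b pe by (intro bexI[of _ "(x, s)"]) (auto simp: block_boundary_def)
    next
      case 2
      have y: "0 \<le> y" "y \<le> 1" using r gy by auto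
      have "inv.\<gamma> (\<gamma> y0) \<le> inv.\<gamma> y" "inv.\<gamma> y \<le> inv.\<gamma> (\<gamma> y1)" using r gy by (auto intro: inv.\<gamma>_mono)
      then have "y0 \<le> inv.\<gamma> y" "inv.\<gamma> y \<le> y1" using inv_\<gamma>[of y0] inv_\<gamma>[of y1] b by auto
      then show ?thesis using 2 f_right[of "inv.\<gamma> y"] \<gamma>_inv[OF y] b pe
        by (intro bexI[of _ "(1, inv.\<gamma> y)"]) (auto simp: block_boundary_def)
    next
      case 3
      obtain s where s: "x \<le> s" "s \<le> 1" "u0 s = \<xi>"
        using attains_between[OF u0_cont, of \<xi>] r u_ends b by auto
      then show ?thesis using 3 f_bottom[of s] b pe by (intro bexI[of _ "(s, y0)"]) (auto simp: block_boundary_def)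
    next
      case 4
      obtain s where s: "x \<le> s" "s \<le> 1" "u1 s = \<xi>"
        using attains_between[OF u1_cont, of \<xi>] r u_ends b by auto
      then show ?thesis using 4 f_top[of s] b pe by (intro bexI[of _ "(s, y1)"]) (auto simp: block_boundary_def)
    qed
    then show "p \<in> f ` block_boundary x y0 y1" by blast
  qed
qed

lemma boundary_image_inv: "g ` block_boundary x' (\<gamma> y0) (\<gamma> y1) = block_boundary x y0 y1"
proof -
  have "block_boundary x y0 y1 \<subseteq> unit_square" using b by (auto simp: block_boundary_def unit_square_def)
  then show ?thesis unfolding boundary_image[symmetric] using F(2) by (simp add: inv_into_image_cancel)
qed

text \<open>The component argument, applied to \<open>f\<close> and to its inverse. In the interior
  of the block only topology gives information about \<open>f\<close>.\<close>

lemma f_block: "p \<in> unit_square \<Longrightarrow> f p \<in> block x' (\<gamma> y0) (\<gamma> y1) \<longleftrightarrow> p \<in> block x y0 y1"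
proof
  assume p: "p \<in> unit_square" "f p \<in> block x' (\<gamma> y0) (\<gamma> y1)"
  show "p \<in> block x y0 y1"
  proof (rule ccontr)
    assume "p \<notin> block x y0 y1"
    from block_complement_image[OF F(1-4) boundary_image b(1) less_imp_le[OF b(2)] b(3,5) less_imp_le[OF b(4)] x'_bounds(1) p(1) this] p(2)
    show False by blast
  qed
next
  assume p: "p \<in> unit_square" "p \<in> block x y0 y1"
  show "f p \<in> block x' (\<gamma> y0) (\<gamma> y1)"
  proof (rule ccontr)
    assume "f p \<notin> block x' (\<gamma> y0) (\<gamma> y1)"
    from block_complement_image[OF inv.F(1-4) boundary_image_inv x'_bounds(1) less_imp_le[OF x'_bounds(2)] gy(1,3) less_imp_le[OF gy(2)] b(1) f_mem[OF p(1)] this]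
    show False using p g_f by simp
  qed
qed

text \<open>A vertical segment that touches the image block is pulled back to one that touches the
  original block. Removability puts that one on the left side, and \<open>v\<close> brings its ends
  forward again.\<close>

lemma removable_image: "removable T' x' (\<gamma> y0) (\<gamma> y1)"
  unfolding removable_def
proof (intro conjI allI impI)
  show "0 < x'" "x' < 1" "0 \<le> \<gamma> y0" "\<gamma> y0 < \<gamma> y1" "\<gamma> y1 \<le> 1" by (fact x'_bounds gy)+
  show "(x', y) \<in> skeleton T'" if h: "\<gamma> y0 \<le> y" "y \<le> \<gamma> y1" for y
  proof -
    obtain s where s: "y0 \<le> s" "s \<le> y1" "v s = y"
      using attains_between[OF v_cont, of y] h v_ends b gy by auto
    then show ?thesis using f_left_side[of s] b_sk(1)[of s] eqv_skeleton[OF f] by metis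
  qed
  show "(\<xi>, \<gamma> y0) \<in> skeleton T'" if h: "x' \<le> \<xi>" "\<xi> \<le> 1" for \<xi>
  proof -
    obtain s where s: "x \<le> s" "s \<le> 1" "u0 s = \<xi>"
      using attains_between[OF u0_cont, of \<xi>] h u_ends b by auto
    then show ?thesis using f_bottom[of s] b_sk(2)[of s] eqv_skeleton[OF f] by metis
  qed
  show "(\<xi>, \<gamma> y1) \<in> skeleton T'" if h: "x' \<le> \<xi>" "\<xi> \<le> 1" for \<xi>
  proof -
    obtain s where s: "x \<le> s" "s \<le> 1" "u1 s = \<xi>"
      using attains_between[OF u1_cont, of \<xi>] h u_ends b by auto
    then show ?thesis using f_top[of s] b_sk(3)[of s] eqv_skeleton[OF f] by metis
  qed
next
  fix p a b' assume p: "a < b'" "x' \<le> p" "p < 1" "a \<le> \<gamma> y1" "\<gamma> y0 \<le> b'"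
    and s0: "\<forall>y. a \<le> y \<longrightarrow> y \<le> b' \<longrightarrow> (p, y) \<in> skeleton T'"
  then have s: "\<And>y. a \<le> y \<Longrightarrow> y \<le> b' \<Longrightarrow> (p, y) \<in> skeleton T'" by blast
  have bb: "0 \<le> a" "b' \<le> 1" using s[of a] s[of b'] p(1) unfolding mem_skeleton[OF T'] by auto
  have mem: "(p, y) \<in> unit_square" if "a \<le> y" "y \<le> b'" for y
    using s[OF that] skeleton_subset[OF T'] by blast
  define p0 where "p0 = fst (g (p, a))"
  have gp: "fst (g (p, y)) = p0" if "a \<le> y" "y \<le> b'" for y
    unfolding p0_def by (rule eqv_vertical[OF inv.f, symmetric]) (use s that in auto)
  define lo where "lo = min (snd (g (p, a))) (snd (g (p, b')))"
  define hi where "hi = max (snd (g (p, a))) (snd (g (p, b')))"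
  have sk: "(p0, w) \<in> skeleton T" if h: "lo \<le> w" "w \<le> hi" for w
  proof -
    obtain z where z: "a \<le> z" "z \<le> b'" "g (p, z) = (fst (g (p, a)), w)"
      using eqv_image_vline[OF T' inv.f less_imp_le[OF p(1)] s] h unfolding lo_def hi_def by blast
    then show ?thesis using eqv_skeleton[OF inv.f s[OF z(1,2)]] by (simp add: p0_def)
  qed
  have ne: "snd (g (p, a)) \<noteq> snd (g (p, b'))"
  proof
    assume "snd (g (p, a)) = snd (g (p, b'))"
    then have "g (p, a) = g (p, b')" using gp[of b'] p(1) by (simp add: prod_eq_iff p0_def)
    then have "(p, a) = (p, b')" by (rule inv.f_inj[rotated 2]) (use mem p(1) in auto)
    then show False using p(1) by simp
  qed
  \<comment> \<open>A height common to the segment and the image block; its preimage therefore lies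
    in the original block, so the pulled back segment touches it.\<close>
  define q where "q = max a (\<gamma> y0)"
  have q: "a \<le> q" "q \<le> b'" "\<gamma> y0 \<le> q" "q \<le> \<gamma> y1" using p gy by (auto simp: q_def)
  define w where "w = snd (g (p, q))"
  have gq: "g (p, q) = (p0, w)" using gp[OF q(1,2)] by (simp add: w_def prod_eq_iff)
  have gqm: "(p0, w) \<in> unit_square" using g_mem[OF mem[OF q(1,2)]] gq by simp
  have fq: "f (p0, w) = (p, q)" using f_g[OF mem[OF q(1,2)]] gq by simp
  have "(p0, w) \<in> block x y0 y1" using f_block[OF gqm] fq p q by simp
  then have w: "x \<le> p0" "p0 \<le> 1" "y0 \<le> w" "w \<le> y1" by auto
  have p01: "p0 \<noteq> 1" using fq f_right[of w] w b p by auto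
  \<comment> \<open>The inverse is injective and continuous along the segment and keeps its abscissa
    fixed, so the heights are mapped monotonically.\<close>
  have low: "lo \<le> w" "w \<le> hi"
  proof -
    have "continuous_on {a..b'} (\<lambda>s. snd (g (p, s)))" "inj_on (\<lambda>s. snd (g (p, s))) {a..b'}"
    proof -
      have pb: "0 \<le> p" "p \<le> 1" using p x'_bounds by auto
      show "continuous_on {a..b'} (\<lambda>s. snd (g (p, s)))" by (rule continuous_on_vline(2)[OF inv.F(1) bb pb])
      show "inj_on (\<lambda>s. snd (g (p, s))) {a..b'}"
      proof (rule inj_onI)
        fix s t assume st: "s \<in> {a..b'}" "t \<in> {a..b'}" "snd (g (p, s)) = snd (g (p, t))"
        then have "g (p, s) = g (p, t)" using gp[of s] gp[of t] by (simp add: prod_eq_iff)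
        then have "(p, s) = (p, t)" by (rule inv.f_inj[rotated 2]) (use mem st in auto)
        then show "s = t" by simp
      qed
    qed
    then have "a < q \<Longrightarrow> q < b' \<Longrightarrow> lo \<le> w \<and> w \<le> hi"
      using continuous_inj_imp_mono[of a q b' "\<lambda>s. snd (g (p, s))"] by (auto simp: lo_def hi_def w_def)
    then show "lo \<le> w" "w \<le> hi" using q by (cases "q = a"; cases "q = b'"; auto simp: lo_def hi_def w_def)+
  qed
  have k: "p0 = x" "y0 \<le> lo" "hi \<le> y1"
  proof -
    have c: "lo < hi" "p0 < 1" "lo \<le> y1" "y0 \<le> hi"
      using ne w p01 low by (auto simp: lo_def hi_def)
    show "p0 = x" "y0 \<le> lo" "hi \<le> y1"
      by (rule removable_vseg[OF rem c(1) w(1) c(2-4) sk]; assumption)+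
  qed
  have ends: "p = x' \<and> \<gamma> y0 \<le> y \<and> y \<le> \<gamma> y1" if "a \<le> y" "y \<le> b'" "lo \<le> snd (g (p, y))" "snd (g (p, y)) \<le> hi" for y
  proof -
    have "g (p, y) = (x, snd (g (p, y)))" using gp[OF that(1,2)] k by (simp add: prod_eq_iff)
    then have "(p, y) = f (x, snd (g (p, y)))" using f_g[OF mem[OF that(1,2)]] by simp
    also have "\<dots> = (x', v (snd (g (p, y))))" by (rule f_left_side) (use that k in auto)
    finally show ?thesis using v_bounds[of "snd (g (p, y))"] that k by auto
  qed
  show "p = x'" "\<gamma> y0 \<le> a" "b' \<le> \<gamma> y1" using ends[of a] ends[of b'] p(1) by (auto simp: lo_def hi_def)
qed

end

text \<open>A lower removable block of \<open>T'\<close> would be pulled back to a removable block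
  of \<open>T\<close> below the lowest one, as \<open>\<gamma>\<close> and its inverse preserve the
  order.\<close>

lemma (in tequiv_block) lowest_image:
  assumes "lowest T x y0 y1"
  shows "lowest T' x' (\<gamma> y0) (\<gamma> y1)"
  unfolding lowest_def
proof (intro conjI allI impI)
  show "removable T' x' (\<gamma> y0) (\<gamma> y1)" by (rule removable_image)
  fix x2 z0 z1 assume r: "removable T' x2 z0 z1"
  note d = removableD[OF r]
  interpret ib: tequiv_block g T' T x2 z0 z1
    by (intro tequiv_block.intro tequiv_invI[OF T' T inv.f] tequiv_block_axioms.intro r)
  have "y1 \<le> inv.\<gamma> z1" using assms ib.removable_image unfolding lowest_def by blast
  then have "\<gamma> y1 \<le> \<gamma> (inv.\<gamma> z1)" using b inv.\<gamma>_bounds[of z1] d by (intro \<gamma>_mono) auto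
  then show "\<gamma> y1 \<le> z1" using \<gamma>_inv[of z1] d by simp
qed

section \<open>Undoing a pair of gluings along an equivalence\<close>

locale tequiv_glue = tequiv_block +
  fixes S V S' V'
  assumes gl: "gluing S x y0 y1 V" and gl_eq: "glue x y0 y1 V S = T"
    and gl': "gluing S' x' (\<gamma> y0) (\<gamma> y1) V'" and gl_eq': "glue x' (\<gamma> y0) (\<gamma> y1) V' S' = T'"
begin

sublocale A: gluing S x y0 y1 V by (rule gl)
sublocale B: gluing S' x' "\<gamma> y0" "\<gamma> y1" V' by (rule gl')

lemma inverse_glue: "tequiv_glue g T' T x' (\<gamma> y0) (\<gamma> y1) S' V' S V"
proof -
  interpret ib: tequiv_block g T' T x' "\<gamma> y0" "\<gamma> y1"
    by (intro tequiv_block.intro tequiv_invI[OF T' T inv.f] tequiv_block_axioms.intro removable_image)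
  have m: "(x, y0) \<in> unit_square" using b by (simp add: mem_unit_square)
  have "f (x, y0) = (x', \<gamma> y0)" using f_left_side[of y0] v_ends b by simp
  then have x: "ib.x' = x" using g_f[OF m] by (simp add: ib.x'_def)
  have y: "inv.\<gamma> (\<gamma> y0) = y0" "inv.\<gamma> (\<gamma> y1) = y1" using inv_\<gamma> b by auto
  show ?thesis
    by (intro tequiv_glue.intro ib.tequiv_block_axioms tequiv_glue_axioms.intro)
      (simp_all add: x y gl gl_eq gl' gl_eq')
qed

lemma V_forward: "u \<in> V \<Longrightarrow> v u \<in> V'"
proof -
  assume u: "u \<in> V"
  then have ub: "y0 < u" "u < y1" using A.V_sub by auto
  have sk: "(\<xi>, u) \<in> skeleton T" if "x \<le> \<xi>" "\<xi> \<le> 1" for \<xi>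
    using iffD1[OF A.V_glue[OF ub, unfolded gl_eq] u] that by simp
  have lev: "snd (f (1, u)) = v u" unfolding v_def
    by (rule eqv_horizontal[OF f]) (use sk b in auto)
  then have "\<gamma> u = v u" by (simp only: \<gamma>_def)
  then have r: "f (1, u) = (1, v u)" using f_right[of u] ub b by simp
  have l: "f (x, u) = (x', v u)" using f_left_side ub by simp
  have vb: "\<gamma> y0 < v u" "v u < \<gamma> y1" using v_bounds_strict ub by auto
  have "(\<xi>, v u) \<in> skeleton T'" if h: "x' \<le> \<xi>" "\<xi> \<le> 1" for \<xi>
  proof -
    have "min (fst (f (x, u))) (fst (f (1, u))) \<le> \<xi>" "\<xi> \<le> max (fst (f (x, u))) (fst (f (1, u)))"
      using h by (auto simp: l r)
    then obtain s where "x \<le> s" "s \<le> 1" "f (s, u) = (\<xi>, snd (f (x, u)))"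
      using eqv_image_hline[OF T f less_imp_le[OF b(2)] sk] by blast
    then show ?thesis using sk[of s] eqv_skeleton[OF f] l by (metis snd_conv)
  qed
  then show "v u \<in> V'" using B.V_glue[OF vb] unfolding gl_eq' by blast
qed

lemma U_forward: "u \<in> A.U \<Longrightarrow> v u \<in> B.U"
proof -
  assume u: "u \<in> A.U"
  then have ub: "y0 < u" "u < y1" by (auto simp: A.U_def)
  obtain a where a: "a < x" "\<And>\<xi>. a \<le> \<xi> \<Longrightarrow> \<xi> \<le> x \<Longrightarrow> (\<xi>, u) \<in> skeleton T"
    using A.U_glue[OF ub] u unfolding gl_eq by blast
  have am: "(a, u) \<in> unit_square" using a(2)[of a] a(1) skeleton_subset[OF T] by auto
  have lev: "snd (f (a, u)) = v u" unfolding v_def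
    by (rule eqv_horizontal[OF f]) (use a in auto)
  have l: "f (x, u) = (x', v u)" using f_left_side ub by simp
  have vb: "\<gamma> y0 < v u" "v u < \<gamma> y1" using v_bounds_strict ub by auto
  \<comment> \<open>The image point lies outside the image block at a height strictly between its
    ends, so it can only lie to the left of it.\<close>
  have "f (a, u) \<notin> block x' (\<gamma> y0) (\<gamma> y1)" using f_block[OF am] a by simp
  moreover have "f (a, u) = (fst (f (a, u)), v u)" using lev by (simp add: prod_eq_iff)
  moreover have "fst (f (a, u)) \<le> 1" using f_mem[OF am] by (auto simp: unit_square_def)
  ultimately have c: "fst (f (a, u)) < x'" using vb by (metis SigmaI atLeastAtMost_iff less_imp_le not_le)
  have "(\<xi>, v u) \<in> skeleton T'" if h: "fst (f (a, u)) \<le> \<xi>" "\<xi> \<le> x'" for \<xi>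
  proof -
    have "min (fst (f (a, u))) (fst (f (x, u))) \<le> \<xi>" "\<xi> \<le> max (fst (f (a, u))) (fst (f (x, u)))"
      using h by (auto simp: l)
    then obtain s where "a \<le> s" "s \<le> x" "f (s, u) = (\<xi>, snd (f (a, u)))"
      using eqv_image_hline[OF T f less_imp_le[OF a(1)] a(2)] by blast
    then show ?thesis using a(2)[of s] eqv_skeleton[OF f] lev by metis
  qed
  then show "v u \<in> B.U" using B.U_glue[OF vb] c unfolding gl_eq' by blast
qed

lemma v_inverse:
  assumes "\<gamma> y0 \<le> y" "y \<le> \<gamma> y1"
  shows "v (snd (g (x', y))) = y" "y0 \<le> snd (g (x', y))" "snd (g (x', y)) \<le> y1"
proof -
  obtain s where s: "y0 \<le> s" "s \<le> y1" "v s = y"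
    using attains_between[OF v_cont, of y] assms v_ends b gy by auto
  have m: "(x, s) \<in> unit_square" using s b by (simp add: mem_unit_square)
  have "g (x', y) = (x, s)" using g_f[OF m] f_left_side[OF s(1,2)] s(3) by simp
  then show "v (snd (g (x', y))) = y" "y0 \<le> snd (g (x', y))" "snd (g (x', y)) \<le> y1" using s by auto
qed

lemma V_image: "v ` V = V'"
proof
  show "v ` V \<subseteq> V'" using V_forward by blast
  interpret ib: tequiv_glue g T' T x' "\<gamma> y0" "\<gamma> y1" S' V' S V by (rule inverse_glue)
  show "V' \<subseteq> v ` V"
  proof
    fix y assume y: "y \<in> V'"
    have "snd (g (x', y)) \<in> V" using ib.V_forward[OF y] by (simp add: ib.v_def)
    moreover have "v (snd (g (x', y))) = y" using y B.V_sub by (intro v_inverse) auto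
    ultimately show "y \<in> v ` V" by (metis imageI)
  qed
qed

lemma U_image: "v ` A.U = B.U"
proof
  show "v ` A.U \<subseteq> B.U" using U_forward by blast
  interpret ib: tequiv_glue g T' T x' "\<gamma> y0" "\<gamma> y1" S' V' S V by (rule inverse_glue)
  show "B.U \<subseteq> v ` A.U"
  proof
    fix y assume y: "y \<in> B.U"
    have "snd (g (x', y)) \<in> A.U" using ib.U_forward[OF y] inv_\<gamma> b by (simp add: ib.v_def)
    moreover have "v (snd (g (x', y))) = y" using y by (intro v_inverse) (auto simp: B.U_def)
    ultimately show "y \<in> v ` A.U" by (metis imageI)
  qed
qed

text \<open>To undo both gluings, keep the equivalence outside the block and interpolate inside it
  between its values on the left, lower and upper side of the block.\<close>

definition "w \<xi> y = (y1 - y) / (y1 - y0) * u0 \<xi> + (y - y0) / (y1 - y0) * u1 \<xi>"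
definition "fbar p = (if p \<in> block x y0 y1 then (w (fst p) (snd p), v (snd p)) else f p)"

lemma w_weights:
  assumes "y0 \<le> y" "y \<le> y1"
  shows "0 \<le> (y1 - y) / (y1 - y0)" "0 \<le> (y - y0) / (y1 - y0)" "(y1 - y) / (y1 - y0) + (y - y0) / (y1 - y0) = 1"
  using assms b(4) by (auto simp: add_divide_distrib[symmetric])

lemma w_ends: "w \<xi> y0 = u0 \<xi>" "w \<xi> y1 = u1 \<xi>"
  using b(4) by (auto simp: w_def)

lemma w_sides:
  assumes "y0 \<le> y" "y \<le> y1"
  shows "w x y = x'" "w 1 y = 1"
proof -
  have "w x y = ((y1 - y) / (y1 - y0) + (y - y0) / (y1 - y0)) * x'"
    "w 1 y = ((y1 - y) / (y1 - y0) + (y - y0) / (y1 - y0)) * 1"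
    by (simp_all only: w_def u_ends distrib_right)
  then show "w x y = x'" "w 1 y = 1" by (simp_all only: w_weights(3)[OF assms] mult_1)
qed

lemma w_strict_mono:
  assumes "y0 \<le> y" "y \<le> y1" "x \<le> s" "s < t" "t \<le> 1"
  shows "w s y < w t y"
proof (cases "y = y1")
  case True then show ?thesis using u1_strict_mono assms by (simp add: w_ends)
next
  case False
  then have "0 < (y1 - y) / (y1 - y0)" using assms b(4) by simp
  then have "(y1 - y) / (y1 - y0) * u0 s < (y1 - y) / (y1 - y0) * u0 t"
    using u0_strict_mono[OF assms(3-5)] by (rule mult_strict_left_mono[rotated])
  moreover have "(y - y0) / (y1 - y0) * u1 s \<le> (y - y0) / (y1 - y0) * u1 t"
    using u1_strict_mono[OF assms(3-5)] w_weights(2)[OF assms(1,2)] by (intro mult_left_mono) auto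
  ultimately show ?thesis by (simp add: w_def)
qed

lemma w_bounds:
  assumes "y0 \<le> y" "y \<le> y1" "x \<le> \<xi>" "\<xi> \<le> 1"
  shows "x' \<le> w \<xi> y \<and> w \<xi> y \<le> 1"
  using w_strict_mono[OF assms(1,2), of x \<xi>] w_strict_mono[OF assms(1,2), of \<xi> 1] w_sides[OF assms(1,2)] assms(3,4)
  by (cases "\<xi> = x"; cases "\<xi> = 1") auto

lemma w_cont: "continuous_on {x..1} (\<lambda>\<xi>. w \<xi> y)"
  unfolding w_def by (intro continuous_intros u0_cont u1_cont)

lemma fbar_outer: "p \<notin> block x y0 y1 \<Longrightarrow> fbar p = f p"
  unfolding fbar_def by (rule if_not_P)

lemma fbar_inner: "x \<le> \<xi> \<Longrightarrow> \<xi> \<le> 1 \<Longrightarrow> y0 \<le> y \<Longrightarrow> y \<le> y1 \<Longrightarrow> fbar (\<xi>, y) = (w \<xi> y, v y)"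
  by (simp add: fbar_def)

lemma fbar_sides:
  assumes "p \<in> block x y0 y1" "fst p = x \<or> snd p = y0 \<or> snd p = y1"
  shows "fbar p = f p"
proof -
  obtain \<xi> y where p: "p = (\<xi>, y)" by fastforce
  from assms show ?thesis
    using f_left_side[of y] f_bottom[of \<xi>] f_top[of \<xi>] v_ends w_sides(1)[of y] w_ends
    by (auto simp: p fbar_inner)
qed

lemma fbar_right: "0 \<le> y \<Longrightarrow> y \<le> 1 \<Longrightarrow> fst (fbar (1, y)) = 1"
  using f_right[of y] w_sides[of y] by (simp add: fbar_def)

lemma fbar_cont: "continuous_on unit_square fbar"
proof -
  let ?B = "unit_square \<inter> ({..x} \<times> UNIV \<union> UNIV \<times> {..y0} \<union> UNIV \<times> {y1..})"
  have US: "unit_square = block x y0 y1 \<union> ?B"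
    using b by (auto simp: unit_square_def)
  have c: "continuous_on (block x y0 y1) (\<lambda>p. (w (fst p) (snd p), v (snd p)))"
    unfolding w_def
    by (intro continuous_intros continuous_on_compose2[OF u0_cont] continuous_on_compose2[OF u1_cont]
        continuous_on_compose2[OF v_cont]) (use b in auto)
  have "continuous_on (block x y0 y1 \<union> ?B)
      (\<lambda>p. if p \<in> block x y0 y1 then (w (fst p) (snd p), v (snd p)) else f p)"
  proof (rule continuous_on_cases)
    show "closed (block x y0 y1)" by (intro closed_Times) auto
    show "closed ?B" by (intro closed_Int closed_Un closed_Times closed_unit_square) auto
    show "continuous_on ?B f" by (rule continuous_on_subset[OF F(1)]) auto
    show "\<forall>p. p \<in> block x y0 y1 \<and> p \<notin> block x y0 y1 \<or> p \<in> ?B \<and> p \<in> block x y0 y1 \<longrightarrow>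
        (w (fst p) (snd p), v (snd p)) = f p"
    proof (intro allI impI)
      fix p assume "p \<in> block x y0 y1 \<and> p \<notin> block x y0 y1 \<or> p \<in> ?B \<and> p \<in> block x y0 y1"
      then have "p \<in> block x y0 y1" "fst p = x \<or> snd p = y0 \<or> snd p = y1" by auto
      then show "(w (fst p) (snd p), v (snd p)) = f p" using fbar_sides[of p] unfolding fbar_def by simp
    qed
  qed (rule c)
  then show ?thesis unfolding fbar_def[abs_def] US[symmetric] .
qed

lemma fbar_block: "p \<in> unit_square \<Longrightarrow> fbar p \<in> block x' (\<gamma> y0) (\<gamma> y1) \<longleftrightarrow> p \<in> block x y0 y1"
proof (cases "p \<in> block x y0 y1")
  case True
  then show ?thesis using w_bounds[of "snd p" "fst p"] v_bounds[of "snd p"] by (auto simp: fbar_def)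
next
  case False
  moreover assume "p \<in> unit_square"
  ultimately show ?thesis using f_block[of p] fbar_outer[OF False] by simp
qed

lemma fbar_inj: "inj_on fbar unit_square"
proof (rule inj_onI)
  fix p q assume p: "p \<in> unit_square" and q: "q \<in> unit_square" and e: "fbar p = fbar q"
  show "p = q"
  proof (cases "p \<in> block x y0 y1")
    case True
    then have "q \<in> block x y0 y1" using fbar_block p q e by metis
    with True have "w (fst p) (snd p) = w (fst q) (snd q)" "v (snd p) = v (snd q)"
      using e by (auto simp: fbar_def)
    moreover have pb: "x \<le> fst p" "fst p \<le> 1" "y0 \<le> snd p" "snd p \<le> y1"
      and qb: "x \<le> fst q" "fst q \<le> 1" "y0 \<le> snd q" "snd q \<le> y1"
      using True \<open>q \<in> block x y0 y1\<close> by auto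
    ultimately have "snd p = snd q"
      using v_strict_mono[of "snd p" "snd q"] v_strict_mono[of "snd q" "snd p"] by linarith
    moreover have "fst p = fst q"
      using \<open>w (fst p) (snd p) = w (fst q) (snd q)\<close> \<open>snd p = snd q\<close> pb qb
        w_strict_mono[of "snd q" "fst p" "fst q"] w_strict_mono[of "snd q" "fst q" "fst p"] by force
    ultimately show ?thesis by (simp add: prod_eq_iff)
  next
    case False
    then have "q \<notin> block x y0 y1" using fbar_block p q e by metis
    then have "f p = f q" using e fbar_outer[OF False] fbar_outer[of q] by metis
    then show ?thesis by (rule f_inj[OF p q])
  qed
qed

lemma fbar_onto_block:
  assumes "x' \<le> \<xi>'" "\<xi>' \<le> 1" "\<gamma> y0 \<le> y'" "y' \<le> \<gamma> y1"
  obtains \<xi> y where "x \<le> \<xi>" "\<xi> \<le> 1" "y0 \<le> y" "y \<le> y1" "w \<xi> y = \<xi>'" "v y = y'" "fbar (\<xi>, y) = (\<xi>', y')"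
proof -
  obtain y where y: "y0 \<le> y" "y \<le> y1" "v y = y'"
    using attains_between[OF v_cont, of y'] assms v_ends b gy by auto
  obtain \<xi> where "x \<le> \<xi>" "\<xi> \<le> 1" "w \<xi> y = \<xi>'"
    using attains_between[OF w_cont, of y \<xi>'] assms w_sides[OF y(1,2)] b by auto
  then show ?thesis using that[of \<xi> y] y fbar_inner by simp
qed

lemma fbar_onto_outer:
  assumes "p \<in> unit_square" "p \<notin> block x' (\<gamma> y0) (\<gamma> y1)"
  shows "fbar (g p) = p" "g p \<in> unit_square" "g p \<notin> block x y0 y1"
proof -
  show 1: "g p \<in> unit_square" by (rule g_mem[OF assms(1)])
  show 2: "g p \<notin> block x y0 y1" using f_block[OF 1] f_g[OF assms(1)] assms(2) by simp
  show "fbar (g p) = p" using fbar_outer[OF 2] f_g[OF assms(1)] by simp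
qed

lemma fbar_onto: "fbar ` unit_square = unit_square"
proof
  show "fbar ` unit_square \<subseteq> unit_square"
  proof (rule image_subsetI)
    fix p assume p: "p \<in> unit_square"
    show "fbar p \<in> unit_square"
    proof (cases "p \<in> block x y0 y1")
      case True
      then have "fbar p \<in> block x' (\<gamma> y0) (\<gamma> y1)" using fbar_block[OF p] by blast
      then show ?thesis using x'_bounds gy by (auto simp: unit_square_def)
    next
      case False then show ?thesis using f_mem[OF p] fbar_outer by simp
    qed
  qed
  show "unit_square \<subseteq> fbar ` unit_square"
  proof
    fix p assume p: "p \<in> unit_square"
    obtain \<xi>' y' where pe: "p = (\<xi>', y')" by fastforce
    show "p \<in> fbar ` unit_square"
    proof (cases "p \<in> block x' (\<gamma> y0) (\<gamma> y1)")
      case True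
      then have "x' \<le> \<xi>'" "\<xi>' \<le> 1" "\<gamma> y0 \<le> y'" "y' \<le> \<gamma> y1" by (auto simp: pe)
      then obtain \<xi> y where "x \<le> \<xi>" "\<xi> \<le> 1" "y0 \<le> y" "y \<le> y1" "fbar (\<xi>, y) = p"
        using fbar_onto_block unfolding pe by metis
      moreover have "(\<xi>, y) \<in> unit_square" using calculation b by (simp add: mem_unit_square)
      ultimately show ?thesis by (metis imageI)
    next
      case False then show ?thesis using fbar_onto_outer[OF p] by (metis imageI)
    qed
  qed
qed

lemma skeleton_S_outer: "p \<notin> block x y0 y1 \<Longrightarrow> fst p \<le> 1 \<Longrightarrow> p \<in> skeleton S \<longleftrightarrow> p \<in> skeleton T"
  using A.skeleton_glue_outside[of "fst p" "snd p"] unfolding gl_eq by (cases p) auto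

lemma skeleton_S'_outer: "p \<notin> block x' (\<gamma> y0) (\<gamma> y1) \<Longrightarrow> fst p \<le> 1 \<Longrightarrow> p \<in> skeleton S' \<longleftrightarrow> p \<in> skeleton T'"
  using B.skeleton_glue_outside[of "fst p" "snd p"] unfolding gl_eq' by (cases p) auto

lemma fst_le: "p \<in> unit_square \<Longrightarrow> fst p \<le> 1"
  by (auto simp: unit_square_def)

text \<open>Inside the block the skeletons of the smaller tilings consist of the right side and the
  horizontals at \<open>U\<close>, \<open>y0\<close> and \<open>y1\<close>; \<open>fbar\<close> acts
  on heights there by \<open>v\<close>, which matches the two sets \<open>U\<close>. Outside,
  nothing has changed.\<close>

lemma fbar_skeleton: "fbar ` skeleton S = skeleton S'"
proof
  have subS: "skeleton S \<subseteq> unit_square" by (rule skeleton_subset[OF A.tiling])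
  have subS': "skeleton S' \<subseteq> unit_square" by (rule skeleton_subset[OF B.tiling])
  show "fbar ` skeleton S \<subseteq> skeleton S'"
  proof (rule image_subsetI)
    fix p assume p: "p \<in> skeleton S"
    then have pu: "p \<in> unit_square" using subS by blast
    obtain \<xi> y where pe: "p = (\<xi>, y)" by fastforce
    show "fbar p \<in> skeleton S'"
    proof (cases "p \<in> block x y0 y1")
      case True
      then have r: "x \<le> \<xi>" "\<xi> \<le> 1" "y0 \<le> y" "y \<le> y1" by (auto simp: pe)
      have "y \<in> insert y0 (insert y1 A.U) \<or> \<xi> = 1" using A.skeleton_block[OF r] p by (simp add: pe)
      then have "v y \<in> insert (\<gamma> y0) (insert (\<gamma> y1) B.U) \<or> w \<xi> y = 1"
        using U_forward[of y] v_ends w_sides(2)[OF r(3,4)] by auto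
      then show ?thesis using B.skeleton_block[of "w \<xi> y" "v y"] w_bounds[OF r(3,4,1,2)] v_bounds[OF r(3,4)]
        by (simp add: pe fbar_inner[OF r])
    next
      case False
      then have "p \<in> skeleton T" using skeleton_S_outer[OF False fst_le[OF pu]] p by blast
      then have "f p \<in> skeleton T'" by (rule eqv_skeleton[OF f])
      moreover have "f p \<notin> block x' (\<gamma> y0) (\<gamma> y1)" using f_block[OF pu] False by metis
      ultimately have "f p \<in> skeleton S'" using skeleton_S'_outer fst_le[OF f_mem[OF pu]] by blast
      then show ?thesis using fbar_outer[OF False] by simp
    qed
  qed
  show "skeleton S' \<subseteq> fbar ` skeleton S"
  proof
    fix p assume p: "p \<in> skeleton S'"
    then have pu: "p \<in> unit_square" using subS' by blast
    obtain \<xi>' y' where pe: "p = (\<xi>', y')" by fastforce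
    show "p \<in> fbar ` skeleton S"
    proof (cases "p \<in> block x' (\<gamma> y0) (\<gamma> y1)")
      case True
      then have r': "x' \<le> \<xi>'" "\<xi>' \<le> 1" "\<gamma> y0 \<le> y'" "y' \<le> \<gamma> y1" by (auto simp: pe)
      obtain \<xi> y where r: "x \<le> \<xi>" "\<xi> \<le> 1" "y0 \<le> y" "y \<le> y1" and e: "w \<xi> y = \<xi>'" "v y = y'" "fbar (\<xi>, y) = (\<xi>', y')"
        by (rule fbar_onto_block[OF r'])
      have "y' \<in> insert (\<gamma> y0) (insert (\<gamma> y1) B.U) \<or> \<xi>' = 1" using B.skeleton_block[OF r'] p by (simp add: pe)
      moreover have "y = s" if "v y = v s" "y0 \<le> s" "s \<le> y1" for s
        using that r v_strict_mono[of y s] v_strict_mono[of s y] by force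
      moreover have "\<exists>u\<in>A.U. y' = v u" if "y' \<in> B.U" using that U_image by blast
      moreover have "\<xi> = 1" if "\<xi>' = 1"
        using w_strict_mono[of y \<xi> 1] w_sides(2)[OF r(3,4)] r e that by force
      moreover have "y0 \<le> u" "u \<le> y1" if "u \<in> A.U" for u using that by (auto simp: A.U_def)
      ultimately have "y \<in> insert y0 (insert y1 A.U) \<or> \<xi> = 1"
        using v_ends e(2) b(4) by (metis insert_iff less_imp_le order_refl)
      then have "(\<xi>, y) \<in> skeleton S" using A.skeleton_block[OF r] by blast
      then show ?thesis using e(3) unfolding pe by (metis imageI)
    next
      case False
      then have "p \<in> skeleton T'" using skeleton_S'_outer[OF False fst_le[OF pu]] p by blast
      then have "g p \<in> skeleton T" by (rule eqv_skeleton[OF inv.f])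
      moreover note o = fbar_onto_outer[OF pu False]
      ultimately have "g p \<in> skeleton S" using skeleton_S_outer[OF o(3) fst_le[OF o(2)]] by blast
      then show ?thesis using o(1) by (metis imageI)
    qed
  qed
qed

text \<open>A segment that enters the block at height \<open>y\<close> runs up to the left side
  within the skeleton of \<open>T\<close>, where \<open>f\<close> keeps its ordinate equal to that
  of \<open>f (x, y)\<close>, namely \<open>v y\<close>. Inside the block the ordinate of
  \<open>fbar\<close> is \<open>v y\<close> by construction.\<close>

lemma fbar_horizontal:
  assumes ab: "a < c" and s: "\<And>\<xi>. a \<le> \<xi> \<Longrightarrow> \<xi> \<le> c \<Longrightarrow> (\<xi>, y) \<in> skeleton S"
  shows "snd (fbar (a, y)) = snd (fbar (c, y))"
proof -
  have u: "(\<xi>, y) \<in> unit_square" if "a \<le> \<xi>" "\<xi> \<le> c" for \<xi>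
    using s[OF that] skeleton_subset[OF A.tiling] by blast
  have T_out: "(\<xi>, y) \<in> skeleton T" if "a \<le> \<xi>" "\<xi> \<le> c" "(\<xi>, y) \<notin> block x y0 y1" for \<xi>
    using skeleton_S_outer[OF that(3)] s[OF that(1,2)] fst_le[OF u[OF that(1,2)]] by blast
  show ?thesis
  proof (cases "y0 \<le> y \<and> y \<le> y1 \<and> x \<le> c")
    case False
    then have o: "(\<xi>, y) \<notin> block x y0 y1" if "\<xi> \<le> c" for \<xi> using that by auto
    have "snd (f (a, y)) = snd (f (c, y))" by (rule eqv_horizontal[OF f]) (use ab T_out o in auto)
    then show ?thesis using fbar_outer[OF o[of a]] fbar_outer[OF o[of c]] ab by simp
  next
    case True
    then have y: "y0 \<le> y" "y \<le> y1" and xc: "x \<le> c" by auto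
    have c1: "c \<le> 1" using u[of c] ab by (simp add: mem_unit_square)
    have C: "snd (fbar (c, y)) = v y" using fbar_inner[OF xc c1 y] by simp
    show ?thesis
    proof (cases "x \<le> a")
      case True
      then show ?thesis using C fbar_inner[of a y] ab c1 y by simp
    next
      case False
      have "(\<xi>, y) \<in> skeleton T" if "a \<le> \<xi>" "\<xi> \<le> x" for \<xi>
        using T_out[of \<xi>] b_sk(1)[OF y] that xc by (cases "\<xi> = x") auto
      then have "snd (f (a, y)) = snd (f (x, y))" by (intro eqv_horizontal[OF f]) (use False in auto)
      moreover have "(a, y) \<notin> block x y0 y1" using False by simp
      ultimately show ?thesis using C fbar_outer by (simp add: v_def)
    qed
  qed
qed

text \<open>By \<open>no_vseg\<close>, vertical segments of \<open>S\<close> short of the right side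
  stay away from the block, so \<open>fbar\<close> agrees with \<open>f\<close> on them.\<close>

lemma fbar_vertical:
  assumes ab: "a < c" and s: "\<And>y. a \<le> y \<Longrightarrow> y \<le> c \<Longrightarrow> (p, y) \<in> skeleton S"
  shows "fst (fbar (p, a)) = fst (fbar (p, c))"
proof -
  have u: "0 \<le> p" "p \<le> 1" "0 \<le> a" "c \<le> 1"
    using s[of a] s[of c] ab unfolding mem_skeleton[OF A.tiling] by auto
  show ?thesis
  proof (cases "p = 1")
    case True then show ?thesis using fbar_right u ab by simp
  next
    case False
    have o: "(p, y) \<notin> block x y0 y1" if "a \<le> y" "y \<le> c" for y
      using A.no_vseg[OF ab, of p] s u False that by force
    have "fst (f (p, a)) = fst (f (p, c))"
    proof (rule eqv_vertical[OF f])
      fix y assume "min a c \<le> y" "y \<le> max a c"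
      then show "(p, y) \<in> skeleton T" using skeleton_S_outer[OF o[of y]] s[of y] u ab by simp
    qed
    then show ?thesis using fbar_outer[OF o[of a]] fbar_outer[OF o[of c]] ab by simp
  qed
qed

lemma unglue_eqv: "eqv fbar S S'"
proof (rule eqvI[OF fbar_cont fbar_inj fbar_onto _ _ _ _ fbar_skeleton])
  show "fbar (0,0) = (0,0)" "fbar (0,1) = (0,1)" using b F(4,6) by (simp_all add: fbar_outer)
  show "fbar (1,0) = (1,0)"
  proof (cases "(1, 0) \<in> block x y0 y1")
    case True then show ?thesis using fbar_sides[OF True] F(5) b by auto
  qed (use F(5) fbar_outer in simp)
  show "fbar (1,1) = (1,1)"
  proof (cases "(1, 1) \<in> block x y0 y1")
    case True then show ?thesis using fbar_sides[OF True] F(7) b by auto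
  qed (use F(7) fbar_outer in simp)
qed (fact fbar_horizontal, fact fbar_vertical)

end

section \<open>Equivalences near the right side\<close>

text \<open>The map is affine in the first coordinate near the right side and keeps the coordinates
  separate there; this is what makes equivalences compatible with gluing.\<close>

definition tame :: "(real \<times> real \<Rightarrow> real \<times> real) \<Rightarrow> bool" where
  "tame f \<longleftrightarrow> (\<exists>\<delta> \<delta>' g. 0 < \<delta> \<and> \<delta> < 1 \<and> 0 < \<delta>' \<and> \<delta>' < 1 \<and>
     (\<forall>s y. 0 \<le> s \<longrightarrow> s \<le> 1 \<longrightarrow> 0 \<le> y \<longrightarrow> y \<le> 1 \<longrightarrow> f (1 - s * \<delta>, y) = (1 - s * \<delta>', g y)))"

definition teq :: "tile set \<Rightarrow> tile set \<Rightarrow> bool" where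
  "teq T T' \<longleftrightarrow> is_tiling T \<and> is_tiling T' \<and> (\<exists>f. eqv f T T' \<and> tame f)"

lemma tameI:
  assumes "0 < \<delta>" "\<delta> < 1" "\<And>\<xi> y. 1 - \<delta> \<le> \<xi> \<Longrightarrow> \<xi> \<le> 1 \<Longrightarrow> 0 \<le> y \<Longrightarrow> y \<le> 1 \<Longrightarrow> f (\<xi>, y) = (\<xi>, g y)"
  shows "tame f"
  unfolding tame_def
proof (intro exI conjI allI impI)
  fix s y :: real assume "0 \<le> s" "s \<le> 1" "0 \<le> y" "y \<le> 1"
  then show "f (1 - s * \<delta>, y) = (1 - s * \<delta>, g y)"
    using assms(1,2) by (intro assms(3)) (auto simp: mult_le_cancel_right2)
qed (use assms in auto)

lemma teq_sym:
  assumes "teq T T'"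
  shows "teq T' T"
proof -
  obtain f where til: "is_tiling T" "is_tiling T'" and "eqv f T T'" and "tame f"
    using assms by (auto simp: teq_def)
  then obtain \<delta> \<delta>' g where d: "0 < \<delta>" "\<delta> < 1" "0 < \<delta>'" "\<delta>' < 1"
    and fs: "\<And>s y. 0 \<le> s \<Longrightarrow> s \<le> 1 \<Longrightarrow> 0 \<le> y \<Longrightarrow> y \<le> 1 \<Longrightarrow> f (1 - s * \<delta>, y) = (1 - s * \<delta>', g y)"
    unfolding tame_def by blast
  interpret tequiv_inv f T T' by (rule tequiv_invI[OF til \<open>eqv f T T'\<close>])
  have g: "g y = \<gamma> y" if "0 \<le> y" "y \<le> 1" for y
    using fs[of 0 y] f_right[of y] that by simp
  have "tame (inv_into unit_square f)"
    unfolding tame_def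
  proof (intro exI conjI allI impI)
    fix s y :: real assume s: "0 \<le> s" "s \<le> 1" "0 \<le> y" "y \<le> 1"
    have i: "0 \<le> inv.\<gamma> y" "inv.\<gamma> y \<le> 1" using inv.\<gamma>_bounds s by auto
    have "f (1 - s * \<delta>, inv.\<gamma> y) = (1 - s * \<delta>', y)" using fs[OF s(1,2) i] g[OF i] \<gamma>_inv[of y] s by simp
    moreover have "s * \<delta> \<le> 1" "0 \<le> s * \<delta>" using s d by (auto intro: mult_le_one)
    then have "(1 - s * \<delta>, inv.\<gamma> y) \<in> unit_square" using i by (simp add: mem_unit_square)
    ultimately show "inv_into unit_square f (1 - s * \<delta>', y) = (1 - s * \<delta>, inv.\<gamma> y)" using g_f by metis
  qed (use d in auto)
  with til inv.f show ?thesis unfolding teq_def by (intro conjI exI)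
qed

lemma teq_trans:
  assumes "teq T T'" "teq T' T''"
  shows "teq T T''"
proof -
  obtain f where T: "is_tiling T" "is_tiling T'" and f: "eqv f T T'" and "tame f"
    using assms by (auto simp: teq_def)
  then obtain \<delta>1 \<delta>1' g1 where d1: "0 < \<delta>1" "\<delta>1 < 1" "0 < \<delta>1'" "\<delta>1' < 1"
    and fs1: "\<And>s y. 0 \<le> s \<Longrightarrow> s \<le> 1 \<Longrightarrow> 0 \<le> y \<Longrightarrow> y \<le> 1 \<Longrightarrow> f (1 - s * \<delta>1, y) = (1 - s * \<delta>1', g1 y)"
    unfolding tame_def by blast
  obtain f' where T'': "is_tiling T''" and f': "eqv f' T' T''" and "tame f'"
    using assms by (auto simp: teq_def)
  then obtain \<delta>2 \<delta>2' g2 where d2: "0 < \<delta>2" "\<delta>2 < 1" "0 < \<delta>2'" "\<delta>2' < 1"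
    and fs2: "\<And>s y. 0 \<le> s \<Longrightarrow> s \<le> 1 \<Longrightarrow> 0 \<le> y \<Longrightarrow> y \<le> 1 \<Longrightarrow> f' (1 - s * \<delta>2, y) = (1 - s * \<delta>2', g2 y)"
    unfolding tame_def by blast
  have g1: "0 \<le> g1 y" "g1 y \<le> 1" if "0 \<le> y" "y \<le> 1" for y
  proof -
    have "(1, y) \<in> unit_square" using that by (simp add: mem_unit_square)
    then have "f (1, y) \<in> unit_square" using eqvD(3)[OF f] by blast
    then show "0 \<le> g1 y" "g1 y \<le> 1" using fs1[of 0 y] that by (auto simp: mem_unit_square)
  qed
  \<comment> \<open>The image strip of the first map and the domain strip of the second have
    different widths. Both are cut down to the common width \<open>m\<close>, and \<open>r1\<close>,
    \<open>r2\<close> are the fractions that remain.\<close>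
  define m where "m = min \<delta>1' \<delta>2"
  define r1 where "r1 = m / \<delta>1'"
  define r2 where "r2 = m / \<delta>2"
  have m: "0 < m" using d1 d2 by (simp add: m_def)
  have r: "0 < r1" "r1 \<le> 1" "0 < r2" "r2 \<le> 1" "r1 * \<delta>1' = m" "r2 * \<delta>2 = m"
    using d1 d2 m by (auto simp: r1_def r2_def m_def)
  have "tame (f' \<circ> f)"
    unfolding tame_def
  proof (intro exI conjI allI impI)
    show "0 < r1 * \<delta>1" "0 < r2 * \<delta>2'" using r d1 d2 by auto
    have "r1 * \<delta>1 \<le> 1 * \<delta>1" using r d1 by (intro mult_right_mono) auto
    then show "r1 * \<delta>1 < 1" using d1 by linarith
    have "r2 * \<delta>2' \<le> 1 * \<delta>2'" using r d2 by (intro mult_right_mono) auto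
    then show "r2 * \<delta>2' < 1" using d2 by linarith
    fix s y :: real assume s: "0 \<le> s" "s \<le> 1" "0 \<le> y" "y \<le> 1"
    have sr: "0 \<le> s * r1" "s * r1 \<le> 1" "0 \<le> s * r2" "s * r2 \<le> 1"
      using s r by (auto intro: mult_le_one)
    have "f (1 - s * (r1 * \<delta>1), y) = (1 - (s * r1) * \<delta>1', g1 y)"
      using fs1[OF sr(1,2) s(3,4)] by (simp add: mult.assoc)
    also have "(s * r1) * \<delta>1' = (s * r2) * \<delta>2" using r by (simp add: mult.assoc)
    finally show "(f' \<circ> f) (1 - s * (r1 * \<delta>1), y) = (1 - s * (r2 * \<delta>2'), g2 (g1 y))"
      using fs2[OF sr(3,4) g1[OF s(3,4)]] by (simp add: mult.assoc)
  qed
  then show ?thesis using eqv_trans[OF T(1) f f'] T T'' unfolding teq_def by blast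
qed

section \<open>Deformations that move one new block\<close>

lemma hshear:
  fixes h :: "real \<Rightarrow> real \<Rightarrow> real"
  assumes cont: "continuous_on unit_square (\<lambda>p. h (fst p) (snd p))"
    and mono: "\<And>s t y. 0 \<le> s \<Longrightarrow> s < t \<Longrightarrow> t \<le> 1 \<Longrightarrow> h s y < h t y"
    and ends: "\<And>y. h 0 y = 0" "\<And>y. h 1 y = 1"
    and f_def: "f = (\<lambda>p. (h (fst p) (snd p), snd p))"
  shows "continuous_on unit_square f" "inj_on f unit_square" "f ` unit_square = unit_square"
    "f (0,0) = (0,0)" "f (1,0) = (1,0)" "f (0,1) = (0,1)" "f (1,1) = (1,1)"
proof -
  show "continuous_on unit_square f" unfolding f_def by (intro continuous_intros cont)
  show "f (0,0) = (0,0)" "f (1,0) = (1,0)" "f (0,1) = (0,1)" "f (1,1) = (1,1)"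
    by (simp_all add: f_def ends)
  have bd: "0 \<le> h s y" "h s y \<le> 1" if "0 \<le> s" "s \<le> 1" for s y
    using mono[of 0 s y] mono[of s 1 y] ends[of y] that by (cases "s = 0"; cases "s = 1"; force)+
  show "inj_on f unit_square"
  proof (rule inj_onI)
    fix p q assume pq: "p \<in> unit_square" "q \<in> unit_square" "f p = f q"
    then have "snd p = snd q" "h (fst p) (snd p) = h (fst q) (snd p)" by (auto simp: f_def)
    moreover have "0 \<le> fst p" "fst p \<le> 1" "0 \<le> fst q" "fst q \<le> 1" using pq by (auto simp: unit_square_def)
    ultimately have "\<not> fst p < fst q" "\<not> fst q < fst p"
      using mono[of "fst p" "fst q" "snd p"] mono[of "fst q" "fst p" "snd p"] by auto
    then show "p = q" using \<open>snd p = snd q\<close> by (simp add: prod_eq_iff)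
  qed
  show "f ` unit_square = unit_square"
  proof
    show "f ` unit_square \<subseteq> unit_square" using bd by (auto simp: f_def unit_square_def)
    show "unit_square \<subseteq> f ` unit_square"
    proof
      fix p assume p: "p \<in> unit_square"
      obtain \<xi> y where pe: "p = (\<xi>, y)" by fastforce
      have b: "0 \<le> \<xi>" "\<xi> \<le> 1" "0 \<le> y" "y \<le> 1" using p by (auto simp: pe mem_unit_square)
      have "continuous_on {0..1} (\<lambda>s. h s y)"
        by (rule continuous_on_compose2[OF cont, of _ "\<lambda>s. (s, y)", simplified])
          (use b in \<open>auto intro!: continuous_intros simp: mem_unit_square\<close>)
      then obtain s where "0 \<le> s" "s \<le> 1" "h s y = \<xi>"
        using attains_between[of 0 1 "\<lambda>s. h s y" \<xi>] ends b by auto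
      then have "f (s, y) = p" "(s, y) \<in> unit_square" using b by (auto simp: f_def pe mem_unit_square)
      then show "p \<in> f ` unit_square" by (metis imageI)
    qed
  qed
qed

lemma vshear:
  fixes k :: "real \<Rightarrow> real \<Rightarrow> real"
  assumes cont: "continuous_on unit_square (\<lambda>p. k (fst p) (snd p))"
    and mono: "\<And>\<xi> s t. 0 \<le> s \<Longrightarrow> s < t \<Longrightarrow> t \<le> 1 \<Longrightarrow> k \<xi> s < k \<xi> t"
    and ends: "\<And>\<xi>. k \<xi> 0 = 0" "\<And>\<xi>. k \<xi> 1 = 1"
    and f_def: "f = (\<lambda>p. (fst p, k (fst p) (snd p)))"
  shows "continuous_on unit_square f" "inj_on f unit_square" "f ` unit_square = unit_square"
    "f (0,0) = (0,0)" "f (1,0) = (1,0)" "f (0,1) = (0,1)" "f (1,1) = (1,1)"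
proof -
  show "continuous_on unit_square f" unfolding f_def by (intro continuous_intros cont)
  show "f (0,0) = (0,0)" "f (1,0) = (1,0)" "f (0,1) = (0,1)" "f (1,1) = (1,1)"
    by (simp_all add: f_def ends)
  have bd: "0 \<le> k \<xi> s" "k \<xi> s \<le> 1" if "0 \<le> s" "s \<le> 1" for s \<xi>
    using mono[of 0 s \<xi>] mono[of s 1 \<xi>] ends[of \<xi>] that by (cases "s = 0"; cases "s = 1"; force)+
  show "inj_on f unit_square"
  proof (rule inj_onI)
    fix p q assume pq: "p \<in> unit_square" "q \<in> unit_square" "f p = f q"
    then have "fst p = fst q" "k (fst p) (snd p) = k (fst p) (snd q)" by (auto simp: f_def)
    moreover have "0 \<le> snd p" "snd p \<le> 1" "0 \<le> snd q" "snd q \<le> 1" using pq by (auto simp: unit_square_def)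
    ultimately have "\<not> snd p < snd q" "\<not> snd q < snd p"
      using mono[of "snd p" "snd q" "fst p"] mono[of "snd q" "snd p" "fst p"] by auto
    then show "p = q" using \<open>fst p = fst q\<close> by (simp add: prod_eq_iff)
  qed
  show "f ` unit_square = unit_square"
  proof
    show "f ` unit_square \<subseteq> unit_square" using bd by (auto simp: f_def unit_square_def)
    show "unit_square \<subseteq> f ` unit_square"
    proof
      fix p assume p: "p \<in> unit_square"
      obtain \<xi> y where pe: "p = (\<xi>, y)" by fastforce
      have b: "0 \<le> \<xi>" "\<xi> \<le> 1" "0 \<le> y" "y \<le> 1" using p by (auto simp: pe mem_unit_square)
      have "continuous_on {0..1} (\<lambda>s. k \<xi> s)"
        by (rule continuous_on_compose2[OF cont, of _ "\<lambda>s. (\<xi>, s)", simplified])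
          (use b in \<open>auto intro!: continuous_intros simp: mem_unit_square\<close>)
      then obtain s where "0 \<le> s" "s \<le> 1" "k \<xi> s = y"
        using attains_between[of 0 1 "\<lambda>s. k \<xi> s" y] ends b by auto
      then have "f (\<xi>, s) = p" "(\<xi>, s) \<in> unit_square" using b by (auto simp: f_def pe mem_unit_square)
      then show "p \<in> f ` unit_square" by (metis imageI)
    qed
  qed
qed

lemma image_eqI_iff:
  assumes "f ` A = A" "\<And>p. p \<in> A \<Longrightarrow> f p \<in> K' \<longleftrightarrow> p \<in> K" "K \<subseteq> A" "K' \<subseteq> A"
  shows "f ` K = K'"
proof
  show "f ` K \<subseteq> K'" using assms(2,3) by blast
  show "K' \<subseteq> f ` K"
  proof
    fix z assume z: "z \<in> K'"
    then obtain p where p: "p \<in> A" "z = f p" using assms(1,4) by blast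
    then show "z \<in> f ` K" using assms(2)[OF p(1)] z by blast
  qed
qed

text \<open>The inequalities in \<open>clear\<close> are strict and concern finitely many
  coordinates, so there is room to the left of \<open>x\<close>; the midpoint between
  \<open>x\<close> and the largest smaller coordinate is taken.\<close>

lemma gluing_shrink:
  assumes "gluing T x y0 y1 V"
  obtains x3 where "x3 < x" "gluing T x3 y0 y1 V"
proof -
  interpret gluing T x y0 y1 V by fact
  let ?A = "insert 0 {z \<in> coords T. z < x}"
  have fin: "finite ?A" using finite_coords[OF tiling_finite[OF tiling]] by simp
  define m where "m = Max ?A"
  have m: "m < x" "0 \<le> m" using fin x_gt by (auto simp: m_def)
  have ge: "z \<le> m" if "z \<in> coords T" "z < x" for z using that fin by (auto simp: m_def)
  define x3 where "x3 = (m + x) / 2"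
  have x3: "m < x3" "x3 < x" "0 < x3" using m by (auto simp: x3_def)
  have "gluing T x3 y0 y1 V"
  proof
    show "xr t < x3 \<or> xr t = 1 \<and> xl t < x3" if "t \<in> T" "yl t \<le> y1" "y0 \<le> yr t" for t
      using clear[OF that] ge[OF coordsI(1)[OF that(1)]] ge[OF coordsI(2)[OF that(1)]] x3 by auto
  qed (use tiling x3 x_lt y_less lev finV V_sub in auto)
  then show ?thesis using that x3 by blast
qed

lemma gluing_grow:
  assumes "gluing T x y0 y1 V" "x \<le> x2" "x2 < 1"
  shows "gluing T x2 y0 y1 V"
proof -
  interpret gluing T x y0 y1 V by fact
  show ?thesis
  proof
    show "xr t < x2 \<or> xr t = 1 \<and> xl t < x2" if "t \<in> T" "yl t \<le> y1" "y0 \<le> yr t" for t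
      using clear[OF that] assms(2) by auto
  qed (use tiling assms x_gt y_less lev finV V_sub in auto)
qed

lemma gluing_change:
  assumes "gluing T x y0 y1 V" "finite V'" "V' \<subseteq> {y0<..<y1}"
  shows "gluing T x y0 y1 V'"
proof -
  interpret gluing T x y0 y1 V by fact
  show ?thesis by unfold_locales (use tiling x_gt x_lt y_less lev clear assms in auto)
qed

text \<open>A horizontal shear that takes \<open>x\<close> to \<open>x2\<close> at the heights of
  the block, fades out in the margin above and below, and is the identity near the right side. It
  changes no heights, so only vertical segments need care.\<close>

lemma gluing_move_x:
  assumes g1: "gluing T x y0 y1 V" and x2: "x < x2" "x2 < 1"
  shows "teq (glue x y0 y1 V T) (glue x2 y0 y1 V T)"
proof -
  interpret A: gluing T x y0 y1 V by fact
  interpret B: gluing T x2 y0 y1 V by (rule gluing_grow[OF g1]) (use x2 in auto)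
  obtain x3 where x3: "x3 < x" and g3: "gluing T x3 y0 y1 V" by (rule gluing_shrink[OF g1])
  interpret W: gluing T x3 y0 y1 V by (rule g3)
  obtain e where e: "e > 0"
    "\<And>p q. x3 \<le> p \<Longrightarrow> p < 1 \<Longrightarrow> y1 < q \<and> q < y1 + e \<or> y0 - e < q \<and> q < y0 \<Longrightarrow> (p, q) \<notin> skeleton T"
    using W.margin by blast
  define x4 where "x4 = (x2 + 1) / 2"
  have x4: "x2 < x4" "x4 < 1" using x2 by (auto simp: x4_def)
  \<comment> \<open>Slopes of the tent \<open>\<beta>\<close>, which rises from 0 at
    \<open>x3\<close> to \<open>x2 - x\<close> at \<open>x\<close> and falls to 0 at
    \<open>x4\<close>. Since \<open>x4\<close> lies beyond \<open>x2\<close>, the descent has slope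
    \<open>c < 1\<close>, which keeps \<open>h\<close> increasing.\<close>
  define k where "k = (x2 - x) / (x - x3)"
  define c where "c = (x2 - x) / (x4 - x)"
  have k: "0 < k" "k * (x - x3) = x2 - x" using x2 x3 by (auto simp: k_def)
  have c: "0 < c" "c < 1" "c * (x4 - x) = x2 - x" using x2 x4 by (auto simp: c_def)
  define \<beta> where "\<beta> \<xi> = max 0 (min (k * (\<xi> - x3)) (c * (x4 - \<xi>)))" for \<xi>
  \<comment> \<open>Equal to 1 at the heights of the block, with linear descent to 0 across the
    margin.\<close>
  define \<theta> where "\<theta> y = max 0 (1 - max 0 (max (y0 - y) (y - y1)) / e)" for y
  define h where "h \<xi> y = \<xi> + \<theta> y * \<beta> \<xi>" for \<xi> y
  have \<theta>_bounds: "0 \<le> \<theta> y" "\<theta> y \<le> 1" for y using e(1) by (auto simp: \<theta>_def)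
  have \<theta>_one: "\<theta> y = 1" if "y0 \<le> y" "y \<le> y1" for y using that by (simp add: \<theta>_def)
  have \<theta>_zero: "\<theta> y = 0" if "y \<le> y0 - e \<or> y1 + e \<le> y" for y
  proof -
    have "e \<le> max 0 (max (y0 - y) (y - y1))" using that by auto
    then have "1 \<le> max 0 (max (y0 - y) (y - y1)) / e" using e(1) by simp
    then show ?thesis by (simp add: \<theta>_def)
  qed
  have \<beta>_ge: "0 \<le> \<beta> \<xi>" for \<xi> by (simp add: \<beta>_def)
  have \<beta>_left: "\<beta> \<xi> = 0" if "\<xi> \<le> x3" for \<xi>
  proof -
    have "k * (\<xi> - x3) \<le> 0" using k that by (simp add: mult_le_0_iff)
    then show ?thesis by (simp add: \<beta>_def)
  qed
  have \<beta>_right: "\<beta> \<xi> = 0" if "x4 \<le> \<xi>" for \<xi>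
  proof -
    have "c * (x4 - \<xi>) \<le> 0" using c that by (simp add: mult_le_0_iff)
    then show ?thesis by (simp add: \<beta>_def)
  qed
  have \<beta>_x: "\<beta> x = x2 - x" using k c x2 by (simp add: \<beta>_def)
  have \<beta>_slope: "\<beta> s - \<beta> t < t - s" if st: "s < t" for s t
  proof (cases "\<beta> s = 0")
    case True then show ?thesis using \<beta>_ge[of t] st by simp
  next
    case False
    define a a' b b' d where "a = k * (s - x3)" and "a' = k * (t - x3)" and "b = c * (x4 - s)"
      and "b' = c * (x4 - t)" and "d = c * (t - s)"
    have "a \<le> a'" unfolding a_def a'_def using k st by (intro mult_left_mono) auto
    moreover have "b' = b - d" by (simp add: b_def b'_def d_def algebra_simps)
    moreover have "d < 1 * (t - s)" unfolding d_def using c st by (intro mult_strict_right_mono) auto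
    moreover have "0 \<le> d" unfolding d_def using c st by simp
    moreover have "\<beta> s = max 0 (min a b)" "\<beta> t = max 0 (min a' b')"
      by (simp_all add: \<beta>_def a_def a'_def b_def b'_def)
    ultimately show ?thesis using st by (auto simp: max_def min_def split: if_splits)
  qed
  have mono: "h s y < h t y" if st: "s < t" for s t y
  proof -
    have "\<theta> y * (\<beta> s - \<beta> t) < t - s"
    proof (cases "0 \<le> \<beta> s - \<beta> t")
      case True
      then have "\<theta> y * (\<beta> s - \<beta> t) \<le> 1 * (\<beta> s - \<beta> t)" using \<theta>_bounds by (intro mult_right_mono) auto
      then show ?thesis using \<beta>_slope[OF st] by simp
    next
      case False
      then have "\<theta> y * (\<beta> s - \<beta> t) \<le> 0" using \<theta>_bounds by (simp add: mult_le_0_iff)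
      then show ?thesis using st by simp
    qed
    then show ?thesis by (simp add: h_def algebra_simps)
  qed
  have h_ends: "h 0 y = 0" "h 1 y = 1" for y
    using \<beta>_left[of 0] \<beta>_right[of 1] W.x_gt x4 by (auto simp: h_def)
  have h_x3: "h x3 y = x3" for y using \<beta>_left[of x3] by (simp add: h_def)
  have cont: "continuous_on unit_square (\<lambda>p. h (fst p) (snd p))"
    unfolding h_def \<theta>_def \<beta>_def by (intro continuous_intros) (use e(1) in auto)
  define f where "f = (\<lambda>p. (h (fst p) (snd p), snd p))"
  have mono_on: "h s y < h t y" if "0 \<le> s" "s < t" "t \<le> 1" for s t y by (rule mono[OF that(2)])
  note sh = hshear[OF cont mono_on h_ends f_def]
  let ?T1 = "glue x y0 y1 V T" and ?T2 = "glue x2 y0 y1 V T"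
  have sk: "f p \<in> skeleton ?T2 \<longleftrightarrow> p \<in> skeleton ?T1" if "p \<in> unit_square" for p
  proof -
    obtain \<xi> y where pe: "p = (\<xi>, y)" by fastforce
    have b: "0 \<le> \<xi>" "\<xi> \<le> 1" "0 \<le> y" "y \<le> 1" using that by (auto simp: pe mem_unit_square)
    have "(h \<xi> y, y) \<in> skeleton ?T2 \<longleftrightarrow> (\<xi>, y) \<in> skeleton ?T1"
    proof (cases "y0 \<le> y \<and> y \<le> y1")
      case True
      then have y: "y0 \<le> y" "y \<le> y1" by auto
      have hx: "h x y = x2" using \<theta>_one[OF y] \<beta>_x by (simp add: h_def)
      consider "\<xi> \<le> x3" | "x3 < \<xi>" "\<xi> < x" | "x \<le> \<xi>" by linarith
      then show ?thesis
      proof cases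
        case 1
        then have "h \<xi> y = \<xi>" using \<beta>_left by (simp add: h_def)
        then show ?thesis using A.skeleton_glue_outside[of \<xi> y] B.skeleton_glue_outside[of \<xi> y] 1 x3 x2 by simp
      next
        case 2
        have hh: "x3 < h \<xi> y" "h \<xi> y < x2" using mono[OF 2(1), of y] mono[OF 2(2), of y] h_x3 hx by auto
        have "(\<xi>, y) \<in> skeleton ?T1 \<longleftrightarrow> (\<xi>, y) \<in> skeleton T"
          using 2 by (intro A.skeleton_glue_outside) simp
        also have "\<dots> \<longleftrightarrow> y \<in> insert y0 (insert y1 W.U)"
          by (subst W.skeleton_block) (use 2 x2 y in auto)
        also have "\<dots> \<longleftrightarrow> (h \<xi> y, y) \<in> skeleton T"
          by (subst W.skeleton_block) (use hh x2 y in auto)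
        also have "\<dots> \<longleftrightarrow> (h \<xi> y, y) \<in> skeleton ?T2"
          using hh by (intro B.skeleton_glue_outside[symmetric]) simp
        finally show ?thesis ..
      next
        case 3
        have e1: "h \<xi> y = x2 \<longleftrightarrow> \<xi> = x" using mono[of x \<xi> y] hx 3 by (cases "\<xi> = x") auto
        have e2: "h \<xi> y = 1 \<longleftrightarrow> \<xi> = 1" using mono[of \<xi> 1 y] h_ends(2)[of y] b by (cases "\<xi> = 1") auto
        have e3: "x2 \<le> h \<xi> y" using mono[of x \<xi> y] hx 3 by (cases "\<xi> = x") auto
        have e4: "h \<xi> y \<le> 1" using mono[of \<xi> 1 y] h_ends(2)[of y] b by (cases "\<xi> = 1") auto
        show ?thesis unfolding A.skeleton_glue_block[OF 3 b(2) y] B.skeleton_glue_block[OF e3 e4 y] e1 e2 ..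
      qed
    next
      case False
      have "(h \<xi> y, y) \<in> skeleton T \<longleftrightarrow> (\<xi>, y) \<in> skeleton T"
      proof (cases "\<theta> y = 0 \<or> \<beta> \<xi> = 0")
        case True then show ?thesis by (auto simp: h_def)
      next
        case ne: False
        then have "y1 < y \<and> y < y1 + e \<or> y0 - e < y \<and> y < y0" using \<theta>_zero[of y] False by force
        moreover have xi: "x3 < \<xi>" "\<xi> < 1" using ne \<beta>_left[of \<xi>] \<beta>_right[of \<xi>] x4 by force+
        moreover have "x3 < h \<xi> y" "h \<xi> y < 1" using mono[OF xi(1), of y] mono[OF xi(2), of y] h_x3 h_ends by auto
        ultimately show ?thesis using e(2)[of \<xi> y] e(2)[of "h \<xi> y" y] by auto
      qed
      then show ?thesis using A.skeleton_glue_outside[of \<xi> y] B.skeleton_glue_outside[of "h \<xi> y" y] False by auto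
    qed
    then show ?thesis by (simp add: f_def pe)
  qed
  have "eqv f ?T1 ?T2"
  proof (rule eqvI[OF sh])
    show "f ` skeleton ?T1 = skeleton ?T2"
      using image_eqI_iff[OF sh(3) sk] skeleton_subset[OF A.tiling_glue] skeleton_subset[OF B.tiling_glue] by blast
    show "snd (f (a, y)) = snd (f (b, y))" for a b y by (simp add: f_def)
    fix a b p assume ab: "a < b" and s: "\<And>y. a \<le> y \<Longrightarrow> y \<le> b \<Longrightarrow> (p, y) \<in> skeleton ?T1"
    show "fst (f (p, a)) = fst (f (p, b))"
    proof (cases "\<beta> p = 0")
      case True then show ?thesis by (simp add: f_def h_def)
    next
      case False
      then have p: "x3 < p" "p < 1" using \<beta>_left[of p] \<beta>_right[of p] x4 by force+
      have nm: "\<not> (y1 < y \<and> y < y1 + e \<or> y0 - e < y \<and> y < y0)" if "a \<le> y" "y \<le> b" for y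
        using e(2)[of p y] p s[OF that] A.skeleton_glue_outside[of p y] by auto
      \<comment> \<open>A vertical segment where the tent is positive cannot enter the margin, so it
        lies either at the heights of the block, where \<open>\<theta>\<close> is 1, or beyond the
        margin, where it is 0.\<close>
      have "\<theta> a = \<theta> b"
      proof (cases "a \<le> y1 \<and> y0 \<le> b")
        case True
        have "b \<le> y1"
        proof (rule ccontr)
          assume "\<not> b \<le> y1"
          then obtain q where "y1 < q" "q < min b (y1 + e)" using e(1) dense[of y1 "min b (y1 + e)"] by auto
          then show False using nm[of q] True by auto
        qed
        moreover have "y0 \<le> a"
        proof (rule ccontr)
          assume "\<not> y0 \<le> a"
          then obtain q where "max a (y0 - e) < q" "q < y0" using e(1) dense[of "max a (y0 - e)" y0] by auto
          then show False using nm[of q] True by auto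
        qed
        ultimately show ?thesis using \<theta>_one ab by simp
      next
        case False
        then have "\<theta> a = 0 \<and> \<theta> b = 0" using \<theta>_zero[of a] \<theta>_zero[of b] nm[of a] nm[of b] ab by force
        then show ?thesis by simp
      qed
      then show ?thesis by (simp add: f_def h_def)
    qed
  qed
  moreover have "tame f"
  proof (rule tameI[of "1 - x4" f "\<lambda>y. y"])
    show "0 < 1 - x4" "1 - x4 < 1" using x4 x2 A.x_gt by auto
    show "f (\<xi>, y) = (\<xi>, y)" if "1 - (1 - x4) \<le> \<xi>" for \<xi> y
      using \<beta>_right[of \<xi>] that by (simp add: f_def h_def)
  qed
  ultimately show ?thesis unfolding teq_def using A.tiling_glue B.tiling_glue by blast
qed

text \<open>The shear \<open>k\<close> passes from the identity at \<open>x3\<close> to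
  \<open>q\<close> at \<open>x\<close>. In this transition zone the block contains edges only at
  \<open>U\<close> and at its two ends, and all these heights are fixed by \<open>q\<close>.\<close>

lemma gluing_move_V:
  assumes g1: "gluing T x y0 y1 V" and g2: "gluing T x y0 y1 V2"
    and q: "continuous_on UNIV q" "strict_mono q" "\<And>y. y \<le> y0 \<Longrightarrow> q y = y" "\<And>y. y1 \<le> y \<Longrightarrow> q y = y"
    and qU: "\<And>u. u \<in> gluing.U T y0 y1 \<Longrightarrow> q u = u" and qV: "q ` V = V2"
  shows "teq (glue x y0 y1 V T) (glue x y0 y1 V2 T)"
proof -
  interpret A: gluing T x y0 y1 V by fact
  interpret B: gluing T x y0 y1 V2 by fact
  obtain x3 where x3: "x3 < x" and g3: "gluing T x3 y0 y1 V" by (rule gluing_shrink[OF g1])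
  interpret W: gluing T x3 y0 y1 V by (rule g3)
  define \<theta> where "\<theta> \<xi> = max 0 (min 1 ((\<xi> - x3) / (x - x3)))" for \<xi>
  define k where "k \<xi> y = (1 - \<theta> \<xi>) * y + \<theta> \<xi> * q y" for \<xi> y
  have \<theta>_bounds: "0 \<le> \<theta> \<xi>" "\<theta> \<xi> \<le> 1" for \<xi> by (auto simp: \<theta>_def)
  have \<theta>_left: "\<theta> \<xi> = 0" if "\<xi> \<le> x3" for \<xi>
    using that x3 by (simp add: \<theta>_def divide_le_0_iff)
  have \<theta>_right: "\<theta> \<xi> = 1" if "x \<le> \<xi>" for \<xi>
    using that x3 by (simp add: \<theta>_def)
  have q_mono: "s < t \<Longrightarrow> q s < q t" for s t using q(2) by (simp add: strict_mono_def)
  have mono': "k \<xi> s < k \<xi> t" if st: "s < t" for \<xi> s t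
  proof (cases "\<theta> \<xi> = 0")
    case True then show ?thesis using st by (simp add: k_def)
  next
    case False
    then have "\<theta> \<xi> * q s < \<theta> \<xi> * q t" using \<theta>_bounds[of \<xi>] q_mono[OF st] by (intro mult_strict_left_mono) auto
    moreover have "(1 - \<theta> \<xi>) * s \<le> (1 - \<theta> \<xi>) * t" using \<theta>_bounds[of \<xi>] st by (intro mult_left_mono) auto
    ultimately show ?thesis by (simp add: k_def)
  qed
  have k_fix: "k \<xi> y = y" if "q y = y" for \<xi> y using that by (simp add: k_def algebra_simps)
  have k_inj: "k \<xi> s = k \<xi> t \<Longrightarrow> s = t" for \<xi> s t using mono'[of s t \<xi>] mono'[of t s \<xi>] by force
  have k_ends: "k \<xi> 0 = 0" "k \<xi> 1 = 1" for \<xi> using k_fix q(3)[of 0] q(4)[of 1] A.y_bounds by auto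
  have "continuous_on unit_square (\<lambda>p. q (snd p))"
    by (rule continuous_on_compose2[OF q(1)]) (auto intro!: continuous_intros)
  then have cont: "continuous_on unit_square (\<lambda>p. k (fst p) (snd p))"
    unfolding k_def \<theta>_def by (intro continuous_intros) (use x3 in auto)
  define f where "f = (\<lambda>p. (fst p, k (fst p) (snd p)))"
  have mono_on: "k \<xi> s < k \<xi> t" if "0 \<le> s" "s < t" "t \<le> 1" for s t \<xi> by (rule mono'[OF that(2)])
  note sh = vshear[OF cont mono_on k_ends f_def]
  let ?T1 = "glue x y0 y1 V T" and ?T2 = "glue x y0 y1 V2 T"
  have U_eq: "B.U = A.U" "W.U = A.U" by (simp_all add: A.U_def)
  have sk: "f p \<in> skeleton ?T2 \<longleftrightarrow> p \<in> skeleton ?T1" if "p \<in> unit_square" for p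
  proof -
    obtain \<xi> y where pe: "p = (\<xi>, y)" by fastforce
    have b: "0 \<le> \<xi>" "\<xi> \<le> 1" "0 \<le> y" "y \<le> 1" using that by (auto simp: pe mem_unit_square)
    have "(\<xi>, k \<xi> y) \<in> skeleton ?T2 \<longleftrightarrow> (\<xi>, y) \<in> skeleton ?T1"
    proof (cases "y0 \<le> y \<and> y \<le> y1")
      case True
      then have y: "y0 \<le> y" "y \<le> y1" by auto
      have k0: "k \<xi> y0 = y0" "k \<xi> y1 = y1" using k_fix q(3)[of y0] q(4)[of y1] by auto
      have ky: "y0 \<le> k \<xi> y" "k \<xi> y \<le> y1"
        using mono'[of y0 y \<xi>] mono'[of y y1 \<xi>] y k0 by (cases "y = y0"; cases "y = y1"; force)+
      consider "\<xi> \<le> x3" | "x3 < \<xi>" "\<xi> < x" | "x \<le> \<xi>" by linarith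
      then show ?thesis
      proof cases
        case 1
        then have "k \<xi> y = y" using \<theta>_left by (simp add: k_def)
        then show ?thesis using A.skeleton_glue_outside[of \<xi> y] B.skeleton_glue_outside[of \<xi> y] 1 x3 by simp
      next
        case 2
        have kU: "k \<xi> y \<in> insert y0 (insert y1 A.U) \<longleftrightarrow> y \<in> insert y0 (insert y1 A.U)"
        proof -
          have "k \<xi> u = u" if "u \<in> insert y0 (insert y1 A.U)" for u
            using that k0 k_fix qU by auto
          then show ?thesis using k_inj by metis
        qed
        have "(\<xi>, y) \<in> skeleton ?T1 \<longleftrightarrow> (\<xi>, y) \<in> skeleton T"
          using 2 by (intro A.skeleton_glue_outside) simp
        also have "\<dots> \<longleftrightarrow> y \<in> insert y0 (insert y1 A.U)"
          by (subst W.skeleton_block) (use 2 A.x_lt y in auto)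
        also have "\<dots> \<longleftrightarrow> k \<xi> y \<in> insert y0 (insert y1 A.U)" by (rule kU[symmetric])
        also have "\<dots> \<longleftrightarrow> (\<xi>, k \<xi> y) \<in> skeleton T"
          by (subst W.skeleton_block) (use 2 A.x_lt ky in auto)
        also have "\<dots> \<longleftrightarrow> (\<xi>, k \<xi> y) \<in> skeleton ?T2"
          using 2 by (intro B.skeleton_glue_outside[symmetric]) simp
        finally show ?thesis ..
      next
        case 3
        then have kq: "k \<xi> z = q z" for z using \<theta>_right by (simp add: k_def)
        have "q y \<in> B.Z \<longleftrightarrow> y \<in> A.Z"
        proof -
          have "q ` A.Z = B.Z" using qV q(3)[of y0] q(4)[of y1] by (simp add: A.Z_def B.Z_def)
          moreover have "inj q" using q(2) by (rule strict_mono_imp_inj_on)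
          ultimately show ?thesis by (metis inj_image_mem_iff)
        qed
        then show ?thesis using A.skeleton_glue_block[of \<xi> y] B.skeleton_glue_block[of \<xi> "k \<xi> y"] 3 b y ky
          by (simp add: kq)
      qed
    next
      case False
      then have "k \<xi> y = y" using k_fix q(3)[of y] q(4)[of y] by force
      then show ?thesis using A.skeleton_glue_outside[of \<xi> y] B.skeleton_glue_outside[of \<xi> y] False by auto
    qed
    then show ?thesis by (simp add: f_def pe)
  qed
  have "eqv f ?T1 ?T2"
  proof (rule eqvI[OF sh])
    show "f ` skeleton ?T1 = skeleton ?T2"
      using image_eqI_iff[OF sh(3) sk] skeleton_subset[OF A.tiling_glue] skeleton_subset[OF B.tiling_glue] by blast
    show "fst (f (p, a)) = fst (f (p, b))" for a b p by (simp add: f_def)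
    fix a b y assume ab: "a < b" and s: "\<And>\<xi>. a \<le> \<xi> \<Longrightarrow> \<xi> \<le> b \<Longrightarrow> (\<xi>, y) \<in> skeleton ?T1"
    show "snd (f (a, y)) = snd (f (b, y))"
    proof (cases "q y = y")
      case True then show ?thesis using k_fix by (simp add: f_def)
    next
      case False
      then have y: "y0 < y" "y < y1" "y \<notin> A.U" using q(3)[of y] q(4)[of y] qU[of y] by force+
      \<comment> \<open>A horizontal segment at a height moved by \<open>q\<close> cannot enter the
        transition zone.\<close>
      have "b \<le> x3 \<or> x \<le> a"
      proof (rule ccontr)
        assume "\<not> (b \<le> x3 \<or> x \<le> a)"
        then obtain \<xi> where "max a x3 < \<xi>" "\<xi> < min b x" using dense[of "max a x3" "min b x"] ab x3 by auto
        then have xi: "a \<le> \<xi>" "\<xi> \<le> b" "x3 \<le> \<xi>" "\<xi> < x" "\<xi> \<le> 1" "\<xi> \<noteq> 1" using A.x_lt by auto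
        then have "(\<xi>, y) \<in> skeleton T" using s[OF xi(1,2)] A.skeleton_glue_outside[of \<xi> y] by simp
        then have "y \<in> insert y0 (insert y1 A.U)"
          using W.skeleton_block[OF xi(3,5)] y xi(6) by (metis U_eq(2) less_imp_le)
        then show False using y by blast
      qed
      then have "\<theta> a = \<theta> b" using \<theta>_left[of a] \<theta>_left[of b] \<theta>_right[of a] \<theta>_right[of b] ab by auto
      then show ?thesis by (simp add: f_def k_def)
    qed
  qed
  moreover have "tame f"
  proof (rule tameI[of "1 - x" f q])
    show "0 < 1 - x" "1 - x < 1" using A.x_gt A.x_lt by auto
    show "f (\<xi>, y) = (\<xi>, q y)" if "1 - (1 - x) \<le> \<xi>" for \<xi> y
      using \<theta>_right[of \<xi>] that by (simp add: f_def k_def)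
  qed
  ultimately show ?thesis unfolding teq_def using A.tiling_glue B.tiling_glue by blast
qed

text \<open>Going up the left side of a block, \<open>Lt\<close> and \<open>Rt\<close> stand for an edge that ends there from the left
  or from the right only, and \<open>Cr\<close> for a crossing.\<close>

datatype letter = Lt | Rt | Cr

definition pattern :: "real set \<Rightarrow> real set \<Rightarrow> letter list" where
  "pattern U V = map (\<lambda>u. if u \<in> U then if u \<in> V then Cr else Lt else Rt) (sorted_list_of_set (U \<union> V))"

lemma count_pattern:
  assumes "finite U" "finite V"
  shows "count_list (pattern U V) Cr = card (U \<inter> V)"
    "count_list (pattern U V) Lt = card (U - V)" "count_list (pattern U V) Rt = card (V - U)"
proof -
  let ?l = "sorted_list_of_set (U \<union> V)"
  have *: "length (filter P ?l) = card {u \<in> U \<union> V. P u}" for P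
    using assms distinct_length_filter[of ?l P] by (simp add: Int_def conj_commute)
  have "{u \<in> U \<union> V. u \<in> U \<and> u \<in> V} = U \<inter> V" "{u \<in> U \<union> V. u \<in> U \<and> u \<notin> V} = U - V"
    "{u \<in> U \<union> V. u \<notin> U} = V - U" by auto
  moreover define g where "g u = (if u \<in> U then if u \<in> V then Cr else Lt else Rt)" for u
  have letter: "(\<lambda>u. Cr = g u) = (\<lambda>u. u \<in> U \<and> u \<in> V)" "(\<lambda>u. Lt = g u) = (\<lambda>u. u \<in> U \<and> u \<notin> V)"
    "(\<lambda>u. Rt = g u) = (\<lambda>u. u \<notin> U)"
    by (auto simp: g_def fun_eq_iff)
  have pat: "pattern U V = map g ?l" by (simp add: pattern_def g_def)
  ultimately show "count_list (pattern U V) Cr = card (U \<inter> V)"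
    "count_list (pattern U V) Lt = card (U - V)" "count_list (pattern U V) Rt = card (V - U)"
    using *[of "\<lambda>u. u \<in> U \<and> u \<in> V"] *[of "\<lambda>u. u \<in> U \<and> u \<notin> V"] *[of "\<lambda>u. u \<notin> U"] letter
    by (simp_all only: pat count_list_eq_length_filter filter_map o_def length_map)
qed

lemma card_left_pattern:
  assumes "finite U" "finite V"
  shows "count_list (pattern U V) Lt + count_list (pattern U V) Cr = card U"
proof -
  have "card (U - V) + card (U \<inter> V) = card U"
    using assms by (subst card_Un_disjoint[symmetric]) (auto intro!: arg_cong[where f = card])
  then show ?thesis by (simp add: count_pattern assms)
qed

lemma card_right_pattern:
  assumes "finite U" "finite V"
  shows "count_list (pattern U V) Rt + count_list (pattern U V) Cr = card V"
proof -
  have "card (V - U) + card (U \<inter> V) = card V"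
    using assms by (subst card_Un_disjoint[symmetric]) (auto intro!: arg_cong[where f = card])
  then show ?thesis by (simp add: count_pattern assms)
qed

section \<open>Matching finite sets of heights by increasing maps\<close>

lemma sorted_list_of_set_strict_mono_image:
  fixes v :: "real \<Rightarrow> real"
  assumes "finite A" "\<And>s t. s \<in> A \<Longrightarrow> t \<in> A \<Longrightarrow> s < t \<Longrightarrow> v s < v t"
  shows "sorted_list_of_set (v ` A) = map v (sorted_list_of_set A)"
proof (rule sorted_distinct_set_unique)
  let ?l = "sorted_list_of_set A"
  have "sorted_wrt (<) (map v ?l)"
    unfolding sorted_wrt_map
    by (rule sorted_wrt_mono_rel[OF _ strict_sorted_list_of_set]) (use assms in auto)
  then show "sorted (map v ?l)" "distinct (map v ?l)"
    using strict_sorted_iff by blast+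
qed (use assms in auto)

lemma pattern_image:
  assumes "finite U" "finite V" "\<And>s t. s \<in> U \<union> V \<Longrightarrow> t \<in> U \<union> V \<Longrightarrow> s < t \<Longrightarrow> v s < v t"
  shows "pattern (v ` U) (v ` V) = pattern U V"
proof -
  have inj: "inj_on v (U \<union> V)"
  proof (rule inj_onI)
    fix s t assume "s \<in> U \<union> V" "t \<in> U \<union> V" "v s = v t"
    then show "s = t" using assms(3)[of s t] assms(3)[of t s] by (metis less_irrefl linorder_neqE_linordered_idom)
  qed
  have "sorted_list_of_set (v ` U \<union> v ` V) = map v (sorted_list_of_set (U \<union> V))"
    using sorted_list_of_set_strict_mono_image[of "U \<union> V" v] assms by (simp add: image_Un)
  moreover have "v u \<in> v ` U \<longleftrightarrow> u \<in> U" "v u \<in> v ` V \<longleftrightarrow> u \<in> V" if "u \<in> U \<union> V" for u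
    using inj that by (auto simp: inj_on_def)
  ultimately show ?thesis using assms(1,2) by (simp add: pattern_def)
qed

text \<open>An increasing map sends the sorted list of \<open>U\<close> to the sorted list of its
  image, which is the same list.\<close>

lemma strict_mono_finite_fixed:
  fixes q :: "real \<Rightarrow> real"
  assumes "finite U" "strict_mono q" "q ` U = U" "u \<in> U"
  shows "q u = u"
proof -
  have "map q (sorted_list_of_set U) = sorted_list_of_set U"
    using sorted_list_of_set_strict_mono_image[OF assms(1), of q] assms(2,3) by (simp add: strict_mono_def)
  then show ?thesis using assms(1,4) by (metis map_eq_conv map_ident set_sorted_list_of_set)
qed

text \<open>A piecewise linear map through the given points, continued by translations beyond both
  ends. When the end points agree on both sides these translations are the identity, so a map built
  for one block leaves the rest of the right side fixed.\<close>

lemma strict_mono_extend: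
  fixes as bs :: "real list"
  assumes "as \<noteq> []" "length as = length bs" "sorted_wrt (<) as" "sorted_wrt (<) bs"
  shows "\<exists>q. continuous_on UNIV q \<and> strict_mono q \<and> map q as = bs \<and>
     (\<forall>y\<le>hd as. q y = y - hd as + hd bs) \<and> (\<forall>y\<ge>last as. q y = y - last as + last bs)"
  using assms
proof (induction as arbitrary: bs)
  case (Cons a as)
  obtain b bs' where bs: "bs = b # bs'" "length as = length bs'" using Cons.prems(2) by (cases bs) auto
  show ?case
  proof (cases "as = []")
    case True
    then show ?thesis using bs
      by (intro exI[of _ "\<lambda>y. y - a + b"]) (auto intro!: continuous_intros simp: strict_mono_def)
  next
    case False
    then have ne: "bs' \<noteq> []" using bs by auto
    obtain q where q: "continuous_on UNIV q" "strict_mono q" "map q as = bs'"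
      "\<And>y. y \<ge> last as \<Longrightarrow> q y = y - last as + last bs'"
      using Cons.IH[OF False bs(2)] Cons.prems(3,4) bs by auto
    define a' where "a' = hd as"
    define b' where "b' = hd bs'"
    have ab: "a < a'" "b < b'" "q a' = b'"
      using Cons.prems(3,4) False ne q(3) by (cases as; cases bs'; auto simp: a'_def b'_def bs)+
    define m where "m = (b' - b) / (a' - a)"
    have m: "0 < m" "m * (a - a') = b - b'" using ab by (auto simp: m_def field_simps)
    \<comment> \<open>Three clamped pieces: slope 1 up to \<open>a\<close>, slope \<open>m\<close>
      between \<open>a\<close> and \<open>a'\<close>, and \<open>q\<close> beyond \<open>a'\<close>.
      Each summand is nondecreasing, and at every height one of them increases.\<close>
    define Q where "Q y = q (max y a') + m * (min (max y a) a' - a') + (min y a - a)" for y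
    have Q_ge: "Q y = q y" if "a' \<le> y" for y using that ab by (simp add: Q_def)
    have Q_le: "Q y = y - a + b" if "y \<le> a" for y using that ab m by (simp add: Q_def)
    have ge: "a' \<le> z" if "z \<in> set as" for z
      using that Cons.prems(3) by (cases as) (auto simp: a'_def)
    have "continuous_on UNIV (\<lambda>y. q (max y a'))"
      by (rule continuous_on_compose2[OF q(1)]) (auto intro!: continuous_intros)
    then have "continuous_on UNIV Q" unfolding Q_def by (intro continuous_intros)
    moreover have "strict_mono Q"
    proof (rule strict_monoI)
      fix s t :: real assume st: "s < t"
      have q_le: "q (max s a') \<le> q (max t a')"
        using st by (intro monoD[OF strict_mono_mono[OF q(2)]]) auto
      have m_le: "m * (min (max s a) a' - a') \<le> m * (min (max t a) a' - a')"
        using m st by (intro mult_left_mono) auto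
      consider "a' < t" | "a < t" "t \<le> a'" | "t \<le> a" by linarith
      then show "Q s < Q t"
      proof cases
        case 1
        then have "q (max s a') < q (max t a')" using st by (intro strict_monoD[OF q(2)]) auto
        then show ?thesis using m_le st unfolding Q_def by linarith
      next
        case 2
        then have "m * (min (max s a) a' - a') < m * (min (max t a) a' - a')"
          using m st by (intro mult_strict_left_mono) auto
        then show ?thesis using q_le st unfolding Q_def by linarith
      next
        case 3
        then have "min s a - a < min t a - a" using st by auto
        then show ?thesis using q_le m_le unfolding Q_def by linarith
      qed
    qed
    moreover have "map Q as = map q as" using Q_ge ge by auto
    then have "map Q (a # as) = bs" using Q_le[of a] q(3) bs by simp
    moreover have "last as \<in> set as" using False by simp
    then have "a' \<le> last as" by (rule ge)
    then have "\<forall>y\<ge>last (a # as). Q y = y - last (a # as) + last bs"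
      using Q_ge q(4) False ne bs by auto
    ultimately show ?thesis using Q_le bs by (intro exI[of _ Q]) auto
  qed
qed simp

text \<open>Equal patterns have equal length, so the two sorted lists of heights can be matched in
  order; the letters say which heights belong to which set, so the matching respects both
  sets.\<close>

lemma pattern_extend:
  assumes fin: "finite U" "finite V" "finite U'" "finite V'"
    and y: "y0 < y1" "y0' < y1'"
    and sub: "U \<union> V \<subseteq> {y0<..<y1}" "U' \<union> V' \<subseteq> {y0'<..<y1'}"
    and eq: "pattern U V = pattern U' V'"
  obtains q where "continuous_on UNIV q" "strict_mono q" "q ` U = U'" "q ` V = V'"
    "\<And>y. y \<le> y0 \<Longrightarrow> q y = y - y0 + y0'" "\<And>y. y1 \<le> y \<Longrightarrow> q y = y - y1 + y1'"
proof -
  let ?l = "sorted_list_of_set (U \<union> V)" and ?l' = "sorted_list_of_set (U' \<union> V')"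
  have len: "length ?l = length ?l'" using arg_cong[OF eq, of length] by (simp add: pattern_def)
  have set: "set ?l = U \<union> V" "set ?l' = U' \<union> V'" using fin by auto
  have s: "sorted_wrt (<) (y0 # ?l @ [y1])" "sorted_wrt (<) (y0' # ?l' @ [y1'])"
    using set sub y by (auto simp: sorted_wrt_append)
  obtain q where q: "continuous_on UNIV q" "strict_mono q" "map q (y0 # ?l @ [y1]) = y0' # ?l' @ [y1']"
    "\<And>y. y \<le> y0 \<Longrightarrow> q y = y - y0 + y0'" "\<And>y. y1 \<le> y \<Longrightarrow> q y = y - y1 + y1'"
    using strict_mono_extend[OF _ _ s] len by auto
  have ql: "map q ?l = ?l'" using q(3) by simp
  have img: "q ` (U \<union> V) = U' \<union> V'" using arg_cong[OF ql, of set] set by simp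
  have "map (\<lambda>u. if u \<in> U then if u \<in> V then Cr else Lt else Rt) ?l =
      map (\<lambda>u. if q u \<in> U' then if q u \<in> V' then Cr else Lt else Rt) ?l"
    using eq unfolding pattern_def ql[symmetric] by (simp add: o_def)
  then have lt: "(if u \<in> U then if u \<in> V then Cr else Lt else Rt) =
      (if q u \<in> U' then if q u \<in> V' then Cr else Lt else Rt)" if "u \<in> U \<union> V" for u
    using that set(1) by (auto dest!: map_eq_conv[THEN iffD1])
  have mem: "q u \<in> U' \<longleftrightarrow> u \<in> U" "q u \<in> V' \<longleftrightarrow> u \<in> V" if "u \<in> U \<union> V" for u
    using lt[OF that] that img by (auto split: if_splits)
  have "q ` U = U'" "q ` V = V'"
  proof -
    have im: "q u \<in> U' \<union> V'" if "u \<in> U \<union> V" for u using img that by blast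
    show "q ` U = U'"
    proof
      show "q ` U \<subseteq> U'" using mem(1) by blast
      show "U' \<subseteq> q ` U"
      proof
        fix z assume z: "z \<in> U'"
        then have "z \<in> q ` (U \<union> V)" by (simp add: img)
        then obtain u where u: "u \<in> U \<union> V" "z = q u" by (rule imageE)
        then show "z \<in> q ` U" using mem(1)[OF u(1)] z by simp
      qed
    qed
    show "q ` V = V'"
    proof
      show "q ` V \<subseteq> V'" using mem(2) by blast
      show "V' \<subseteq> q ` V"
      proof
        fix z assume z: "z \<in> V'"
        then have "z \<in> q ` (U \<union> V)" by (simp add: img)
        then obtain u where u: "u \<in> U \<union> V" "z = q u" by (rule imageE)
        then show "z \<in> q ` V" using mem(2)[OF u(1)] z by simp
      qed
    qed
  qed
  then show ?thesis using that q by blast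
qed

section \<open>Ranks of levels, and gluing along an equivalence\<close>

definition level_index :: "tile set \<Rightarrow> real \<Rightarrow> nat" where
  "level_index T y = card {h \<in> levels T. h < y}"

lemma level_index_strict_mono:
  assumes "is_tiling T" "y \<in> levels T" "y < z"
  shows "level_index T y < level_index T z"
  unfolding level_index_def
  by (rule psubset_card_mono) (use assms finite_levels[OF assms(1)] in auto)

lemma level_index_inj:
  assumes "is_tiling T" "y \<in> levels T" "z \<in> levels T" "level_index T y = level_index T z"
  shows "y = z"
  using level_index_strict_mono[OF assms(1,2), of z] level_index_strict_mono[OF assms(1,3), of y] assms(4)
  by (cases y z rule: linorder_cases) auto

lemma (in gluing) level_index_y1: "level_index T y1 = level_index T y0 + 1 + card U"
proof -
  have "{h \<in> levels T. h < y1} = {h \<in> levels T. h < y0} \<union> insert y0 U"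
    using lev y_less y_bounds by (auto simp: U_def levels_def)
  moreover have "{h \<in> levels T. h < y0} \<inter> insert y0 U = {}" by (auto simp: U_def)
  moreover have "y0 \<notin> U" by (simp add: U_def)
  ultimately show ?thesis unfolding level_index_def
    using finite_levels[OF tiling] finU by (simp add: card_Un_disjoint)
qed

lemma (in tequiv_inv) level_index_image:
  assumes "0 \<le> y" "y \<le> 1"
  shows "level_index T' (\<gamma> y) = level_index T y"
proof -
  have "{h \<in> levels T'. h < \<gamma> y} = \<gamma> ` {h \<in> levels T. h < y}"
    unfolding levels_image[symmetric] using \<gamma>_less_iff assms levels_bounds by force
  moreover have "inj_on \<gamma> {h \<in> levels T. h < y}"
    by (rule inj_on_subset[OF \<gamma>_inj_on]) (use levels_bounds in auto)
  ultimately show ?thesis by (simp add: level_index_def card_image)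
qed

text \<open>In the zone where \<open>f\<close> is a product it sends the line at
  \<open>1 - s0 * \<delta>\<close> to the line at \<open>1 - s0 * \<delta>'\<close>, so
  \<open>f\<close> itself carries the new left side and the new edges to their counterparts.\<close>

lemma (in tequiv_inv) glue_tame:
  assumes d: "0 < \<delta>" "\<delta> < 1" "0 < \<delta>'" "\<delta>' < 1"
    and fs: "\<And>s y. 0 \<le> s \<Longrightarrow> s \<le> 1 \<Longrightarrow> 0 \<le> y \<Longrightarrow> y \<le> 1 \<Longrightarrow> f (1 - s * \<delta>, y) = (1 - s * \<delta>', \<gamma> y)"
    and s0: "0 < s0" "s0 \<le> 1"
    and g1: "gluing T x y0 y1 V" "x < 1 - s0 * \<delta>"
    and g2: "gluing T' (1 - s0 * \<delta>') (\<gamma> y0) (\<gamma> y1) (\<gamma> ` V)"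
  shows "teq (glue (1 - s0 * \<delta>) y0 y1 V T) (glue (1 - s0 * \<delta>') (\<gamma> y0) (\<gamma> y1) (\<gamma> ` V) T')"
proof -
  define x2 where "x2 = 1 - s0 * \<delta>"
  define x2' where "x2' = 1 - s0 * \<delta>'"
  have x2: "x2 < 1" "x < x2" using d s0 g1 by (auto simp: x2_def)
  interpret W: gluing T x y0 y1 V by (rule g1)
  interpret A: gluing T x2 y0 y1 V by (rule gluing_grow[OF g1(1)]) (use x2 in auto)
  interpret B: gluing T' x2' "\<gamma> y0" "\<gamma> y1" "\<gamma> ` V" using g2 by (simp add: x2'_def)
  let ?T1 = "glue x2 y0 y1 V T" and ?T2 = "glue x2' (\<gamma> y0) (\<gamma> y1) (\<gamma> ` V) T'"
  define \<phi> where "\<phi> \<xi> = 1 - (1 - \<xi>) / \<delta> * \<delta>'" for \<xi>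
  have f_near: "f (\<xi>, y) = (\<phi> \<xi>, \<gamma> y)" if "x2 \<le> \<xi>" "\<xi> \<le> 1" "0 \<le> y" "y \<le> 1" for \<xi> y
  proof -
    have "s0 * \<delta> \<le> \<delta>" using s0 d by (simp add: mult_le_cancel_right1)
    then have "1 - \<xi> \<le> \<delta>" using that(1) by (simp add: x2_def)
    then have "(1 - \<xi>) / \<delta> \<le> 1" "0 \<le> (1 - \<xi>) / \<delta>" using that d by (auto simp: divide_le_eq)
    then show ?thesis using fs[of "(1 - \<xi>) / \<delta>" y] that d by (simp add: \<phi>_def)
  qed
  have \<phi>_mono: "\<phi> s < \<phi> t" if "s < t" for s t
    using that d by (simp add: \<phi>_def divide_strict_right_mono)
  have \<phi>_ends: "\<phi> x2 = x2'" "\<phi> 1 = 1" using d by (auto simp: \<phi>_def x2_def x2'_def)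
  have \<phi>_inj: "\<phi> s = \<phi> t \<longleftrightarrow> s = t" for s t using \<phi>_mono[of s t] \<phi>_mono[of t s] by force
  have \<phi>_le: "\<phi> s \<le> \<phi> t \<longleftrightarrow> s \<le> t" for s t using \<phi>_mono[of s t] \<phi>_mono[of t s] by force
  have Zb: "z \<in> A.Z \<Longrightarrow> 0 \<le> z \<and> z \<le> 1" for z using A.Z_bounds[of z] A.y_bounds by auto
  have Z_img: "\<gamma> ` A.Z = B.Z" by (simp add: A.Z_def B.Z_def)
  have block_iff: "f p \<in> block x2' (\<gamma> y0) (\<gamma> y1) \<longleftrightarrow> p \<in> block x2 y0 y1" if p: "p \<in> unit_square" for p
  proof
    assume "p \<in> block x2 y0 y1"
    then show "f p \<in> block x2' (\<gamma> y0) (\<gamma> y1)"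
      using f_near[of "fst p" "snd p"] \<phi>_le[of x2 "fst p"] \<phi>_le[of "fst p" 1] \<phi>_ends A.y_bounds
        \<gamma>_mono[of y0 "snd p"] \<gamma>_mono[of "snd p" y1] by (cases p) auto
  next
    assume a: "f p \<in> block x2' (\<gamma> y0) (\<gamma> y1)"
    obtain \<xi>' y' where fp: "f p = (\<xi>', y')" by fastforce
    have r: "x2' \<le> \<xi>'" "\<xi>' \<le> 1" "\<gamma> y0 \<le> y'" "y' \<le> \<gamma> y1" using a fp by auto
    have y': "0 \<le> y'" "y' \<le> 1" using r B.y_bounds by auto
    define \<xi> where "\<xi> = 1 - (1 - \<xi>') / \<delta>' * \<delta>"
    have \<xi>: "\<phi> \<xi> = \<xi>'" using d by (simp add: \<phi>_def \<xi>_def)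
    have xb: "x2 \<le> \<xi>" "\<xi> \<le> 1" using \<xi> r \<phi>_le[of x2 \<xi>] \<phi>_le[of \<xi> 1] \<phi>_ends by auto
    have yb: "y0 \<le> inv.\<gamma> y'" "inv.\<gamma> y' \<le> y1"
      using inv.\<gamma>_mono[of "\<gamma> y0" y'] inv.\<gamma>_mono[of y' "\<gamma> y1"] r y' B.y_bounds A.y_bounds A.y_less inv_\<gamma>[of y0] inv_\<gamma>[of y1] by auto
    have "f (\<xi>, inv.\<gamma> y') = f p"
      using f_near[OF xb, of "inv.\<gamma> y'"] yb A.y_bounds \<xi> \<gamma>_inv[OF y'] fp by simp
    then have "(\<xi>, inv.\<gamma> y') = p"
      by (rule f_inj[rotated 2]) (use p xb yb A.y_bounds A.x_gt in \<open>auto simp: mem_unit_square\<close>)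
    then show "p \<in> block x2 y0 y1" using xb yb by auto
  qed
  have out1: "p \<in> skeleton ?T1 \<longleftrightarrow> p \<in> skeleton T" if "p \<in> unit_square" "p \<notin> block x2 y0 y1" for p
    using A.skeleton_glue_outside[of "fst p" "snd p"] that by (cases p) (auto simp: mem_unit_square)
  have out2: "p \<in> skeleton ?T2 \<longleftrightarrow> p \<in> skeleton T'" if "p \<in> unit_square" "p \<notin> block x2' (\<gamma> y0) (\<gamma> y1)" for p
    using B.skeleton_glue_outside[of "fst p" "snd p"] that by (cases p) (auto simp: mem_unit_square)
  have skT: "f p \<in> skeleton T' \<longleftrightarrow> p \<in> skeleton T" if "p \<in> unit_square" for p
  proof
    assume "f p \<in> skeleton T'"
    then have "f p \<in> f ` skeleton T" by (simp only: F(8))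
    then obtain r where r: "r \<in> skeleton T" "f p = f r" by (rule imageE)
    then have "p = r" using f_inj[OF that] skeleton_subset[OF T] by blast
    then show "p \<in> skeleton T" using r by simp
  qed (rule eqv_skeleton[OF f])
  have sk: "f p \<in> skeleton ?T2 \<longleftrightarrow> p \<in> skeleton ?T1" if p: "p \<in> unit_square" for p
  proof (cases "p \<in> block x2 y0 y1")
    case True
    obtain \<xi> y where pe: "p = (\<xi>, y)" by fastforce
    have r: "x2 \<le> \<xi>" "\<xi> \<le> 1" "y0 \<le> y" "y \<le> y1" using True by (auto simp: pe)
    have y: "0 \<le> y" "y \<le> 1" using r A.y_bounds by auto
    have fp: "f p = (\<phi> \<xi>, \<gamma> y)" using f_near[OF r(1,2) y] pe by simp
    have r': "x2' \<le> \<phi> \<xi>" "\<phi> \<xi> \<le> 1" "\<gamma> y0 \<le> \<gamma> y" "\<gamma> y \<le> \<gamma> y1"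
      using True block_iff[OF p] fp by auto
    have "\<gamma> y \<in> B.Z \<longleftrightarrow> y \<in> A.Z"
    proof -
      have "A.Z \<subseteq> {0..1}" using Zb by auto
      moreover have "y \<in> {0..1}" using y by simp
      ultimately show ?thesis unfolding Z_img[symmetric] using inj_on_image_mem_iff[OF \<gamma>_inj_on] by blast
    qed
    moreover have "\<phi> \<xi> = x2' \<longleftrightarrow> \<xi> = x2" "\<phi> \<xi> = 1 \<longleftrightarrow> \<xi> = 1"
      using \<phi>_inj[of \<xi> x2] \<phi>_inj[of \<xi> 1] \<phi>_ends by auto
    ultimately show ?thesis unfolding fp unfolding pe A.skeleton_glue_block[OF r] B.skeleton_glue_block[OF r'] by blast
  next
    case False
    have "f p \<notin> block x2' (\<gamma> y0) (\<gamma> y1)" using block_iff[OF p] False by metis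
    then show ?thesis using out1[OF p False] out2[OF f_mem[OF p]] skT[OF p] by metis
  qed
  have "eqv f ?T1 ?T2"
  proof (rule eqvI[OF F(1-7)])
    show "f ` skeleton ?T1 = skeleton ?T2"
      using image_eqI_iff[OF F(3) sk] skeleton_subset[OF A.tiling_glue] skeleton_subset[OF B.tiling_glue] by blast
  next
    fix a b y assume ab: "a < b" and s: "\<And>\<xi>. a \<le> \<xi> \<Longrightarrow> \<xi> \<le> b \<Longrightarrow> (\<xi>, y) \<in> skeleton ?T1"
    have u: "(\<xi>, y) \<in> unit_square" if "a \<le> \<xi>" "\<xi> \<le> b" for \<xi>
      using s[OF that] skeleton_subset[OF A.tiling_glue] by blast
    have bb: "0 \<le> a" "b \<le> 1" "0 \<le> y" "y \<le> 1" using u[of a] u[of b] ab by (auto simp: mem_unit_square)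
    have sT: "(\<xi>, y) \<in> skeleton T" if "a \<le> \<xi>" "\<xi> \<le> b" "(\<xi>, y) \<notin> block x2 y0 y1" for \<xi>
      using out1[OF u[OF that(1,2)] that(3)] s[OF that(1,2)] by blast
    show "snd (f (a, y)) = snd (f (b, y))"
    proof (cases "y0 \<le> y \<and> y \<le> y1 \<and> x2 \<le> b")
      case False
      then show ?thesis using ab by (intro eqv_horizontal[OF f] sT) auto
    next
      case True
      then have y: "y0 \<le> y" "y \<le> y1" and xb: "x2 \<le> b" by auto
      have fb: "snd (f (b, y)) = \<gamma> y" using f_near[of b y] xb bb by simp
      show ?thesis
      proof (cases "x2 \<le> a")
        case True
        then show ?thesis using f_near[of a y] fb ab bb by simp
      next
        case False
        \<comment> \<open>Just left of the new side the glued skeleton is still that of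
          \<open>T\<close>, whose edges between \<open>x\<close> and the right side run on to the
          right side. So the segment arrives at a height where \<open>T\<close> has an edge up to
          \<open>x2\<close>.\<close>
        obtain \<xi> where xi: "max a x < \<xi>" "\<xi> < x2" using dense[of "max a x" x2] False x2 by auto
        have "(\<xi>, y) \<in> skeleton T" using xi xb by (intro sT) auto
        then have "y \<in> insert y0 (insert y1 W.U)" using W.skeleton_block[of \<xi> y] xi x2 y by auto
        then have "(x2, y) \<in> skeleton T" using W.skeleton_block[of x2 y] x2 y by auto
        then have "(\<xi>, y) \<in> skeleton T" if "a \<le> \<xi>" "\<xi> \<le> x2" for \<xi>
          using sT[of \<xi>] that xb by (cases "\<xi> = x2") auto
        then have "snd (f (a, y)) = snd (f (x2, y))" by (intro eqv_horizontal[OF f]) (use False in auto)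
        then show ?thesis using f_near[of x2 y] x2 bb fb by simp
      qed
    qed
  next
    fix a b p assume ab: "a < b" and s: "\<And>y. a \<le> y \<Longrightarrow> y \<le> b \<Longrightarrow> (p, y) \<in> skeleton ?T1"
    have u: "(p, y) \<in> unit_square" if "a \<le> y" "y \<le> b" for y
      using s[OF that] skeleton_subset[OF A.tiling_glue] by blast
    have bb: "0 \<le> a" "b \<le> 1" "0 \<le> p" "p \<le> 1" using u[of a] u[of b] ab by (auto simp: mem_unit_square)
    show "fst (f (p, a)) = fst (f (p, b))"
    proof (cases "x2 \<le> p")
      case True then show ?thesis using f_near[of p a] f_near[of p b] ab bb by simp
    next
      case False
      then have "(p, y) \<in> skeleton T" if "a \<le> y" "y \<le> b" for y
        using out1[OF u[OF that]] s[OF that] by auto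
      then show ?thesis using ab by (intro eqv_vertical[OF f]) auto
    qed
  qed
  moreover have "tame f" unfolding tame_def using d fs by blast
  ultimately show ?thesis unfolding teq_def using A.tiling_glue B.tiling_glue by (auto simp: x2_def x2'_def)
qed

text \<open>A chain of four tame equivalences: move the new heights so that \<open>\<gamma>\<close>
  takes them to \<open>V'\<close>, push the left side into the product zone of \<open>f\<close>,
  apply \<open>f\<close>, and bring the left side back to \<open>x'\<close>. The rank fixes the
  lower end of the block, the pattern the number of old levels inside it and hence the upper
  end.\<close>

lemma glue_teq:
  assumes g1: "gluing T x y0 y1 V" and g2: "gluing T' x' y0' y1' V'" and tt: "teq T T'"
    and idx: "level_index T y0 = level_index T' y0'"
    and pat: "pattern (gluing.U T y0 y1) V = pattern (gluing.U T' y0' y1') V'"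
  shows "teq (glue x y0 y1 V T) (glue x' y0' y1' V' T')"
proof -
  interpret A: gluing T x y0 y1 V by (rule g1)
  interpret B: gluing T' x' y0' y1' V' by (rule g2)
  obtain f where "eqv f T T'" and "tame f" using tt by (auto simp: teq_def)
  then obtain \<delta> \<delta>' g where d: "0 < \<delta>" "\<delta> < 1" "0 < \<delta>'" "\<delta>' < 1"
    and fs: "\<And>s y. 0 \<le> s \<Longrightarrow> s \<le> 1 \<Longrightarrow> 0 \<le> y \<Longrightarrow> y \<le> 1 \<Longrightarrow> f (1 - s * \<delta>, y) = (1 - s * \<delta>', g y)"
    unfolding tame_def by blast
  interpret E: tequiv_inv f T T' by (rule tequiv_invI[OF A.tiling B.tiling \<open>eqv f T T'\<close>])
  have g: "g y = E.\<gamma> y" if "0 \<le> y" "y \<le> 1" for y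
    using fs[of 0 y] E.f_right[of y] that by simp
  have y0: "E.\<gamma> y0 = y0'"
  proof (rule level_index_inj[OF B.tiling _ B.lev(1)])
    show "E.\<gamma> y0 \<in> levels T'" using E.levels_image A.lev(1) by blast
    show "level_index T' (E.\<gamma> y0) = level_index T' y0'" using E.level_index_image[of y0] idx A.y_bounds by simp
  qed
  have "card A.U = card B.U"
    using card_left_pattern[OF A.finU A.finV] card_left_pattern[OF B.finU B.finV] pat by simp
  then have idx1: "level_index T y1 = level_index T' y1'" using A.level_index_y1 B.level_index_y1 idx by simp
  have y1: "E.\<gamma> y1 = y1'"
  proof (rule level_index_inj[OF B.tiling _ B.lev(2)])
    show "E.\<gamma> y1 \<in> levels T'" using E.levels_image A.lev(2) by blast
    show "level_index T' (E.\<gamma> y1) = level_index T' y1'" using E.level_index_image[of y1] idx1 A.y_bounds by simp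
  qed
  have less: "E.\<gamma> s < E.\<gamma> t \<longleftrightarrow> s < t" if "0 \<le> s" "s \<le> 1" "0 \<le> t" "t \<le> 1" for s t
    by (rule E.\<gamma>_less_iff[OF that])
  have U_img: "E.\<gamma> ` A.U = B.U"
  proof -
    have "E.\<gamma> ` A.U = E.\<gamma> ` right_hits T \<inter> {y0'<..<y1'}"
      using less[of y0] less[of _ y1] A.y_bounds A.y_less right_hits_bounds
      by (force simp: A.U_def y0[symmetric] y1[symmetric])
    then show ?thesis by (simp add: E.right_hits_image B.U_def)
  qed
  have inv_b: "y0 < E.inv.\<gamma> v \<and> E.inv.\<gamma> v < y1 \<and> E.\<gamma> (E.inv.\<gamma> v) = v" if "v \<in> V'" for v
  proof -
    have v: "y0' < v" "v < y1'" using that B.V_sub by auto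
    then have "E.inv.\<gamma> y0' < E.inv.\<gamma> v" "E.inv.\<gamma> v < E.inv.\<gamma> y1'"
      using B.y_bounds by (auto intro!: E.inv.\<gamma>_strict_mono)
    moreover have "E.inv.\<gamma> y0' = y0" "E.inv.\<gamma> y1' = y1"
      using E.inv_\<gamma>[of y0] E.inv_\<gamma>[of y1] A.y_bounds A.y_less y0 y1 by auto
    ultimately show ?thesis using E.\<gamma>_inv[of v] v B.y_bounds by auto
  qed
  define V2 where "V2 = E.inv.\<gamma> ` V'"
  have V2: "finite V2" "V2 \<subseteq> {y0<..<y1}" using inv_b B.finV by (auto simp: V2_def)
  have V2_img: "E.\<gamma> ` V2 = V'" using inv_b by (force simp: V2_def image_image)
  have "pattern (E.\<gamma> ` A.U) (E.\<gamma> ` V2) = pattern A.U V2"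
  proof (rule pattern_image[OF A.finU V2(1)])
    fix s t assume "s \<in> A.U \<union> V2" "t \<in> A.U \<union> V2" "s < t"
    moreover have "0 \<le> u \<and> u \<le> 1" if "u \<in> A.U \<union> V2" for u using that V2 A.y_bounds by (force simp: A.U_def)
    ultimately show "E.\<gamma> s < E.\<gamma> t" using less[of s t] by blast
  qed
  then have pat2: "pattern A.U V = pattern A.U V2" using pat by (simp add: U_img V2_img)
  have subs: "A.U \<union> V \<subseteq> {y0<..<y1}" "A.U \<union> V2 \<subseteq> {y0<..<y1}" using A.V_sub V2 by (auto simp: A.U_def)
  obtain q where q: "continuous_on UNIV q" "strict_mono q" "q ` A.U = A.U" "q ` V = V2"
    "\<And>y. y \<le> y0 \<Longrightarrow> q y = y - y0 + y0" "\<And>y. y1 \<le> y \<Longrightarrow> q y = y - y1 + y1"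
    by (rule pattern_extend[OF A.finU A.finV A.finU V2(1) A.y_less A.y_less subs pat2]) blast
  have moveV: "teq (glue x y0 y1 V T) (glue x y0 y1 V2 T)"
  proof (rule gluing_move_V[OF g1 gluing_change[OF g1 V2] q(1,2) _ _ _ q(4)])
    show "q u = u" if "u \<in> A.U" for u by (rule strict_mono_finite_fixed[OF A.finU q(2,3) that])
  qed (use q(5,6) in auto)
  \<comment> \<open>Small enough for the lines with parameter \<open>s0\<close> to lie beyond
    \<open>x\<close> in one tiling and beyond \<open>x'\<close> in the other.\<close>
  define s0 where "s0 = min ((1 - x) / 2) ((1 - x') / 2)"
  have s0: "0 < s0" "s0 \<le> 1" "s0 < 1 - x" "s0 < 1 - x'"
    using A.x_lt B.x_lt A.x_gt by (auto simp: s0_def min_def)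
  have m: "s0 * \<delta> < s0" "s0 * \<delta>' < s0" using s0 d by auto
  have "0 < s0 * \<delta>" "0 < s0 * \<delta>'" using s0 d by auto
  then have x2: "x < 1 - s0 * \<delta>" "1 - s0 * \<delta> < 1" "x' < 1 - s0 * \<delta>'" "1 - s0 * \<delta>' < 1"
    using s0 m by linarith+
  have "teq (glue (1 - s0 * \<delta>) y0 y1 V2 T) (glue (1 - s0 * \<delta>') (E.\<gamma> y0) (E.\<gamma> y1) (E.\<gamma> ` V2) T')"
  proof (rule E.glue_tame[OF d _ s0(1,2) gluing_change[OF g1 V2] x2(1)])
    show "f (1 - s * \<delta>, y) = (1 - s * \<delta>', E.\<gamma> y)" if "0 \<le> s" "s \<le> 1" "0 \<le> y" "y \<le> 1" for s y
      using fs[OF that] g[OF that(3,4)] by simp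
    show "gluing T' (1 - s0 * \<delta>') (E.\<gamma> y0) (E.\<gamma> y1) (E.\<gamma> ` V2)"
      unfolding y0 y1 V2_img by (rule gluing_grow[OF g2]) (use x2 in auto)
  qed
  then have near: "teq (glue (1 - s0 * \<delta>) y0 y1 V2 T) (glue (1 - s0 * \<delta>') y0' y1' V' T')"
    by (simp add: y0 y1 V2_img)
  show ?thesis
    using teq_trans[OF teq_trans[OF moveV gluing_move_x[OF gluing_change[OF g1 V2] x2(1,2)]]
        teq_trans[OF near teq_sym[OF gluing_move_x[OF g2 x2(3,4)]]]] .
qed

section \<open>Stacks of strips\<close>

lemma strips_skeleton:
  assumes "strips T"
  shows "(x, y) \<in> skeleton T \<longleftrightarrow> (x, y) \<in> unit_square \<and> (x = 0 \<or> x = 1 \<or> y \<in> levels T)"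
proof -
  have T: "is_tiling T" and t: "\<And>t. t \<in> T \<Longrightarrow> xl t = 0 \<and> xr t = 1" using assms by (auto simp: strips_def)
  have "y \<in> levels T \<longleftrightarrow> (\<forall>t\<in>T. \<not> (yl t < y \<and> y < yr t))" if y: "0 \<le> y" "y \<le> 1"
  proof
    show "\<forall>t\<in>T. \<not> (yl t < y \<and> y < yr t)" if "y \<in> levels T"
      using right_tile_no_level[OF T _ _ that] t by force
    assume a: "\<forall>t\<in>T. \<not> (yl t < y \<and> y < yr t)"
    show "y \<in> levels T"
    proof (cases "y = 1")
      case False
      then have "y < 1" using y by simp
      then obtain u where u: "u \<in> T" "xr u = 1" "yl u \<le> y" "y < yr u" using right_tile_above[OF T y(1)] by blast
      then have "yl u = y" using a by force
      then show ?thesis using right_tile_levels(1)[OF T u(1,2)] by simp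
    qed (simp add: levels_def)
  qed
  then show ?thesis unfolding mem_skeleton[OF T] mem_unit_square using t by force
qed

lemma strips_teq:
  assumes s: "strips T" "strips T'" and c: "card (right_hits T) = card (right_hits T')"
  shows "teq T T'"
proof -
  have T: "is_tiling T" "is_tiling T'" using s by (auto simp: strips_def)
  note fin = finite_right_hits[OF T(1)] finite_right_hits[OF T(2)]
  \<comment> \<open>With nothing on the left the pattern records only the number of heights, so
    stacks with equally many strips can be matched by \<open>pattern_extend\<close>.\<close>
  have "pattern {} V = replicate (card V) Rt" if "finite V" for V
    using that by (simp add: pattern_def map_replicate_const)
  then have p: "pattern {} (right_hits T) = pattern {} (right_hits T')" using fin c by simp
  have sub: "{} \<union> right_hits T \<subseteq> {0<..<1}" "{} \<union> right_hits T' \<subseteq> {0<..<1}" by (auto simp: right_hits_bounds)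
  obtain q where q: "continuous_on UNIV q" "strict_mono q" "q ` right_hits T = right_hits T'"
    "\<And>y. y \<le> 0 \<Longrightarrow> q y = y - 0 + 0" "\<And>y. 1 \<le> y \<Longrightarrow> q y = y - 1 + 1"
    by (rule pattern_extend[OF _ fin(1) _ fin(2) zero_less_one zero_less_one sub p]) auto
  have q01: "q 0 = 0" "q 1 = 1" using q(4)[of 0] q(5)[of 1] by auto
  have mono: "q s < q t" if "0 \<le> s" "s < t" "t \<le> 1" for s t \<xi> :: real
    using q(2) that by (simp add: strict_mono_def)
  define f :: "real \<times> real \<Rightarrow> real \<times> real" where "f = (\<lambda>p. (fst p, q (snd p)))"
  have "continuous_on unit_square (\<lambda>p. q (snd p))"
    by (rule continuous_on_compose2[OF q(1)]) (auto intro!: continuous_intros)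
  note sh = vshear[of "\<lambda>_. q", OF this mono q01 f_def]
  have lev: "q y \<in> levels T' \<longleftrightarrow> y \<in> levels T" for y
  proof -
    have "q ` levels T = levels T'" by (simp add: levels_def q(3) q01)
    then show ?thesis using strict_mono_imp_inj_on[OF q(2)] by (metis inj_image_mem_iff)
  qed
  have sk: "f p \<in> skeleton T' \<longleftrightarrow> p \<in> skeleton T" if "p \<in> unit_square" for p
  proof -
    have "f p \<in> unit_square" using sh(3) that by blast
    then show ?thesis using that lev[of "snd p"]
      by (cases p) (simp add: f_def strips_skeleton[OF s(1)] strips_skeleton[OF s(2)])
  qed
  have "eqv f T T'"
  proof (rule eqvI[OF sh])
    show "f ` skeleton T = skeleton T'"
      using image_eqI_iff[OF sh(3) sk] skeleton_subset[OF T(1)] skeleton_subset[OF T(2)] by blast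
  qed (simp_all add: f_def)
  moreover have "tame f" by (rule tameI[of "1 / 2" f q]) (auto simp: f_def)
  ultimately show ?thesis using T unfolding teq_def by blast
qed

section \<open>Codes of rectangulations\<close>

text \<open>\<open>Strips k\<close> is the stack of \<open>k + 1\<close> strips; \<open>Glue w i p\<close> adds to \<open>w\<close> a block with pattern \<open>p\<close> that starts at
  the level of index \<open>i\<close>, counted from the bottom of the right side.\<close>

datatype code = Strips nat | Glue code nat "letter list"

abbreviation "nL p \<equiv> count_list p Lt"
abbreviation "nR p \<equiv> count_list p Rt"
abbreviation "nX p \<equiv> count_list p Cr"

fun ntiles :: "code \<Rightarrow> nat" where
  "ntiles (Strips k) = k + 1"
| "ntiles (Glue w i p) = ntiles w + 1 + nR p + nX p"

fun nhits :: "code \<Rightarrow> nat" where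
  "nhits (Strips k) = k"
| "nhits (Glue w i p) = nhits w + nR p - nL p"

fun nsing :: "code \<Rightarrow> nat" where
  "nsing (Strips k) = 0"
| "nsing (Glue w i p) = nsing w + nX p"

fun top_index :: "code \<Rightarrow> nat option" where
  "top_index (Strips k) = None"
| "top_index (Glue w i p) = Some (i + 1 + nR p + nX p)"

text \<open>The last block glued on must be the lowest removable one: the previous block, whose upper
  end has index \<open>top_index w\<close>, must not lie strictly below it.\<close>

fun canon :: "code \<Rightarrow> bool" where
  "canon (Strips k) \<longleftrightarrow> True"
| "canon (Glue w i p) \<longleftrightarrow> canon w \<and> i + nL p + nX p \<le> nhits w \<and>
     (\<forall>j. top_index w = Some j \<longrightarrow> i \<le> j)"

text \<open>A relation rather than a function, because a code leaves the real positions of the left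
  side and of the edges open.\<close>

fun realizes :: "tile set \<Rightarrow> code \<Rightarrow> bool" where
  "realizes T (Strips k) \<longleftrightarrow> strips T \<and> card (right_hits T) = k"
| "realizes T (Glue w i p) \<longleftrightarrow> (\<exists>S x y0 y1 V. gluing S x y0 y1 V \<and> T = glue x y0 y1 V S \<and>
     realizes S w \<and> level_index S y0 = i \<and> pattern (gluing.U S y0 y1) V = p)"

lemma realizes_tiling: "realizes T w \<Longrightarrow> is_tiling T"
  by (cases w) (auto simp: strips_def gluing.tiling_glue)

text \<open>The induction closes because \<open>glue_teq\<close> takes and returns the stronger
  relation \<open>teq\<close>; plain equivalence of the smaller tilings would not suffice for the
  gluing step.\<close>

lemma realizes_teq: "realizes T w \<Longrightarrow> realizes T' w \<Longrightarrow> teq T T'"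
proof (induction w arbitrary: T T')
  case (Strips k) then show ?case by (auto intro: strips_teq)
next
  case (Glue w i p)
  obtain S x y0 y1 V where 1: "gluing S x y0 y1 V" "T = glue x y0 y1 V S" "realizes S w"
    "level_index S y0 = i" "pattern (gluing.U S y0 y1) V = p" using Glue.prems(1) by auto
  obtain S' x' y0' y1' V' where 2: "gluing S' x' y0' y1' V'" "T' = glue x' y0' y1' V' S'" "realizes S' w"
    "level_index S' y0' = i" "pattern (gluing.U S' y0' y1') V' = p" using Glue.prems(2) by auto
  show ?case unfolding 1(2) 2(2)
    by (rule glue_teq[OF 1(1) 2(1) Glue.IH[OF 1(3) 2(3)]]) (simp_all add: 1 2)
qed

lemma strips_eq_slabs:
  assumes "strips T"
  shows "T = slabs 0 (levels T)"
proof -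
  have T: "is_tiling T" and x: "\<And>t. t \<in> T \<Longrightarrow> xl t = 0 \<and> xr t = 1" using assms by (auto simp: strips_def)
  have c: "consec (levels T) (yl t) (yr t)" if "t \<in> T" for t
    using right_tile_levels[OF T that] right_tile_no_level[OF T that] tile_bounds[OF T that] x[OF that]
    by (auto simp: consec_def)
  show ?thesis
  proof (intro set_eqI iffI)
    fix t assume t: "t \<in> T"
    then have "t = ((0, yl t), (1, yr t))" using x by (simp add: tile_eq_iff)
    then show "t \<in> slabs 0 (levels T)" using c[OF t] unfolding slabs_def by blast
  next
    fix t assume "t \<in> slabs 0 (levels T)"
    then obtain z z' where t: "t = ((0, z), (1, z'))" "consec (levels T) z z'" by (auto simp: slabs_def)
    then have "0 \<le> z" "z < 1" using levels_bounds by (force simp: consec_def)+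
    then obtain u where u: "u \<in> T" "xr u = 1" "yl u \<le> z" "z < yr u" using right_tile_above[OF T] by blast
    have "yl u = z \<and> yr u = z'"
      using u t(2) by (intro consec_unique[OF c[OF u(1)] t(2)]) (auto simp: consec_def)
    then have "t = u" using x[OF u(1)] t by (simp add: tile_eq_iff)
    then show "t \<in> T" using u by simp
  qed
qed

lemma card_levels: "is_tiling T \<Longrightarrow> card (levels T) = card (right_hits T) + 2"
  using finite_right_hits[of T] right_hits_bounds[of 0 T] right_hits_bounds[of 1 T]
  by (auto simp: levels_def card_insert_if)

lemma card_strips:
  assumes "strips T"
  shows "card T = card (right_hits T) + 1" "singular_vertices T = {}"
proof -
  have T: "is_tiling T" using assms by (simp add: strips_def)
  have "card T = card (slabs 0 (levels T))" using strips_eq_slabs[OF assms] by simp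
  also have "\<dots> = card (levels T) - 1" by (rule card_slabs[OF finite_levels[OF T]]) (simp add: levels_def)
  finally show "card T = card (right_hits T) + 1" using card_levels[OF T] by simp
  show "singular_vertices T = {}"
    using assms by (auto simp: singular_iff[OF T] ll_corner_def ur_corner_def strips_def)
qed

text \<open>The upper end of the block is a level, and the largest possible rank, that of the height
  1, is r + 1. This is the origin of the inequality in \<open>canon\<close>.\<close>

lemma (in gluing) level_index_bound: "level_index T y0 + card U \<le> card (right_hits T)"
proof -
  have "level_index T y1 \<le> card (levels T - {1})"
    unfolding level_index_def using y_bounds finite_levels[OF tiling] by (intro card_mono) auto
  also have "\<dots> = card (right_hits T) + 1"
    using card_levels[OF tiling] finite_levels[OF tiling] by (simp add: levels_def)
  finally show ?thesis using level_index_y1 by simp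
qed

lemma realizes_card:
  "realizes T w \<Longrightarrow> card T = ntiles w \<and> card (right_hits T) = nhits w \<and> card (singular_vertices T) = nsing w"
proof (induction w arbitrary: T)
  case (Strips k) then show ?case using card_strips[of T] by simp
next
  case (Glue w i p)
  then obtain S x y0 y1 V where 1: "gluing S x y0 y1 V" "T = glue x y0 y1 V S" "realizes S w"
    "level_index S y0 = i" "pattern (gluing.U S y0 y1) V = p" by auto
  interpret gluing S x y0 y1 V by (rule 1(1))
  note IH = Glue.IH[OF 1(3)]
  have "nL p + nX p = card U" "nR p + nX p = card V" "nX p = card (U \<inter> V)"
    using card_left_pattern[OF finU finV] card_right_pattern[OF finU finV] count_pattern(1)[OF finU finV] 1(5) by simp_all
  then show ?case
    using IH card_glue card_right_hits_glue card_singular_glue 1(2) by simp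
qed

lemma (in gluing) levels_glue: "levels (glue x y0 y1 V T) = (levels T - {y0<..<y1}) \<union> V"
  using y_bounds V_sub by (auto simp: levels_def right_hits_glue)

lemma (in gluing) level_index_glue_y0: "level_index (glue x y0 y1 V T) y0 = level_index T y0"
proof -
  have "{h \<in> levels (glue x y0 y1 V T). h < y0} = {h \<in> levels T. h < y0}"
    using V_sub by (auto simp: levels_glue)
  then show ?thesis by (simp add: level_index_def)
qed

lemma (in gluing) level_index_glue_y1: "level_index (glue x y0 y1 V T) y1 = level_index T y0 + 1 + card V"
proof -
  have "{h \<in> levels (glue x y0 y1 V T). h < y1} = {h \<in> levels T. h < y0} \<union> insert y0 V"
    using V_sub lev y_less by (auto simp: levels_glue)
  moreover have "{h \<in> levels T. h < y0} \<inter> insert y0 V = {}" "y0 \<notin> V" using V_sub by auto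
  ultimately show ?thesis unfolding level_index_def
    using finite_levels[OF tiling] finV by (simp add: card_Un_disjoint)
qed

lemma (in gluing) y1_level_glue: "y1 \<in> levels (glue x y0 y1 V T)"
  using lev by (simp add: levels_glue)

text \<open>A removable block below the new one is removable before the gluing too. By induction it
  is not lower than the previous block of the code, which would then lie strictly below the new one,
  against the condition on ranks.\<close>

lemma canon_lowest:
  assumes "canon (Glue w i p)" "gluing S x y0 y1 V" "realizes S w" "level_index S y0 = i"
  shows "lowest (glue x y0 y1 V S) x y0 y1"
  using assms
proof (induction w arbitrary: i p S x y0 y1 V)
  case (Strips k)
  interpret gluing S x y0 y1 V by fact
  have "y1 \<le> z1" if r: "removable (glue x y0 y1 V S) x' z0 z1" for x' z0 z1
  proof (rule ccontr)
    assume n: "\<not> y1 \<le> z1"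
    have "\<not> y0 \<le> z1" using removable_overlap_eq[OF removable_glue r] n removableD(4)[OF r] by force
    then have "removable S x' z0 z1" using removable_glue_below r by auto
    then show False using strips_not_removable Strips.prems(3) by simp
  qed
  then show ?case using removable_glue by (auto simp: lowest_def)
next
  case (Glue w0 i0 p0)
  interpret gluing S x y0 y1 V by fact
  obtain S0 x0 a0 a1 V0 where 1: "gluing S0 x0 a0 a1 V0" "S = glue x0 a0 a1 V0 S0" "realizes S0 w0"
    "level_index S0 a0 = i0" "pattern (gluing.U S0 a0 a1) V0 = p0" using Glue.prems(3) by auto
  interpret z: gluing S0 x0 a0 a1 V0 by (rule 1(1))
  have low: "lowest S x0 a0 a1" unfolding 1(2)
    using Glue.IH[OF _ 1(1,3,4)] Glue.prems(1) by auto
  have idx: "level_index S a1 = i0 + 1 + nR p0 + nX p0"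
    using z.level_index_glue_y1 card_right_pattern[OF z.finU z.finV] 1 by simp
  have "y1 \<le> z1" if r: "removable (glue x y0 y1 V S) x' z0 z1" for x' z0 z1
  proof (rule ccontr)
    assume n: "\<not> y1 \<le> z1"
    have "\<not> y0 \<le> z1" using removable_overlap_eq[OF removable_glue r] n removableD(4)[OF r] by force
    then have "removable S x' z0 z1" using removable_glue_below r by auto
    then have "a1 \<le> z1" using low by (auto simp: lowest_def)
    then have "a1 < y0" using \<open>\<not> y0 \<le> z1\<close> by simp
    then have "level_index S a1 < level_index S y0"
      using z.y1_level_glue 1(2) by (intro level_index_strict_mono[OF tiling]) auto
    then show False using Glue.prems(1,4) idx by simp
  qed
  then show ?case using removable_glue by (auto simp: lowest_def)
qed

lemma level_index_mono: "is_tiling T \<Longrightarrow> y \<le> z \<Longrightarrow> level_index T y \<le> level_index T z"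
  unfolding level_index_def by (intro card_mono) (auto simp: finite_levels)

text \<open>The lowest block is removed and the rest is coded by induction. If the previous block
  lay strictly below the removed one, it would be removable in \<open>T\<close> as well,
  contradicting the choice of the lowest.\<close>

lemma ex_canon:
  assumes "is_tiling T"
  shows "\<exists>w. canon w \<and> realizes T w"
  using assms
proof (induction "card T" arbitrary: T rule: less_induct)
  case less
  show ?case
  proof (cases "strips T")
    case True then show ?thesis by (intro exI[of _ "Strips (card (right_hits T))"]) simp
  next
    case False
    then obtain x y0 y1 where low: "lowest T x y0 y1" using ex_lowest_or_strips[OF less.prems] by blast
    obtain S V where S: "gluing S x y0 y1 V" "glue x y0 y1 V S = T"
      using removable_unglue[OF less.prems lowest_removable[OF low]] by blast
    interpret gluing S x y0 y1 V by (rule S(1))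
    have "card S < card T" using card_glue S(2) by simp
    then obtain w where w: "canon w" "realizes S w" using less.hyps tiling by blast
    define p where "p = pattern U V"
    define i where "i = level_index S y0"
    have "i + nL p + nX p \<le> nhits w"
      using level_index_bound realizes_card[OF w(2)] card_left_pattern[OF finU finV] by (simp add: i_def p_def)
    moreover have "i \<le> j" if j: "top_index w = Some j" for j
    proof (cases w)
      case (Strips k) then show ?thesis using j by simp
    next
      case (Glue w0 i0 p0)
      obtain S0 x0 a0 a1 V0 where 1: "gluing S0 x0 a0 a1 V0" "S = glue x0 a0 a1 V0 S0" "realizes S0 w0"
        "level_index S0 a0 = i0" "pattern (gluing.U S0 a0 a1) V0 = p0" using w(2) Glue by auto
      interpret z: gluing S0 x0 a0 a1 V0 by (rule 1(1))
      have idx: "level_index S a1 = j"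
        using z.level_index_glue_y1 card_right_pattern[OF z.finU z.finV] 1 j Glue by simp
      have "y0 \<le> a1"
      proof (rule ccontr)
        assume n: "\<not> y0 \<le> a1"
        have "removable S x0 a0 a1" using z.removable_glue 1(2) by simp
        then have "removable T x0 a0 a1" using removable_glue_below[of a1] n S(2) by simp
        then have "y1 \<le> a1" using low unfolding lowest_def by blast
        then show False using n y_less by simp
      qed
      then show ?thesis using level_index_mono[OF tiling, of y0 a1] idx by (simp add: i_def)
    qed
    ultimately have "canon (Glue w i p)" using w by simp
    moreover have "realizes T (Glue w i p)"
      unfolding realizes.simps by (intro exI conjI) (rule S(1) S(2)[symmetric] w(2) i_def[symmetric] p_def[symmetric])+
    ultimately show ?thesis by blast
  qed
qed

section \<open>Every canonical code is realized\<close>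

lemma sorted_list_of_set_insert_least:
  assumes "finite A" "\<And>u. u \<in> A \<Longrightarrow> m < u"
  shows "sorted_list_of_set (insert m A) = m # sorted_list_of_set (A :: real set)"
proof -
  define X where "X = insert m A"
  have "finite X" using assms(1) by (simp add: X_def)
  then have X: "set (sorted_list_of_set X) = X" by (rule set_sorted_list_of_set)
  have "sorted_list_of_set X = m # sorted_list_of_set A"
  proof (rule sorted_distinct_set_unique)
    show "sorted (m # sorted_list_of_set A)" using assms by (auto simp: less_imp_le)
    show "distinct (m # sorted_list_of_set A)" using assms by auto
    show "set (sorted_list_of_set X) = set (m # sorted_list_of_set A)" using X assms(1) by (simp add: X_def)
  qed simp_all
  then show ?thesis by (simp only: X_def)
qed

lemma pattern_insert:
  assumes "finite U" "finite V" "\<And>u. u \<in> U \<union> V \<Longrightarrow> m < u"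
  shows "pattern U (insert m V) = Rt # pattern U V" "pattern (insert m U) V = Lt # pattern U V"
    "pattern (insert m U) (insert m V) = Cr # pattern U V"
proof -
  have s: "sorted_list_of_set (insert m (U \<union> V)) = m # sorted_list_of_set (U \<union> V)"
    using assms by (intro sorted_list_of_set_insert_least) auto
  have m: "m \<notin> U" "m \<notin> V" using assms(3) by auto
  have e: "U \<union> insert m V = insert m (U \<union> V)" "insert m U \<union> V = insert m (U \<union> V)"
    "insert m U \<union> insert m V = insert m (U \<union> V)" by auto
  have ne: "u \<noteq> m" if "u \<in> set (sorted_list_of_set (U \<union> V))" for u using that assms m by auto
  show "pattern U (insert m V) = Rt # pattern U V" "pattern (insert m U) V = Lt # pattern U V"
    "pattern (insert m U) (insert m V) = Cr # pattern U V"
    unfolding pattern_def e s using m ne by (auto intro!: map_cong)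
qed

text \<open>The pattern is realized from the bottom upwards: \<open>Lt\<close> and \<open>Cr\<close>
  consume the least remaining height of \<open>U\<close>, while \<open>Rt\<close> inserts a new
  height below it by density. The lower bound \<open>y0\<close> rises with the induction.\<close>

lemma ex_pattern:
  assumes "finite U" "U \<subseteq> {y0<..<y1}" "y0 < y1" "nL p + nX p = card U"
  shows "\<exists>V. finite V \<and> V \<subseteq> {y0<..<y1} \<and> pattern U V = p"
  using assms
proof (induction p arbitrary: U y0)
  case Nil
  then show ?case by (intro exI[of _ "{}"]) (simp add: pattern_def)
next
  case (Cons a p)
  show ?case
  proof (cases "a = Rt")
    case True
    define m where "m = Min (insert y1 U)"
    have m: "y0 < m" "m \<le> y1" "\<And>u. u \<in> U \<Longrightarrow> m \<le> u" using Cons.prems by (auto simp: m_def)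
    obtain c where c: "y0 < c" "c < m" using m dense by blast
    have "U \<subseteq> {c<..<y1}" using Cons.prems m c by force
    then obtain V where V: "finite V" "V \<subseteq> {c<..<y1}" "pattern U V = p"
      using Cons.IH[of U c] Cons.prems True c m by auto
    have "pattern U (insert c V) = Rt # p" using V \<open>U \<subseteq> {c<..<y1}\<close> Cons.prems(1) by (subst pattern_insert(1)) auto
    then show ?thesis using V c m True by (intro exI[of _ "insert c V"]) auto
  next
    case False
    then have ne: "U \<noteq> {}" using Cons.prems by (cases a) auto
    define m where "m = Min U"
    have m: "m \<in> U" "\<And>u. u \<in> U \<Longrightarrow> m \<le> u" using Cons.prems ne by (auto simp: m_def)
    have mb: "y0 < m" "m < y1" using m Cons.prems by auto
    have U: "U - {m} \<subseteq> {m<..<y1}" using m Cons.prems by force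
    have U_eq: "insert m (U - {m}) = U" using m by blast
    have "nL p + nX p = card (U - {m})" using Cons.prems m False by (cases a) auto
    then obtain V where V: "finite V" "V \<subseteq> {m<..<y1}" "pattern (U - {m}) V = p"
      using Cons.IH[of "U - {m}" m] Cons.prems U mb by auto
    have b: "\<And>u. u \<in> (U - {m}) \<union> V \<Longrightarrow> m < u" using U V by auto
    have fU: "finite (U - {m})" using Cons.prems(1) by simp
    have pL: "pattern (insert m (U - {m})) V = Lt # pattern (U - {m}) V"
      and pX: "pattern (insert m (U - {m})) (insert m V) = Cr # pattern (U - {m}) V"
      by (intro pattern_insert fU V(1) b; assumption)+
    show ?thesis
    proof (cases a)
      case Lt
      have "pattern U V = a # p" using pL by (simp only: Lt U_eq V(3))
      moreover have "V \<subseteq> {y0<..<y1}" using V(2) mb by auto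
      ultimately show ?thesis using V(1) by (intro exI[of _ V] conjI)
    next
      case Cr
      have "pattern U (insert m V) = a # p" using pX by (simp only: Cr U_eq V(3))
      moreover have "insert m V \<subseteq> {y0<..<y1}" using V(2) mb by auto
      moreover have "finite (insert m V)" using V(1) by simp
      ultimately show ?thesis by (intro exI[of _ "insert m V"] conjI)
    qed (use False in simp)
  qed
qed

text \<open>Ranks are distinct and smaller than the number of levels, so by counting all of them
  occur.\<close>

lemma ex_level:
  assumes "is_tiling T" "i < card (levels T)"
  shows "\<exists>y\<in>levels T. level_index T y = i"
proof -
  have inj: "inj_on (level_index T) (levels T)" by (rule inj_onI) (rule level_index_inj[OF assms(1)])
  have "level_index T ` levels T \<subseteq> {..<card (levels T)}"
  proof
    fix n assume "n \<in> level_index T ` levels T"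
    then obtain y where y: "y \<in> levels T" "n = level_index T y" by blast
    have "{h \<in> levels T. h < y} \<subset> levels T" using y by blast
    then show "n \<in> {..<card (levels T)}" unfolding y(2) level_index_def
      using finite_levels[OF assms(1)] by (simp add: psubset_card_mono)
  qed
  then have "level_index T ` levels T = {..<card (levels T)}"
    using card_image[OF inj] by (intro card_subset_eq) auto
  then have "i \<in> level_index T ` levels T" using assms(2) by simp
  then show ?thesis by blast
qed

lemma ex_strips: "\<exists>T. strips T \<and> card (right_hits T) = k"
proof -
  obtain R :: "real set" where R: "finite R" "card R = k" "R \<subseteq> {0<..<1}"
    using infinite_arbitrarily_large[OF infinite_Ioo[OF zero_less_one]] by blast
  define Z where "Z = insert 0 (insert 1 R)"
  have Z: "finite Z" "0 \<in> Z" "1 \<in> Z" "\<And>z. z \<in> Z \<Longrightarrow> 0 \<le> z \<and> z \<le> 1"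
    using R by (auto simp: Z_def)
  let ?T = "slabs 0 Z"
  have T: "is_tiling ?T"
  proof (rule is_tilingI)
    show "finite ?T" by (rule slabs_finite[OF Z(1)])
    show "0 \<le> xl t \<and> xl t < xr t \<and> xr t \<le> 1 \<and> 0 \<le> yl t \<and> yl t < yr t \<and> yr t \<le> 1" if "t \<in> ?T" for t
      using that Z(4) by (auto simp: slabs_def consec_def)
    show "\<exists>t\<in>?T. xl t \<le> x \<and> x \<le> xr t \<and> yl t \<le> y \<and> y \<le> yr t" if b: "0 \<le> x" "x \<le> 1" "0 \<le> y" "y \<le> 1" for x y
    proof -
      have "\<exists>z z'. consec Z z z' \<and> z \<le> y \<and> y \<le> z'"
      proof (cases "y < 1")
        case True
        obtain z z' where "consec Z z z'" "z \<le> y" "y < z'" using consec_above[OF Z(1-3) b(3) True] by blast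
        then show ?thesis by (intro exI[of _ z] exI[of _ z']) auto
      next
        case False
        then have "0 < y" by simp
        then obtain z z' where "consec Z z z'" "z < y" "y \<le> z'" using consec_below[OF Z(1-3) _ b(4)] by blast
        then show ?thesis by (intro exI[of _ z] exI[of _ z']) auto
      qed
      then obtain z z' where z: "consec Z z z'" "z \<le> y" "y \<le> z'" by blast
      then have "((0, z), (1, z')) \<in> ?T" by (auto simp: slabs_def)
      then show ?thesis by (rule bexI[rotated]) (use z b in auto)
    qed
    show "t = u" if "t \<in> ?T" "u \<in> ?T" "yl t < y" "y < yr t" "yl u < y" "y < yr u" for t u y
    proof -
      obtain z z' w w' where e: "t = ((0, z), (1, z'))" "consec Z z z'" "u = ((0, w), (1, w'))" "consec Z w w'"
        using \<open>t \<in> ?T\<close> \<open>u \<in> ?T\<close> unfolding slabs_def by blast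
      then have "z = w \<and> z' = w'" using that by (intro consec_unique[OF e(2,4)]) auto
      then show ?thesis using e by simp
    qed
  qed
  have s: "strips ?T" using T by (auto simp: strips_def slabs_def)
  have "right_hits ?T = R"
  proof (intro set_eqI iffI)
    fix y assume "y \<in> right_hits ?T"
    then show "y \<in> R" by (auto simp: right_hits_def slabs_def consec_def Z_def)
  next
    fix y assume y: "y \<in> R"
    then have yb: "0 < y" "y < 1" "y \<in> Z" using R by (auto simp: Z_def)
    obtain z z' where z: "consec Z z z'" "z \<le> y" "y < z'" using consec_above[OF Z(1-3) less_imp_le[OF yb(1)] yb(2)] by blast
    then have "z = y" using yb by (force simp: consec_def)
    then have "((0, y), (1, z')) \<in> ?T" using z by (auto simp: slabs_def)
    then show "y \<in> right_hits ?T" using yb unfolding right_hits_def by force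
  qed
  then show ?thesis using s R by blast
qed

lemma ex_realizes: "canon w \<Longrightarrow> \<exists>T. realizes T w"
proof (induction w)
  case (Strips k) then show ?case using ex_strips by simp
next
  case (Glue w i p)
  then obtain S where S: "realizes S w" by auto
  have T: "is_tiling S" by (rule realizes_tiling[OF S])
  have c: "card (levels S) = nhits w + 2" using card_levels[OF T] realizes_card[OF S] by simp
  have le: "i + nL p + nX p \<le> nhits w" using Glue.prems by simp
  obtain y0 where y0: "y0 \<in> levels S" "level_index S y0 = i" using ex_level[OF T, of i] c le by auto
  obtain y1 where y1: "y1 \<in> levels S" "level_index S y1 = i + 1 + nL p + nX p"
    using ex_level[OF T, of "i + 1 + nL p + nX p"] c le by auto
  have "y0 < y1"
    using level_index_mono[OF T, of y1 y0] y0 y1 by (cases "y0 < y1") auto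
  \<comment> \<open>A left side to the right of all coordinates other than 1 satisfies
    \<open>clear\<close> for any two levels.\<close>
  let ?A = "insert 0 {z \<in> coords S. z < 1}"
  have fin: "finite ?A" using finite_coords[OF tiling_finite[OF T]] by simp
  define m where "m = Max ?A"
  have m: "m < 1" "0 \<le> m" using fin by (auto simp: m_def)
  have ge: "z \<le> m" if "z \<in> coords S" "z < 1" for z using that fin by (auto simp: m_def)
  define x where "x = (m + 1) / 2"
  have x: "m < x" "x < 1" "0 < x" using m by (auto simp: x_def)
  \<comment> \<open>Gluing without new edges makes \<open>U\<close> available; only then can
    \<open>V\<close> be chosen to fit the pattern.\<close>
  have g0: "gluing S x y0 y1 {}"
  proof
    show "xr t < x \<or> xr t = 1 \<and> xl t < x" if "t \<in> S" "yl t \<le> y1" "y0 \<le> yr t" for t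
      using ge[OF coordsI(1)[OF that(1)]] ge[OF coordsI(2)[OF that(1)]] x tile_bounds[OF T that(1)] by force
  qed (use T x y0 y1 \<open>y0 < y1\<close> in auto)
  interpret g0: gluing S x y0 y1 "{}" by (rule g0)
  have "nL p + nX p = card g0.U" using g0.level_index_y1 y0 y1 by simp
  moreover have "g0.U \<subseteq> {y0<..<y1}" by (auto simp: g0.U_def)
  ultimately obtain V where V: "finite V" "V \<subseteq> {y0<..<y1}" "pattern g0.U V = p"
    using ex_pattern[OF g0.finU _ \<open>y0 < y1\<close>] by blast
  have g: "gluing S x y0 y1 V" by (rule gluing_change[OF g0 V(1,2)])
  have "realizes (glue x y0 y1 V S) (Glue w i p)"
    unfolding realizes.simps by (intro exI conjI) (rule g refl S y0(2) V(3))+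
  then show ?case by blast
qed

section \<open>The code is an invariant of the rectangulation\<close>

lemma removable_eqv:
  assumes "is_tiling T" "is_tiling T'" "eqv f T T'" "removable T x y0 y1"
  shows "\<exists>x' z0 z1. removable T' x' z0 z1"
proof -
  interpret tequiv_block f T T' x y0 y1
    by (intro tequiv_block.intro tequiv_invI tequiv_block_axioms.intro assms)
  show ?thesis using removable_image by blast
qed

text \<open>An equivalence maps the lowest block to the lowest block, and for canonical codes that
  is the last one glued. So the last gluings correspond and are undone together; rank and pattern
  agree because both can be read off the glued tilings.\<close>

lemma realizes_unique:
  assumes "canon w" "canon w'" "realizes T w" "realizes T' w'" "eqv f T T'"
  shows "w = w'"
  using assms
proof (induction w arbitrary: w' T T' f)
  case (Strips k)
  have til: "is_tiling T" "is_tiling T'" using Strips.prems(3,4) realizes_tiling by blast+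
  interpret tequiv_inv f T T' by (rule tequiv_invI[OF til Strips.prems(5)])
  show ?case
  proof (cases w')
    case (Strips k')
    have "inj_on \<gamma> (right_hits T)"
      by (rule inj_on_subset[OF \<gamma>_inj_on]) (use right_hits_bounds in force)
    then have "card (right_hits T') = card (right_hits T)" using right_hits_image card_image by metis
    then show ?thesis using Strips \<open>realizes T (Strips k)\<close> \<open>realizes T' w'\<close> by simp
  next
    case (Glue w0 i p)
    then obtain x y0 y1 where "removable T' x y0 y1" using \<open>realizes T' w'\<close> gluing.removable_glue by fastforce
    then show ?thesis using removable_eqv[OF til(2,1) inv.f] strips_not_removable[of T] \<open>realizes T (Strips k)\<close> by auto
  qed
next
  case (Glue w i p)
  have til: "is_tiling T" "is_tiling T'" using Glue.prems(3,4) realizes_tiling by blast+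
  obtain S x y0 y1 V where 1: "gluing S x y0 y1 V" "T = glue x y0 y1 V S" "realizes S w"
    "level_index S y0 = i" "pattern (gluing.U S y0 y1) V = p" using Glue.prems(3) by auto
  have low: "lowest T x y0 y1" unfolding 1(2) by (rule canon_lowest[OF Glue.prems(1) 1(1,3,4)])
  interpret tequiv_block f T T' x y0 y1
    by (intro tequiv_block.intro tequiv_invI tequiv_block_axioms.intro til lowest_removable[OF low] Glue.prems(5))
  show ?case
  proof (cases w')
    case (Strips k')
    then show ?thesis using removable_image strips_not_removable[of T'] Glue.prems(4) by simp
  next
    case w': (Glue w2 i2 p2)
    obtain S' x2 z0 z1 V' where 2: "gluing S' x2 z0 z1 V'" "T' = glue x2 z0 z1 V' S'" "realizes S' w2"
      "level_index S' z0 = i2" "pattern (gluing.U S' z0 z1) V' = p2" using Glue.prems(4) w' by auto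
    have "lowest T' x2 z0 z1" unfolding 2(2)
      by (rule canon_lowest[OF _ 2(1,3,4)]) (use Glue.prems(2) w' in auto)
    then have e: "x2 = x'" "z0 = \<gamma> y0" "z1 = \<gamma> y1" using lowest_unique[OF lowest_image[OF low]] by auto
    interpret tequiv_glue f T T' x y0 y1 S V S' V'
      by (intro tequiv_glue.intro tequiv_block_axioms tequiv_glue_axioms.intro) (use 1 2 e in simp_all)
    have "w = w2" using Glue.IH[OF _ _ 1(3) 2(3) unglue_eqv] Glue.prems(1,2) w' by auto
    moreover have "i = i2"
      using A.level_index_glue_y0 B.level_index_glue_y0 level_index_image[of y0] 1(2,4) 2(2,4) e b by simp
    moreover have "p = p2"
    proof -
      have "pattern (v ` A.U) (v ` V) = pattern A.U V"
      proof (rule pattern_image[OF A.finU A.finV])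
        fix s t assume "s \<in> A.U \<union> V" "t \<in> A.U \<union> V" "s < t"
        moreover have "A.U \<union> V \<subseteq> {y0<..<y1}" using A.V_sub by (auto simp: A.U_def)
        ultimately show "v s < v t" by (intro v_strict_mono) force+
      qed
      then show ?thesis using 1(5) 2(5) e by (simp add: V_image U_image)
    qed
    ultimately show ?thesis using w' by simp
  qed
qed

definition codes :: "nat \<Rightarrow> nat \<Rightarrow> nat \<Rightarrow> code set" where
  "codes m r s = {w. canon w \<and> ntiles w = m \<and> nhits w = r \<and> nsing w = s}"

lemma comb_equiv_refl: "is_tiling T \<Longrightarrow> comb_equiv T T"
  using comb_equiv_iff eqv_id by blast

lemma comb_equiv_sym: "is_tiling T \<Longrightarrow> is_tiling T' \<Longrightarrow> comb_equiv T T' \<Longrightarrow> comb_equiv T' T"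
  using comb_equiv_iff eqv_inv by blast

lemma comb_equiv_trans:
  "is_tiling T \<Longrightarrow> is_tiling T' \<Longrightarrow> is_tiling T'' \<Longrightarrow> comb_equiv T T' \<Longrightarrow> comb_equiv T' T'' \<Longrightarrow> comb_equiv T T''"
  by (simp add: comb_equiv_iff) (meson eqv_trans)

lemma rect_class_eq_iff:
  assumes "is_tiling T" "is_tiling T'"
  shows "rect_class T = rect_class T' \<longleftrightarrow> comb_equiv T T'"
proof
  assume "rect_class T = rect_class T'"
  moreover have "T' \<in> rect_class T'" using assms comb_equiv_refl by (simp add: rect_class_def)
  ultimately show "comb_equiv T T'" by (auto simp: rect_class_def)
next
  assume "comb_equiv T T'"
  then show "rect_class T = rect_class T'"
    unfolding rect_class_def using assms comb_equiv_sym comb_equiv_trans by blast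
qed

text \<open>\<open>realizes_unique\<close> gives injectivity; \<open>ex_canon\<close> and
  \<open>realizes_teq\<close> give surjectivity, whatever representatives are chosen.\<close>

lemma t_count_codes: "t_count m r s = card (codes m r s)"
proof -
  define R where "R w = (SOME T. realizes T w)" for w
  have R: "realizes (R w) w" if "canon w" for w
    unfolding R_def using ex_realizes[OF that] by (rule someI_ex)
  let ?K = "{rect_class T | T. is_tiling T \<and> card T = m \<and> card (right_hits T) = r \<and> card (singular_vertices T) = s}"
  have "bij_betw (\<lambda>w. rect_class (R w)) (codes m r s) ?K"
    unfolding bij_betw_def
  proof
    show "inj_on (\<lambda>w. rect_class (R w)) (codes m r s)"
    proof (rule inj_onI)
      fix w w' assume w: "w \<in> codes m r s" "w' \<in> codes m r s" "rect_class (R w) = rect_class (R w')"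
      then have c: "canon w" "canon w'" by (auto simp: codes_def)
      note t = realizes_tiling[OF R[OF c(1)]] realizes_tiling[OF R[OF c(2)]]
      obtain f where "eqv f (R w) (R w')" using w(3) rect_class_eq_iff[OF t] comb_equiv_iff[OF t] by blast
      then show "w = w'" by (rule realizes_unique[OF c R[OF c(1)] R[OF c(2)]])
    qed
    show "(\<lambda>w. rect_class (R w)) ` codes m r s = ?K"
    proof (intro set_eqI iffI)
      fix K assume "K \<in> (\<lambda>w. rect_class (R w)) ` codes m r s"
      then obtain w where w: "w \<in> codes m r s" "K = rect_class (R w)" by blast
      then have "realizes (R w) w" using R by (simp add: codes_def)
      then show "K \<in> ?K" using w realizes_tiling[of "R w" w] realizes_card[of "R w" w]
        unfolding codes_def by blast
    next
      fix K assume "K \<in> ?K"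
      then obtain T where T: "K = rect_class T" "is_tiling T" "card T = m" "card (right_hits T) = r"
        "card (singular_vertices T) = s" by blast
      obtain w where w: "canon w" "realizes T w" using ex_canon[OF T(2)] by blast
      have "w \<in> codes m r s" using w realizes_card[OF w(2)] T by (simp add: codes_def)
      moreover have "teq T (R w)" by (rule realizes_teq[OF w(2) R[OF w(1)]])
      then obtain f where "eqv f T (R w)" by (auto simp: teq_def)
      then have "rect_class (R w) = K" unfolding T(1)
        using rect_class_eq_iff comb_equiv_iff T(2) realizes_tiling[OF R[OF w(1)]] by metis
      ultimately show "K \<in> (\<lambda>w. rect_class (R w)) ` codes m r s" by blast
    qed
  qed
  then show ?thesis unfolding t_count_def by (simp add: bij_betw_same_card)
qed

section \<open>Counting codes\<close>

text \<open>A list of c words becomes one word with c - 1 separators \<open>None\<close>, so that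
  lists of patterns can be counted as permutations of a multiset. The empty word splits into one
  empty part, never into none.\<close>

fun join_words :: "'a list list \<Rightarrow> 'a option list" where
  "join_words [] = []"
| "join_words (p # ps) = map Some p @ (if ps = [] then [] else None # join_words ps)"

fun split_word :: "'a option list \<Rightarrow> 'a list list" where
  "split_word [] = [[]]"
| "split_word (None # u) = [] # split_word u"
| "split_word (Some a # u) = (a # hd (split_word u)) # tl (split_word u)"

lemma split_word_nonempty: "split_word u \<noteq> []"
  by (cases u rule: split_word.cases) auto

lemma split_word_append: "split_word (map Some p @ u) = (p @ hd (split_word u)) # tl (split_word u)"
  by (induction p) (auto simp: split_word_nonempty)

lemma split_join: "ps \<noteq> [] \<Longrightarrow> split_word (join_words ps) = ps"
proof (induction ps)
  case (Cons p ps)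
  then show ?case using split_word_append[of p "[]"] split_word_append[of p "None # join_words ps"]
    by auto
qed simp

lemma join_split: "join_words (split_word u) = u"
proof (induction u rule: split_word.induct)
  case (2 u) then show ?case using split_word_nonempty[of u] by simp
next
  case (3 a u)
  obtain p ps where "split_word u = p # ps" using split_word_nonempty[of u] by (cases "split_word u") auto
  then show ?case using 3 by simp
qed simp

lemma count_map_Some: "count_list (map Some p) (Some a) = count_list p a" "count_list (map Some p) None = 0"
  by (induction p) auto

lemma count_join_Some: "count_list (join_words ps) (Some a) = sum_list (map (\<lambda>p. count_list p a) ps)"
  by (induction ps) (auto simp: count_map_Some)

lemma count_join_None: "count_list (join_words ps) None = length ps - 1"
  by (induction ps) (auto simp: count_map_Some Suc_diff_1)

definition patterns :: "nat \<Rightarrow> nat \<Rightarrow> nat \<Rightarrow> nat \<Rightarrow> letter list list set" where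
  "patterns c a b d = {ps. length ps = c \<and> sum_list (map nL ps) = a \<and> sum_list (map nX ps) = b \<and>
     sum_list (map nR ps) = d}"

lemma UNIV_letter_option: "(UNIV :: letter option set) = {None, Some Lt, Some Cr, Some Rt}"
proof -
  have "x \<in> {None, Some Lt, Some Cr, Some Rt}" for x :: "letter option"
    by (cases x; cases "the x") auto
  then show ?thesis by blast
qed

text \<open>The joined words arrange k separators, a letters \<open>Lt\<close>, b letters
  \<open>Cr\<close> and d letters \<open>Rt\<close>, a multinomial count. It is factored by placing
  the separators among the symbols other than \<open>Rt\<close>, the \<open>Cr\<close> among
  \<open>Lt\<close> and \<open>Cr\<close>, and finally all of these among the \<open>Rt\<close>.
  With c = k + 1 and l = a + b + c these are three of the four binomials of the recursion.\<close>

lemma card_patterns: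
  "card (patterns (Suc k) a b d) = ((a + b + k) choose k) * ((a + b) choose b) * ((d + (a + b + k)) choose (a + b + k))"
  and finite_patterns: "finite (patterns (Suc k) a b d)"
proof -
  define M where "M = replicate_mset k None + replicate_mset a (Some Lt) + replicate_mset b (Some Cr) +
    replicate_mset d (Some Rt)"
  have cM: "count M None = k" "count M (Some Lt) = a" "count M (Some Cr) = b" "count M (Some Rt) = d"
    by (auto simp: M_def)
  have mem: "u \<in> permutations_of_multiset M \<longleftrightarrow> count_list u None = k \<and> count_list u (Some Lt) = a \<and>
      count_list u (Some Cr) = b \<and> count_list u (Some Rt) = d" for u
  proof -
    have "u \<in> permutations_of_multiset M \<longleftrightarrow> (\<forall>x\<in>UNIV. count (mset u) x = count M x)"
      by (auto simp: permutations_of_multiset_def multiset_eq_iff)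
    then show ?thesis unfolding UNIV_letter_option by (simp add: cM count_mset)
  qed
  have bij: "bij_betw join_words (patterns (Suc k) a b d) (permutations_of_multiset M)"
  proof (rule bij_betwI[where g = split_word])
    show "join_words \<in> patterns (Suc k) a b d \<rightarrow> permutations_of_multiset M"
      by (auto simp: mem patterns_def count_join_Some count_join_None)
    show "split_word \<in> permutations_of_multiset M \<rightarrow> patterns (Suc k) a b d"
    proof
      fix u assume u: "u \<in> permutations_of_multiset M"
      have "length (split_word u) - 1 = k" using u count_join_None[of "split_word u"] by (simp add: mem join_split)
      then have "length (split_word u) = Suc k" using split_word_nonempty[of u] by (cases "split_word u") auto
      then show "split_word u \<in> patterns (Suc k) a b d"
        using u count_join_Some[of "split_word u"] by (simp add: patterns_def mem join_split)
    qed
    show "split_word (join_words ps) = ps" if "ps \<in> patterns (Suc k) a b d" for ps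
      using that by (intro split_join) (auto simp: patterns_def)
    show "join_words (split_word u) = u" for u by (rule join_split)
  qed
  show "finite (patterns (Suc k) a b d)" using bij_betw_finite[OF bij] by simp
  have fin_UNIV: "finite (UNIV :: letter option set)" unfolding UNIV_letter_option by simp
  have "(\<Prod>x\<in>set_mset M. fact (count M x)) = (\<Prod>x\<in>UNIV. fact (count M x) :: nat)"
    by (rule prod.mono_neutral_left) (use fin_UNIV in \<open>auto simp: not_in_iff\<close>)
  also have "\<dots> = fact k * fact a * fact b * fact d" unfolding UNIV_letter_option by (simp add: cM)
  finally have P: "(\<Prod>x\<in>set_mset M. fact (count M x)) = (fact k * fact a * fact b * fact d :: nat)" .
  have "card (patterns (Suc k) a b d) * (fact k * fact a * fact b * fact d) = (fact (k + a + b + d) :: nat)"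
    using card_permutations_of_multiset_aux[of M] bij_betw_same_card[OF bij] P by (simp add: M_def)
  moreover have "((a + b + k) choose k) * ((a + b) choose b) * ((d + (a + b + k)) choose (a + b + k)) *
      (fact k * fact a * fact b * fact d) = (fact (k + a + b + d) :: nat)"
  proof -
    have 1: "fact k * fact (a + b) * ((a + b + k) choose k) = (fact (a + b + k) :: nat)"
      using binomial_fact_lemma[of k "a + b + k"] by simp
    have 2: "fact b * fact a * ((a + b) choose b) = (fact (a + b) :: nat)"
      using binomial_fact_lemma[of b "a + b"] by simp
    have 3: "fact (a + b + k) * fact d * ((d + (a + b + k)) choose (a + b + k)) = (fact (d + (a + b + k)) :: nat)"
      using binomial_fact_lemma[of "a + b + k" "d + (a + b + k)"] by simp
    have "(fact (k + a + b + d) :: nat) = fact (d + (a + b + k))" by (rule arg_cong[of _ _ fact]) simp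
    also have "\<dots> = fact k * (fact b * fact a * ((a + b) choose b)) * ((a + b + k) choose k) * fact d *
        ((d + (a + b + k)) choose (a + b + k))"
      by (simp only: 2 1 3)
    finally show ?thesis by (simp add: mult_ac)
  qed
  ultimately show "card (patterns (Suc k) a b d) =
      ((a + b + k) choose k) * ((a + b) choose b) * ((d + (a + b + k)) choose (a + b + k))"
    by (metis fact_nonzero mult_cancel2 mult_eq_0_iff)
qed

text \<open>Stars and bars: the slack is prepended as one more summand, which turns the inequality
  into an equation.\<close>

lemma card_sum_list_le:
  "card {gs :: nat list. length gs = c \<and> sum_list gs \<le> n} = (n + c) choose c"
  "finite {gs :: nat list. length gs = c \<and> sum_list gs \<le> n}"
proof -
  have bij: "bij_betw (\<lambda>gs. (n - sum_list gs) # gs) {gs :: nat list. length gs = c \<and> sum_list gs \<le> n}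
      {gs. length gs = Suc c \<and> sum_list gs = n}"
    by (rule bij_betwI[where g = tl]) (auto simp: length_Suc_conv)
  have "{gs :: nat list. length gs = Suc c \<and> sum_list gs = n} \<subseteq> {gs. set gs \<subseteq> {..n} \<and> length gs = Suc c}"
    using member_le_sum_list by fastforce
  then have "finite {gs :: nat list. length gs = Suc c \<and> sum_list gs = n}"
    by (rule finite_subset) (simp add: finite_lists_length_eq)
  then show "finite {gs :: nat list. length gs = c \<and> sum_list gs \<le> n}" using bij_betw_finite[OF bij] by simp
  show "card {gs :: nat list. length gs = c \<and> sum_list gs \<le> n} = (n + c) choose c"
    using bij_betw_same_card[OF bij] card_length_sum_list[of "Suc c" n] binomial_symmetric[of c "n + c"] by simp
qed

text \<open>A family of pairwise separated blocks on the right side is a list of pairs \<open>(g, p)\<close>: \<open>p\<close> is the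
  pattern of the block and \<open>g\<close> the number of levels skipped since the end of the previous block.\<close>

type_synonym family = "(nat \<times> letter list) list"

text \<open>The number of levels up to and including the upper end of the last block. The 2 stands
  for the two ends of each block, which separated blocks do not share.\<close>

definition fspan :: "family \<Rightarrow> nat" where
  "fspan B = sum_list (map (\<lambda>(g, p). g + nL p + nX p + 2) B)"
definition fL :: "family \<Rightarrow> nat" where "fL B = sum_list (map (nL \<circ> snd) B)"
definition fR :: "family \<Rightarrow> nat" where "fR B = sum_list (map (nR \<circ> snd) B)"
definition fX :: "family \<Rightarrow> nat" where "fX B = sum_list (map (nX \<circ> snd) B)"

lemma family_simps [simp]:
  "fspan [] = 0" "fL [] = 0" "fR [] = 0" "fX [] = 0"
  "fspan ((g, p) # B) = g + nL p + nX p + 2 + fspan B"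
  "fL ((g, p) # B) = nL p + fL B" "fR ((g, p) # B) = nR p + fR B" "fX ((g, p) # B) = nX p + fX B"
  by (simp_all add: fspan_def fL_def fR_def fX_def)

lemma fspan_eq: "fspan B = sum_list (map fst B) + fL B + fX B + 2 * length B"
  by (induction B) auto

definition families :: "nat \<Rightarrow> nat \<Rightarrow> nat \<Rightarrow> nat \<Rightarrow> nat \<Rightarrow> family set" where
  "families c rb a b d = {B. length B = c \<and> fspan B \<le> rb + 2 \<and> fL B = a \<and> fX B = b \<and> fR B = d}"

text \<open>Gaps and patterns are independent. The blocks use a + b + 2 * c levels, and the rest of
  the rb + 2 levels is distributed over the c gaps and the part above the last block. This is the
  remaining binomial of the recursion.\<close>

lemma card_families:
  assumes "c = Suc k"
  shows "card (families c rb a b d) = (if a + b + 2 * c \<le> rb + 2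
      then ((rb + 2 - (a + b + c)) choose c) * card (patterns c a b d) else 0)"
    and "finite (families c rb a b d)"
proof -
  let ?G = "{gs :: nat list. length gs = c \<and> sum_list gs \<le> rb + 2 - (a + b + 2 * c)}"
  have *: "card (families c rb a b d) = (if a + b + 2 * c \<le> rb + 2
      then ((rb + 2 - (a + b + c)) choose c) * card (patterns c a b d) else 0) \<and> finite (families c rb a b d)"
  proof (cases "a + b + 2 * c \<le> rb + 2")
    case True
    have bij: "bij_betw (\<lambda>B. (map fst B, map snd B)) (families c rb a b d) (?G \<times> patterns c a b d)"
    proof (rule bij_betwI[where g = "\<lambda>(gs, ps). zip gs ps"])
      show "(\<lambda>B. (map fst B, map snd B)) \<in> families c rb a b d \<rightarrow> ?G \<times> patterns c a b d"
        by (auto simp: families_def patterns_def fspan_eq fL_def fX_def fR_def o_def)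
      show "(\<lambda>(gs, ps). zip gs ps) \<in> ?G \<times> patterns c a b d \<rightarrow> families c rb a b d"
      proof
        fix x assume "x \<in> ?G \<times> patterns c a b d"
        then obtain gs ps where x: "x = (gs, ps)" "gs \<in> ?G" "ps \<in> patterns c a b d" by blast
        then have l: "length gs = length ps" by (auto simp: patterns_def)
        have f: "fL (zip gs ps) = sum_list (map nL ps)" "fX (zip gs ps) = sum_list (map nX ps)"
          "fR (zip gs ps) = sum_list (map nR ps)"
          using l by (simp_all add: fL_def fX_def fR_def map_map[symmetric] del: map_map)
        show "(\<lambda>(gs, ps). zip gs ps) x \<in> families c rb a b d"
          using x l True f by (auto simp: families_def fspan_eq patterns_def)
      qed
      show "(\<lambda>(gs, ps). zip gs ps) (map fst B, map snd B) = B" for B :: family by (simp add: zip_map_fst_snd)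
      show "(map fst ((\<lambda>(gs, ps). zip gs ps) x), map snd ((\<lambda>(gs, ps). zip gs ps) x)) = x"
        if "x \<in> ?G \<times> patterns c a b d" for x
        using that by (auto simp: patterns_def)
    qed
    have "finite (?G \<times> patterns c a b d)"
      using card_sum_list_le(2) finite_patterns by (simp add: assms)
    moreover have "rb + 2 - (a + b + 2 * c) + c = rb + 2 - (a + b + c)" using True by simp
    ultimately show ?thesis using bij_betw_same_card[OF bij] bij_betw_finite[OF bij] True
      card_sum_list_le(1)[of c "rb + 2 - (a + b + 2 * c)"] by (simp add: card_cartesian_product)
  next
    case False
    then have "families c rb a b d = {}" by (auto simp: families_def fspan_eq)
    then show ?thesis using False by simp
  qed
  then show "card (families c rb a b d) = (if a + b + 2 * c \<le> rb + 2
      then ((rb + 2 - (a + b + c)) choose c) * card (patterns c a b d) else 0)"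
    and "finite (families c rb a b d)" by blast+
qed

text \<open>The sets behind the numbers \<open>F c\<close> of the overview, as
  \<open>glued_canon\<close> is for \<open>H c\<close>. The last three conditions prescribe the
  numbers of the glued rectangulation, written as sums to avoid truncated subtraction.\<close>

definition glued :: "nat \<Rightarrow> nat \<Rightarrow> nat \<Rightarrow> nat \<Rightarrow> (code \<times> family) set" where
  "glued c m r s = {(w, B). canon w \<and> length B = c \<and> fspan B \<le> nhits w + 2 \<and>
     ntiles w + c + fR B + fX B = m \<and> nhits w + fR B = r + fL B \<and> nsing w + fX B = s}"

definition glued_canon :: "nat \<Rightarrow> nat \<Rightarrow> nat \<Rightarrow> nat \<Rightarrow> (code \<times> family) set" where
  "glued_canon c m r s = {(w, B) \<in> glued c m r s. \<forall>j. top_index w = Some j \<longrightarrow> fst (hd B) \<le> j}"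

lemma canon_nhits_less: "canon w \<Longrightarrow> nhits w < ntiles w"
  by (induction w) auto

lemma length_letters: "length p = nL p + nR p + nX p"
proof (induction p)
  case (Cons a p) then show ?case by (cases a) auto
qed simp

lemma finite_words: "finite {p :: letter list. length p \<le> n}"
proof -
  have "UNIV = {Lt, Rt, Cr}" by (metis (full_types) UNIV_eq_I insertCI letter.exhaust)
  then have "finite (UNIV :: letter set)" by (metis finite.emptyI finite_insert)
  then show ?thesis using finite_lists_length_le[of UNIV n] by simp
qed

lemma finite_canon: "finite {w. canon w \<and> ntiles w \<le> m}"
proof (induction m)
  case 0
  have "ntiles w > 0" for w by (cases w) auto
  then have "{w. canon w \<and> ntiles w \<le> 0} = {}" by auto
  then show ?case by (simp only: finite.emptyI)
next
  case (Suc m)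
  let ?A = "{w. canon w \<and> ntiles w \<le> m}"
  \<comment> \<open>A pattern has at most m letters \<open>Rt\<close> and \<open>Cr\<close>, as each
    adds a tile, and at most m letters \<open>Lt\<close>, which are bounded by the hits of the
    smaller code; hence the length 2 * m.\<close>
  have "{w. canon w \<and> ntiles w \<le> Suc m} \<subseteq> Strips ` {..m} \<union>
      (\<lambda>(w, i, p). Glue w i p) ` (?A \<times> {..m} \<times> {p. length p \<le> 2 * m})"
  proof
    fix w assume "w \<in> {w. canon w \<and> ntiles w \<le> Suc m}"
    then have w: "canon w" "ntiles w \<le> Suc m" by auto
    show "w \<in> Strips ` {..m} \<union> (\<lambda>(w, i, p). Glue w i p) ` (?A \<times> {..m} \<times> {p. length p \<le> 2 * m})"
    proof (cases w)
      case (Strips k) then show ?thesis using w by auto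
    next
      case (Glue w0 i p)
      then have "canon w0" "ntiles w0 + nR p + nX p \<le> m" "i + nL p + nX p \<le> nhits w0" using w by auto
      moreover have "nhits w0 < ntiles w0" by (rule canon_nhits_less) fact
      ultimately have "(w0, i, p) \<in> ?A \<times> {..m} \<times> {p. length p \<le> 2 * m}" using length_letters[of p] by auto
      then show ?thesis using Glue by force
    qed
  qed
  moreover have "finite (Strips ` {..m} \<union> (\<lambda>(w, i, p). Glue w i p) ` (?A \<times> {..m} \<times> {p. length p \<le> 2 * m}))"
    using Suc finite_words by (intro finite_UnI finite_imageI finite_cartesian_product) auto
  ultimately show ?case by (rule finite_subset)
qed

lemma finite_codes: "finite (codes m r s)"
  by (rule finite_subset[OF _ finite_canon[of m]]) (auto simp: codes_def)

text \<open>The map turns the lowest block of the family into the last block of the code; the first gap of the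
  remaining family is then counted from the bottom again.\<close>

lemma glued_step:
  assumes "c \<ge> 1"
  shows "bij_betw (\<lambda>(w, B). (Glue w (fst (hd B)) (snd (hd B)),
      (fst (hd (tl B)) + (fst (hd B) + 1 + nR (snd (hd B)) + nX (snd (hd B))) + 1, snd (hd (tl B))) # tl (tl B)))
    (glued_canon (Suc c) m r s) (glued c m r s - glued_canon c m r s)" (is "bij_betw ?f ?A ?B")
proof -
  \<comment> \<open>The gap of the next block is counted again from the upper end of the removed
    one, whose rank is \<open>i + 1 + nR p + nX p\<close>; the further 1 is for that level itself.
    On \<open>Strips\<close> the value is a default.\<close>
  define G where "G = (\<lambda>(w, B :: family). case w of Strips k \<Rightarrow> (w, B) | Glue w0 i p \<Rightarrow>
    (w0, (i, p) # (fst (hd B) - (i + 1 + nR p + nX p) - 1, snd (hd B)) # tl B))"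
  show ?thesis
  proof (rule bij_betwI[where g = G])
    show "?f \<in> ?A \<rightarrow> ?B"
    proof
      fix x assume x: "x \<in> ?A"
      obtain w B where xe: "x = (w, B)" by fastforce
      obtain i p g q B' where B: "B = (i, p) # (g, q) # B'"
        using x assms xe by (auto simp: glued_canon_def glued_def length_Suc_conv neq_Nil_conv Suc_le_eq gr0_conv_Suc)
      show "?f x \<in> ?B" using x unfolding xe B by (auto simp: glued_canon_def glued_def)
    qed
    show "G \<in> ?B \<rightarrow> ?A"
    proof
      fix x assume x: "x \<in> ?B"
      obtain w B where xe: "x = (w, B)" by fastforce
      obtain g q B' where B: "B = (g, q) # B'"
        using x assms xe by (cases B) (auto simp: glued_def)
      obtain w0 i p where w: "w = Glue w0 i p" using x xe by (cases w) (auto simp: glued_canon_def)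
      \<comment> \<open>This is the failure of the condition in \<open>glued_canon\<close>; it makes
        the subtractions in \<open>G\<close> exact.\<close>
      have "i + 1 + nR p + nX p < g" using x unfolding xe B w by (auto simp: glued_canon_def)
      then show "G x \<in> ?A" using x unfolding xe B w by (auto simp: glued_canon_def glued_def G_def)
    qed
    show "G (?f x) = x" if x: "x \<in> ?A" for x
    proof -
      obtain w B where xe: "x = (w, B)" by fastforce
      obtain i p g q B' where B: "B = (i, p) # (g, q) # B'"
        using x assms xe by (auto simp: glued_canon_def glued_def length_Suc_conv neq_Nil_conv Suc_le_eq gr0_conv_Suc)
      show ?thesis by (simp add: xe B G_def)
    qed
    show "?f (G x) = x" if x: "x \<in> ?B" for x
    proof -
      obtain w B where xe: "x = (w, B)" by fastforce
      obtain g q B' where B: "B = (g, q) # B'"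
        using x assms xe by (cases B) (auto simp: glued_def)
      obtain w0 i p where w: "w = Glue w0 i p" using x xe by (cases w) (auto simp: glued_canon_def)
      have "i + 1 + nR p + nX p < g" using x unfolding xe B w by (auto simp: glued_canon_def)
      then show ?thesis by (simp add: xe B w G_def)
    qed
  qed
qed

section \<open>Cardinalities and the alternating sum\<close>

lemma glued_eq_UN:
  assumes "c \<ge> 1"
  shows "glued c m r s = (\<Union>(mb, rb, sb)\<in>{1..m-1} \<times> {0..m-1} \<times> {0..s}.
    {(w, B). w \<in> codes mb rb sb \<and> length B = c \<and> fspan B \<le> rb + 2 \<and> mb + c + fR B + fX B = m \<and>
      rb + fR B = r + fL B \<and> sb + fX B = s})"
proof (intro set_eqI iffI)
  fix x assume x: "x \<in> glued c m r s"
  obtain w B where xe: "x = (w, B)" by fastforce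
  have w: "canon w" "ntiles w + c + fR B + fX B = m" "nsing w + fX B = s" using x by (auto simp: xe glued_def)
  have "0 < ntiles w" by (cases w) auto
  then have "(ntiles w, nhits w, nsing w) \<in> {1..m-1} \<times> {0..m-1} \<times> {0..s}"
    using w canon_nhits_less[OF w(1)] assms by auto
  then show "x \<in> (\<Union>(mb, rb, sb)\<in>{1..m-1} \<times> {0..m-1} \<times> {0..s}.
    {(w, B). w \<in> codes mb rb sb \<and> length B = c \<and> fspan B \<le> rb + 2 \<and> mb + c + fR B + fX B = m \<and>
      rb + fR B = r + fL B \<and> sb + fX B = s})"
    by (rule UN_I) (use x in \<open>simp add: xe glued_def codes_def\<close>)
qed (auto simp: glued_def codes_def)

definition ways :: "nat \<Rightarrow> nat \<Rightarrow> nat \<Rightarrow> nat \<Rightarrow> nat \<Rightarrow> nat \<Rightarrow> nat \<Rightarrow> family set" where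
  "ways c m r s mb rb sb = {B. length B = c \<and> fspan B \<le> rb + 2 \<and> mb + c + fR B + fX B = m \<and>
      rb + fR B = r + fL B \<and> sb + fX B = s}"

text \<open>The number of crossings is the increase in singular vertices; the tile count then fixes
  the letters \<open>Rt\<close>, and the hits fix the letters \<open>Lt\<close>.\<close>

lemma ways_families:
  assumes "mb + c + (s - sb) \<le> m" "sb \<le> s" "r \<le> rb + (m - (mb + c + (s - sb)))"
  shows "ways c m r s mb rb sb =
    families c rb (rb + (m - (mb + c + (s - sb))) - r) (s - sb) (m - (mb + c + (s - sb)))"
  using assms by (auto simp: ways_def families_def)

lemma ways_empty:
  assumes "\<not> (mb + c + (s - sb) \<le> m \<and> sb \<le> s \<and> r \<le> rb + (m - (mb + c + (s - sb))))"
  shows "ways c m r s mb rb sb = {}"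
  using assms by (auto simp: ways_def)

lemma finite_ways: "c \<ge> 1 \<Longrightarrow> finite (ways c m r s mb rb sb)"
  using ways_families[of mb c s sb m r rb] ways_empty[of mb c s sb m r rb] card_families(2)[of c "c - 1"]
  by (cases "mb + c + (s - sb) \<le> m \<and> sb \<le> s \<and> r \<le> rb + (m - (mb + c + (s - sb)))") auto

lemma card_ways:
  fixes m r s mb rb sb c :: nat
  assumes "c \<ge> 1" "sb \<le> s"
  defines "ds \<equiv> int s - int sb" and "dm \<equiv> int m - int mb" and "dr \<equiv> int r - int rb"
  defines "l \<equiv> dm - dr"
  shows "int (card (ways c m r s mb rb sb)) = binom (l - 1) (int c - 1) * binom (int rb + 2 - l) (int c)
      * binom (l - int c) ds * binom (dm - int c - ds + l - 1) (l - 1)"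
proof (cases "mb + c + (s - sb) \<le> m \<and> r \<le> rb + (m - (mb + c + (s - sb)))")
  case True
  define b where "b = s - sb"
  define d where "d = m - (mb + c + b)"
  define a where "a = rb + d - r"
  obtain k where k: "c = Suc k" using assms(1) by (cases c) auto
  have "s = sb + b" "m = mb + c + b + d" "rb + d = r + a"
    using True assms(2) by (auto simp: a_def b_def d_def)
  \<comment> \<open>Tiles increase by c + b + d and hits by d - a, so their difference l is a + b +
    c.\<close>
  then have e: "ds = int b" "l = int (a + b + c)" "dm - int c - ds = int d"
    by (auto simp: ds_def l_def dm_def dr_def)
  have W: "ways c m r s mb rb sb = families c rb a b d"
    unfolding a_def b_def d_def using True assms(2) by (intro ways_families) auto
  have b3: "binom (l - int c) ds = int ((a + b) choose b)"
  proof -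
    have "l - int c = int (a + b)" using e by simp
    then show ?thesis unfolding binom_def e(1) by (simp only: nat_int of_nat_0_le_iff if_True simp_thms)
  qed
  have b4: "binom (dm - int c - ds + l - 1) (l - 1) = int ((d + (a + b + k)) choose (a + b + k))"
  proof -
    have "dm - int c - ds + l - 1 = int (d + (a + b + k))" "l - 1 = int (a + b + k)" using e k by auto
    then show ?thesis unfolding binom_def by (simp only: nat_int of_nat_0_le_iff if_True simp_thms)
  qed
  have b1: "binom (l - 1) (int c - 1) = int ((a + b + k) choose k)"
  proof -
    have "l - 1 = int (a + b + k)" "int c - 1 = int k" using e k by auto
    then show ?thesis unfolding binom_def by (simp only: nat_int of_nat_0_le_iff if_True simp_thms)
  qed
  \<comment> \<open>Too few levels make the binomial vanish: its upper entry is then smaller than c,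
    or negative, where \<open>binom\<close> is 0 by convention.\<close>
  have b2: "binom (int rb + 2 - l) (int c) =
      (if a + b + 2 * c \<le> rb + 2 then int ((rb + 2 - (a + b + c)) choose c) else 0)"
  proof (cases "a + b + c \<le> rb + 2")
    case True
    then have "int rb + 2 - l = int (rb + 2 - (a + b + c))" using e by auto
    then have "binom (int rb + 2 - l) (int c) = int ((rb + 2 - (a + b + c)) choose c)"
      unfolding binom_def by (simp only: nat_int of_nat_0_le_iff if_True simp_thms)
    moreover have "rb + 2 - (a + b + c) < c" if "\<not> a + b + 2 * c \<le> rb + 2"
      using that True k by arith
    ultimately show ?thesis by (simp add: binomial_eq_0_iff)
  next
    case False
    then show ?thesis using e by (auto simp: binom_def)
  qed
  show ?thesis unfolding W card_families(1)[OF k] b1 b2 b3 b4 by (simp add: k card_patterns)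
next
  case False
  then have W: "ways c m r s mb rb sb = {}" by (intro ways_empty) auto
  show ?thesis
  proof (cases "mb + c + (s - sb) \<le> m")
    case True
    \<comment> \<open>The number of letters \<open>Lt\<close> would be negative, and the third
      binomial vanishes.\<close>
    then have "l - int c < ds" using False assms(2) by (auto simp: l_def ds_def dm_def dr_def)
    then have "binom (l - int c) ds = 0" by (auto simp: binom_def binomial_eq_0_iff)
    then show ?thesis by (simp add: W)
  next
    case f: False
    \<comment> \<open>The number of letters \<open>Rt\<close> would be negative, and the last
      binomial vanishes.\<close>
    then have "dm - int c - ds + l - 1 < l - 1" using assms(2) by (auto simp: ds_def dm_def)
    then have "binom (dm - int c - ds + l - 1) (l - 1) = 0" by (auto simp: binom_def binomial_eq_0_iff)
    then show ?thesis by (simp add: W)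
  qed
qed

text \<open>Each block occupies at least its two end levels out of rb + 2.\<close>

lemma ways_bound: "B \<in> ways c m r s mb rb sb \<Longrightarrow> 2 * c \<le> rb + 2"
  by (auto simp: ways_def fspan_eq)

lemma card_glued:
  assumes "c \<ge> 1"
  shows "card (glued c m r s) =
    (\<Sum>mb\<in>{1..m-1}. \<Sum>rb\<in>{0..m-1}. \<Sum>sb\<in>{0..s}. card (codes mb rb sb) * card (ways c m r s mb rb sb))"
    and "finite (glued c m r s)"
proof -
  let ?I = "{1..m-1} \<times> {0..m-1} \<times> {0..s}"
  let ?S = "\<lambda>(mb, rb, sb). codes mb rb sb \<times> ways c m r s mb rb sb"
  have eq: "glued c m r s = (\<Union>i\<in>?I. ?S i)"
    unfolding glued_eq_UN[OF assms] by (intro SUP_cong) (auto simp: ways_def)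
  have fin: "\<forall>i\<in>?I. finite (?S i)" using finite_codes finite_ways[OF assms] by auto
  show "finite (glued c m r s)" unfolding eq using fin by (intro finite_UN_I) auto
  have disj: "\<forall>i\<in>?I. \<forall>j\<in>?I. i \<noteq> j \<longrightarrow> ?S i \<inter> ?S j = {}" by (auto simp: codes_def)
  have "card (glued c m r s) = (\<Sum>i\<in>?I. card (?S i))"
    unfolding eq by (rule card_UN_disjoint[OF _ fin disj]) auto
  also have "\<dots> = (\<Sum>(mb, rb, sb)\<in>?I. card (codes mb rb sb) * card (ways c m r s mb rb sb))"
    by (intro sum.cong) (auto simp: card_cartesian_product)
  finally show "card (glued c m r s) =
    (\<Sum>mb\<in>{1..m-1}. \<Sum>rb\<in>{0..m-1}. \<Sum>sb\<in>{0..s}. card (codes mb rb sb) * card (ways c m r s mb rb sb))"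
    by (simp add: sum.cartesian_product)
qed

lemma glued_recursion:
  assumes "c \<ge> 1"
  shows "card (glued c m r s) = card (glued_canon c m r s) + card (glued_canon (Suc c) m r s)"
proof -
  have sub: "glued_canon c m r s \<subseteq> glued c m r s" by (auto simp: glued_canon_def)
  have fin: "finite (glued c m r s)" by (rule card_glued(2)[OF assms])
  have "card (glued_canon (Suc c) m r s) = card (glued c m r s - glued_canon c m r s)"
    by (rule bij_betw_same_card[OF glued_step[OF assms]])
  then show ?thesis using card_Diff_subset[OF finite_subset[OF sub fin] sub] card_mono[OF fin sub] by simp
qed

text \<open>Iterates \<open>H c = F c - H (c + 1)\<close>; the last term is the remainder after n
  steps.\<close>

lemma glued_alternating:
  "int (card (glued_canon 1 m r s)) =
    (\<Sum>c\<in>{1..n}. (-1) ^ (c + 1) * int (card (glued c m r s))) + (-1) ^ n * int (card (glued_canon (Suc n) m r s))"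
proof (induction n)
  case (Suc n)
  have "int (card (glued (Suc n) m r s)) = int (card (glued_canon (Suc n) m r s)) + int (card (glued_canon (Suc (Suc n)) m r s))"
    using glued_recursion[of "Suc n" m r s] by simp
  then show ?case using Suc by (simp add: algebra_simps)
qed simp

text \<open>Each block adds at least one tile, so the remainder vanishes once there are more blocks
  than tiles.\<close>

lemma glued_canon_empty: "glued_canon (Suc m) m r s = {}"
  by (auto simp: glued_canon_def glued_def)

text \<open>A stack has r = m - 1 and s = 0, so for other parameters every code ends with a gluing,
  and the condition in \<open>canon\<close> on that last block is the one in
  \<open>glued_canon\<close>.\<close>

lemma codes_glued_canon:
  assumes "\<not> (r = m - 1 \<and> s = 0)"
  shows "card (codes m r s) = card (glued_canon 1 m r s)"
proof (rule bij_betw_same_card[symmetric])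
  define G where "G = (\<lambda>w. case w of Strips k \<Rightarrow> (w, []) | Glue w0 i p \<Rightarrow> (w0, [(i, p)]))"
  show "bij_betw (\<lambda>(w, B). Glue w (fst (hd B)) (snd (hd B))) (glued_canon 1 m r s) (codes m r s)"
  proof (rule bij_betwI[where g = G])
    have one: "\<exists>w i p. x = (w, [(i, p)])" if "x \<in> glued_canon 1 m r s" for x
      using that by (auto simp: glued_canon_def glued_def length_Suc_conv)
    show "(\<lambda>(w, B). Glue w (fst (hd B)) (snd (hd B))) \<in> glued_canon 1 m r s \<rightarrow> codes m r s"
    proof
      fix x assume x: "x \<in> glued_canon 1 m r s"
      obtain w i p where "x = (w, [(i, p)])" using one[OF x] by blast
      then show "(\<lambda>(w, B). Glue w (fst (hd B)) (snd (hd B))) x \<in> codes m r s"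
        using x by (auto simp: glued_canon_def glued_def codes_def)
    qed
    have g: "\<exists>w0 i p. w = Glue w0 i p" if "w \<in> codes m r s" for w
      using that assms by (cases w) (auto simp: codes_def)
    show "G \<in> codes m r s \<rightarrow> glued_canon 1 m r s"
    proof
      fix w assume w: "w \<in> codes m r s"
      obtain w0 i p where "w = Glue w0 i p" using g[OF w] by blast
      then show "G w \<in> glued_canon 1 m r s" using w by (auto simp: G_def glued_canon_def glued_def codes_def)
    qed
    show "G ((\<lambda>(w, B). Glue w (fst (hd B)) (snd (hd B))) x) = x" if "x \<in> glued_canon 1 m r s" for x
      using one[OF that] by (auto simp: G_def)
    show "(\<lambda>(w, B). Glue w (fst (hd B)) (snd (hd B))) (G w) = w" if "w \<in> codes m r s" for w
      using g[OF that] by (auto simp: G_def)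
  qed
qed

text \<open>Each gluing raises the excess of tiles over hits by \<open>1 + nL p + nX p\<close>, so
  an excess of 1 is left to the stacks.\<close>

lemma nhits_ntiles: "canon w \<Longrightarrow> ntiles w = nhits w + 1 \<Longrightarrow> \<exists>k. w = Strips k"
proof (cases w)
  case (Glue w0 i p)
  assume "canon w" "ntiles w = nhits w + 1"
  then show ?thesis using canon_nhits_less[of w0] Glue by auto
qed auto

lemma codes_base: "k \<ge> 1 \<Longrightarrow> codes k (k - 1) 0 = {Strips (k - 1)}"
  using nhits_ntiles by (fastforce simp: codes_def)

lemma codes_nhits: "mb \<le> rb \<Longrightarrow> codes mb rb sb = {}"
  using canon_nhits_less by (force simp: codes_def)

theorem theorem2:
  shows "(\<forall>k::nat. k \<ge> 1 \<longrightarrow> t_count k (k - 1) 0 = 1) \<and>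
    (\<forall>m r s :: nat. m \<ge> 1 \<and> \<not> (r = m - 1 \<and> s = 0) \<longrightarrow>
      int (t_count m r s) =
      (\<Sum>mb\<in>{1..m-1}. \<Sum>rb\<in>{0..mb-1}. \<Sum>sb\<in>{0..s}.
         \<Sum>c\<in>{1..nat \<lceil>(real rb + 1) / 2\<rceil>}.
           (let ds = int s - int sb; dm = int m - int mb; dr = int r - int rb; l = dm - dr
            in (-1) ^ (c + 1) * binom (l - 1) (int c - 1) * binom (int rb + 2 - l) (int c)
               * binom (l - int c) ds * binom (dm - int c - ds + l - 1) (l - 1)
               * int (t_count mb rb sb))))"
proof (intro conjI allI impI)
  fix k :: nat assume "k \<ge> 1"
  then show "t_count k (k - 1) 0 = 1" unfolding t_count_codes by (subst codes_base) auto
next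
  fix m r s :: nat assume a: "m \<ge> 1 \<and> \<not> (r = m - 1 \<and> s = 0)"
  define t where "t c mb rb sb = (-1) ^ (c + 1) * int (card (ways c m r s mb rb sb)) * int (card (codes mb rb sb))"
    for c mb rb sb
  have "int (t_count m r s) = int (card (glued_canon 1 m r s))"
    unfolding t_count_codes using codes_glued_canon[of r m s] a by simp
  \<comment> \<open>After m steps the remainder of the alternating sum is empty.\<close>
  also have "\<dots> = (\<Sum>c\<in>{1..m}. (-1) ^ (c + 1) * int (card (glued c m r s)))"
    using glued_alternating[of m r s m] by (simp add: glued_canon_empty)
  also have "\<dots> = (\<Sum>c\<in>{1..m}. \<Sum>mb\<in>{1..m-1}. \<Sum>rb\<in>{0..m-1}. \<Sum>sb\<in>{0..s}. t c mb rb sb)"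
  proof (rule sum.cong[OF refl])
    fix c assume "c \<in> {1..m}"
    then have c: "c \<ge> 1" by simp
    show "(-1) ^ (c + 1) * int (card (glued c m r s)) = (\<Sum>mb\<in>{1..m-1}. \<Sum>rb\<in>{0..m-1}. \<Sum>sb\<in>{0..s}. t c mb rb sb)"
      unfolding card_glued(1)[OF c] of_nat_sum sum_distrib_left t_def by (simp add: mult_ac)
  qed
  also have "\<dots> = (\<Sum>mb\<in>{1..m-1}. \<Sum>c\<in>{1..m}. \<Sum>rb\<in>{0..m-1}. \<Sum>sb\<in>{0..s}. t c mb rb sb)"
    by (rule sum.swap)
  also have "\<dots> = (\<Sum>mb\<in>{1..m-1}. \<Sum>rb\<in>{0..mb-1}. \<Sum>sb\<in>{0..s}.
      \<Sum>c\<in>{1..nat \<lceil>(real rb + 1) / 2\<rceil>}. t c mb rb sb)"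
  proof (rule sum.cong[OF refl])
    fix mb assume mb: "mb \<in> {1..m-1}"
    have "(\<Sum>c\<in>{1..m}. \<Sum>rb\<in>{0..m-1}. \<Sum>sb\<in>{0..s}. t c mb rb sb) =
        (\<Sum>rb\<in>{0..m-1}. \<Sum>c\<in>{1..m}. \<Sum>sb\<in>{0..s}. t c mb rb sb)" by (rule sum.swap)
    \<comment> \<open>A rectangulation has fewer hits than tiles, so the terms with
      \<open>rb\<close> at least \<open>mb\<close> vanish.\<close>
    also have "\<dots> = (\<Sum>rb\<in>{0..mb-1}. \<Sum>c\<in>{1..m}. \<Sum>sb\<in>{0..s}. t c mb rb sb)"
      by (rule sum.mono_neutral_right) (use mb in \<open>auto simp: t_def codes_nhits\<close>)
    also have "\<dots> = (\<Sum>rb\<in>{0..mb-1}. \<Sum>sb\<in>{0..s}. \<Sum>c\<in>{1..m}. t c mb rb sb)"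
      by (rule sum.cong[OF refl]) (rule sum.swap)
    also have "\<dots> = (\<Sum>rb\<in>{0..mb-1}. \<Sum>sb\<in>{0..s}. \<Sum>c\<in>{1..nat \<lceil>(real rb + 1) / 2\<rceil>}. t c mb rb sb)"
    proof (rule sum.cong[OF refl], rule sum.cong[OF refl])
      fix rb sb assume rb: "rb \<in> {0..mb-1}"
      \<comment> \<open>The rounded bound of the theorem is the bound from
        \<open>ways_bound\<close>, so shortening the range of c drops only zero terms.\<close>
      have ceil: "c \<le> nat \<lceil>(real rb + 1) / 2\<rceil> \<longleftrightarrow> 2 * c \<le> rb + 2" for c
      proof -
        have "c \<le> nat \<lceil>(real rb + 1) / 2\<rceil> \<longleftrightarrow> real c - 1 < (real rb + 1) / 2"
          by (simp add: le_nat_iff le_ceiling_iff)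
        also have "\<dots> \<longleftrightarrow> 2 * c \<le> rb + 2" by auto
        finally show ?thesis .
      qed
      have sub: "{1..nat \<lceil>(real rb + 1) / 2\<rceil>} \<subseteq> {1..m}"
      proof
        fix c assume "c \<in> {1..nat \<lceil>(real rb + 1) / 2\<rceil>}"
        then have "1 \<le> c" "2 * c \<le> rb + 2" using ceil[of c] by auto
        then show "c \<in> {1..m}" using rb mb by auto
      qed
      have zero: "t c mb rb sb = 0" if "c \<in> {1..m} - {1..nat \<lceil>(real rb + 1) / 2\<rceil>}" for c
      proof -
        have "\<not> 2 * c \<le> rb + 2" using that ceil[of c] by auto
        then have "ways c m r s mb rb sb = {}" using ways_bound by blast
        then show ?thesis by (simp add: t_def)
      qed
      show "(\<Sum>c\<in>{1..m}. t c mb rb sb) = (\<Sum>c\<in>{1..nat \<lceil>(real rb + 1) / 2\<rceil>}. t c mb rb sb)"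
        by (rule sum.mono_neutral_right[OF _ sub]) (use zero in auto)
    qed
    finally show "(\<Sum>c\<in>{1..m}. \<Sum>rb\<in>{0..m-1}. \<Sum>sb\<in>{0..s}. t c mb rb sb) =
      (\<Sum>rb\<in>{0..mb-1}. \<Sum>sb\<in>{0..s}. \<Sum>c\<in>{1..nat \<lceil>(real rb + 1) / 2\<rceil>}. t c mb rb sb)" .
  qed
  also have "\<dots> = (\<Sum>mb\<in>{1..m-1}. \<Sum>rb\<in>{0..mb-1}. \<Sum>sb\<in>{0..s}.
         \<Sum>c\<in>{1..nat \<lceil>(real rb + 1) / 2\<rceil>}.
           (let ds = int s - int sb; dm = int m - int mb; dr = int r - int rb; l = dm - dr
            in (-1) ^ (c + 1) * binom (l - 1) (int c - 1) * binom (int rb + 2 - l) (int c)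
               * binom (l - int c) ds * binom (dm - int c - ds + l - 1) (l - 1)
               * int (t_count mb rb sb)))"
  proof (intro sum.cong refl)
    fix mb rb sb c assume "sb \<in> {0..s}" "c \<in> {1..nat \<lceil>(real rb + 1) / 2\<rceil>}"
    then have "sb \<le> s" "c \<ge> 1" by auto
    then show "t c mb rb sb =
        (let ds = int s - int sb; dm = int m - int mb; dr = int r - int rb; l = dm - dr
            in (-1) ^ (c + 1) * binom (l - 1) (int c - 1) * binom (int rb + 2 - l) (int c)
               * binom (l - int c) ds * binom (dm - int c - ds + l - 1) (l - 1)
               * int (t_count mb rb sb))"
      by (simp only: t_def Let_def card_ways t_count_codes mult.assoc)
  qed
  finally show "int (t_count m r s) = (\<Sum>mb\<in>{1..m-1}. \<Sum>rb\<in>{0..mb-1}. \<Sum>sb\<in>{0..s}.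
         \<Sum>c\<in>{1..nat \<lceil>(real rb + 1) / 2\<rceil>}.
           (let ds = int s - int sb; dm = int m - int mb; dr = int r - int rb; l = dm - dr
            in (-1) ^ (c + 1) * binom (l - 1) (int c - 1) * binom (int rb + 2 - l) (int c)
               * binom (l - int c) ds * binom (dm - int c - ds + l - 1) (l - 1)
               * int (t_count mb rb sb)))" .
qed

end
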